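(* Let $(M^2,g)$ be a $2$-dimensional oriented Riemannian manifold endowed with any $\mathrm{Spin}^c$ structure (with a connection on its auxiliary line bundle whose curvature form is $i\Omega$), let $D$ be the associated Dirac operator, and let $\psi$ be an eigenspinor of $D^2$ with eigenvalue $\lambda^2$, i.e. $D^2\psi=\lambda^2\psi$. Then, on the complement of the zero set of $\psi$, $$\lambda^2 = \frac{S}{4} + |T^\psi|^2 + |Q^\psi|^2 + \Delta f + |Y|^2 - 2Y(f) + \Big(\frac{i}{2}\,\Omega\cdot\psi, \frac{\psi}{|\psi|^2}\Big),$$ where $S$ is the scalar curvature of $M$, $f$ is the real-valued function $f=\frac12\ln|\psi|^2$, and $Y$ is the tangent vector field given by $g(Y,Z)=\frac{1}{|\psi|^2}\mathrm{Re}\,(D\psi, Z\cdot\psi)$ for every $Z\in\Gamma(TM)$.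
   Context: A $\mathrm{Spin}^c$ structure on an oriented Riemannian manifold $(M^n,g)$ without boundary consists of a $\mathrm{Spin}^c_n$-principal bundle $\mathrm{Spin}^cM$ over $M$, an $\mathbb S^1$-principal bundle $\mathbb S^1M$ over $M$, and a double covering $\theta:\mathrm{Spin}^cM\to \mathrm{SO}M\times_M\mathbb S^1M$ equivariant with respect to the $2$-fold covering $\mathrm{Spin}^c_n\to \mathrm{SO}_n\times\mathbb S^1$. The spinor bundle is $\Sigma M=\mathrm{Spin}^cM\times_{\rho_n}\Sigma_n$ with $\Sigma_n=\mathbb C^{2^{[n/2]}}$ and $\rho_n$ the complex spinor representation; it carries a natural Hermitian product $(\cdot,\cdot)$ and Clifford multiplication "$\cdot$", with $X\cdot X\cdot\psi=-|X|^2\psi$. A connection $1$-form on $\mathbb S^1M$, with curvature $i\Omega$ ($\Omega$ viewed as a real $2$-form on $M$; $i\Omega$ is the curvature form of the auxiliary line bundle associated with $\mathbb S^1M$), together with the Levi-Civita connection, induces a covariant derivative $\nabla$ on $\Gamma(\Sigma M)$. The Dirac operator is $D\psi=\sum_i e_i\cdot\nabla_{e_i}\psi$ for a local oriented orthonormal frame $(e_i)$. Clifford multiplication extends to $2$-forms by $(e_i^*\wedge e_j^* )\cdot\psi=e_i\cdot e_j\cdot\psi$ for $i\neq j$. On the complement of the zero set of $\psi$, for $X,Z\in\Gamma(TM)$, $$T^\psi(X,Z)=\tfrac12\mathrm{Re}\Big(X\cdot\nabla_Z\psi+Z\cdot\nabla_X\psi,\tfrac{\psi}{|\psi|^2}\Big),\qquad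 Q^\psi(X,Z)=\tfrac12\mathrm{Re}\Big(X\cdot\nabla_Z\psi-Z\cdot\nabla_X\psi,\tfrac{\psi}{|\psi|^2}\Big)$$ ($T^\psi$ is the symmetric Energy-Momentum tensor, $Q^\psi$ is skew-symmetric). Their norms are $|T^\psi|^2=\sum_{i,j}T^\psi(e_i,e_j)^2$ and $|Q^\psi|^2=\sum_{i,j}Q^\psi(e_i,e_j)^2$. The Laplacian on functions is the nonnegative one, $\Delta=-\mathrm{div}\,\mathrm{grad}$. *)

theory Defs
  imports "HOL-Analysis.Analysis"
begin

section \<open>Smooth maps, manifolds and tangent vectors\<close>

fun Ck_on :: "nat \<Rightarrow> ('e::euclidean_space) set \<Rightarrow> ('e \<Rightarrow> 'b::real_normed_vector) \<Rightarrow> bool" where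
  "Ck_on 0 W F \<longleftrightarrow> continuous_on W F"
| "Ck_on (Suc k) W F \<longleftrightarrow> (\<forall>y\<in>W. F differentiable (at y)) \<and>
     (\<forall>v. Ck_on k W (\<lambda>y. frechet_derivative F (at y) v))"

text \<open>Only used for open \<open>W\<close>.\<close>

definition smooth_on :: "('e::euclidean_space) set \<Rightarrow> ('e \<Rightarrow> 'b::real_normed_vector) \<Rightarrow> bool" where
  "smooth_on W F \<longleftrightarrow> (\<forall>k. Ck_on k W F)"

type_synonym ('a, 'n) chart = "'a set \<times> ('a \<Rightarrow> real ^ 'n)"
type_synonym ('a, 'n) atlas = "('a, 'n) chart set"

abbreviation chart_inv :: "('a, 'n) chart \<Rightarrow> real ^ 'n \<Rightarrow> 'a" where
  "chart_inv c \<equiv> inv_into (fst c) (snd c)"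

definition smooth_atlas :: "('a::topological_space, 'n::finite) atlas \<Rightarrow> bool" where
  "smooth_atlas A \<longleftrightarrow>
     (\<Union>c\<in>A. fst c) = UNIV \<and>
     (\<forall>c\<in>A. open (fst c) \<and> open (snd c ` fst c) \<and> inj_on (snd c) (fst c) \<and>
        continuous_on (fst c) (snd c) \<and> continuous_on (snd c ` fst c) (chart_inv c)) \<and>
     (\<forall>c\<in>A. \<forall>d\<in>A. smooth_on (snd c ` (fst c \<inter> fst d)) (snd d \<circ> chart_inv c))"

definition charts_at :: "('a, 'n) atlas \<Rightarrow> 'a \<Rightarrow> ('a, 'n) chart set" where
  "charts_at A x = {c \<in> A. x \<in> fst c}"

definition chart_at :: "('a, 'n) atlas \<Rightarrow> 'a \<Rightarrow> ('a, 'n) chart" where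
  "chart_at A x = (SOME c. c \<in> charts_at A x)"

text \<open>An orientation is given by an atlas whose changes of charts preserve the orientation
  of \<open>\<real>\<^sup>n\<close>.\<close>

definition oriented_atlas :: "('a::topological_space, 'n::finite) atlas \<Rightarrow> bool" where
  "oriented_atlas A \<longleftrightarrow> smooth_atlas A \<and>
     (\<forall>c\<in>A. \<forall>d\<in>A. \<forall>x\<in>fst c \<inter> fst d.
        det (matrix (frechet_derivative (snd d \<circ> chart_inv c) (at (snd c x)))) > 0)"

definition smooth_fun :: "('a, 'n::finite) atlas \<Rightarrow> 'a set \<Rightarrow> ('a \<Rightarrow> 'b::real_normed_vector) \<Rightarrow> bool" where
  "smooth_fun A W F \<longleftrightarrow> (\<forall>c\<in>A. smooth_on (snd c ` (fst c \<inter> W)) (F \<circ> chart_inv c))"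

text \<open>Smoothness of a map from an arbitrary subset of a Euclidean space to a manifold:
  locally, the map has a smooth extension to an open set. Arbitrary subsets are needed for
  maps defined on (open set) \<open>\<times>\<close> (Lie group), the group being embedded in a space of matrices.\<close>

definition smooth_into :: "('b, 'n::finite) atlas \<Rightarrow> ('e::euclidean_space) set \<Rightarrow> ('e \<Rightarrow> 'b) \<Rightarrow> bool" where
  "smooth_into B W F \<longleftrightarrow>
     (\<forall>z\<in>W. \<exists>N F'. open N \<and> z \<in> N \<and> (\<forall>y\<in>N \<inter> W. F' y = F y) \<and>
        (\<exists>c\<in>B. F' ` N \<subseteq> fst c \<and> smooth_on N (snd c \<circ> F')))"

definition smooth_map :: "('a, 'n::finite) atlas \<Rightarrow> ('b, 'k::finite) atlas \<Rightarrow> ('a \<Rightarrow> 'b) \<Rightarrow> bool" where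
  "smooth_map A B F \<longleftrightarrow> (\<forall>c\<in>A. smooth_into B (snd c ` fst c) (F \<circ> chart_inv c))"

text \<open>A tangent vector at \<open>x\<close> is the family of its coordinate vectors in all charts
  around \<open>x\<close>, related by the derivatives of the changes of charts (and 0 in the other
  charts).\<close>

type_synonym ('a, 'n) tvec = "('a, 'n) chart \<Rightarrow> real ^ 'n"

definition tangent_space :: "('a, 'n::finite) atlas \<Rightarrow> 'a \<Rightarrow> ('a, 'n) tvec set" where
  "tangent_space A x =
     {v. (\<forall>c. c \<notin> charts_at A x \<longrightarrow> v c = 0) \<and>
         (\<forall>c\<in>charts_at A x. \<forall>d\<in>charts_at A x.
            v d = frechet_derivative (snd d \<circ> chart_inv c) (at (snd c x)) (v c))}"

definition coord_vec :: "('a, 'n::finite) atlas \<Rightarrow> ('a, 'n) chart \<Rightarrow> 'a \<Rightarrow> real ^ 'n \<Rightarrow> ('a, 'n) tvec" where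
  "coord_vec A c x w =
     (\<lambda>d. if d \<in> charts_at A x
          then frechet_derivative (snd d \<circ> chart_inv c) (at (snd c x)) w else 0)"

definition tdiff :: "('a, 'n::finite) atlas \<Rightarrow> ('a \<Rightarrow> 'b::real_normed_vector) \<Rightarrow> 'a \<Rightarrow> ('a, 'n) tvec \<Rightarrow> 'b" where
  "tdiff A F x v = (let c = chart_at A x in
     frechet_derivative (F \<circ> chart_inv c) (at (snd c x)) (v c))"

definition push ::
    "('a, 'n::finite) atlas \<Rightarrow> ('b, 'k::finite) atlas \<Rightarrow> ('a \<Rightarrow> 'b) \<Rightarrow> 'a \<Rightarrow> ('a, 'n) tvec \<Rightarrow> ('b, 'k) tvec" where
  "push A B F x v = (\<lambda>d. if d \<in> charts_at B (F x) then tdiff A (snd d \<circ> F) x v else 0)"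


section \<open>Riemannian metrics and the Levi-Civita connection\<close>

type_synonym ('a, 'n) bilin = "'a \<Rightarrow> ('a, 'n) tvec \<Rightarrow> ('a, 'n) tvec \<Rightarrow> real"

definition metric_matrix ::
    "('a, 'n::finite) atlas \<Rightarrow> ('a, 'n) bilin \<Rightarrow> ('a, 'n) chart \<Rightarrow> real ^ 'n \<Rightarrow> real ^ 'n ^ 'n" where
  "metric_matrix A g c y =
     (\<chi> i j. g (chart_inv c y) (coord_vec A c (chart_inv c y) (axis i 1))
                               (coord_vec A c (chart_inv c y) (axis j 1)))"

definition riemannian_metric :: "('a, 'n::finite) atlas \<Rightarrow> ('a, 'n) bilin \<Rightarrow> bool" where
  "riemannian_metric A g \<longleftrightarrow>
     (\<forall>x. \<forall>u\<in>tangent_space A x. \<forall>v\<in>tangent_space A x.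
        g x u v = g x v u \<and>
        (u \<noteq> (\<lambda>_. 0) \<longrightarrow> g x u u > 0) \<and>
        (\<forall>w\<in>tangent_space A x. \<forall>a b.
           g x (\<lambda>c. a *\<^sub>R u c + b *\<^sub>R v c) w = a * g x u w + b * g x v w)) \<and>
     (\<forall>c\<in>A. smooth_on (snd c ` fst c) (metric_matrix A g c))"

abbreviation pdiff :: "'n::finite \<Rightarrow> (real ^ 'n \<Rightarrow> real) \<Rightarrow> real ^ 'n \<Rightarrow> real" where
  "pdiff i F y \<equiv> frechet_derivative F (at y) (axis i 1)"

text \<open>\<open>christoffel A g c y k i j\<close> is the symbol with upper index \<open>k\<close> and lower indices
  \<open>i\<close>, \<open>j\<close> in the chart \<open>c\<close>.\<close>

definition christoffel ::
    "('a, 'n::finite) atlas \<Rightarrow> ('a, 'n) bilin \<Rightarrow> ('a, 'n) chart \<Rightarrow> real ^ 'n \<Rightarrow> 'n \<Rightarrow> 'n \<Rightarrow> 'n \<Rightarrow> real" where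
  "christoffel A g c y k i j = (let G = metric_matrix A g c in
     1 / 2 * (\<Sum>l\<in>UNIV. matrix_inv (G y) $ k $ l *
       (pdiff i (\<lambda>z. G z $ j $ l) y + pdiff j (\<lambda>z. G z $ i $ l) y - pdiff l (\<lambda>z. G z $ i $ j) y)))"

text \<open>Levi-Civita derivative, in the direction \<open>v\<close> tangent to the source, of a vector field
  \<open>E\<close> along a map \<open>F\<close> into the Riemannian manifold. A vector field on the manifold itself is
  the case where \<open>F\<close> is the identity.\<close>

definition cov_along ::
    "('p, 'k::finite) atlas \<Rightarrow> ('a, 'n::finite) atlas \<Rightarrow> ('a, 'n) bilin \<Rightarrow> ('p \<Rightarrow> 'a) \<Rightarrow>
     ('p \<Rightarrow> ('a, 'n) tvec) \<Rightarrow> 'p \<Rightarrow> ('p, 'k) tvec \<Rightarrow> ('a, 'n) tvec" where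
  "cov_along B A g F E p v =
     (\<lambda>c. if c \<in> charts_at A (F p)
          then tdiff B (\<lambda>p'. E p' c) p v +
               (\<chi> k. \<Sum>i\<in>UNIV. \<Sum>j\<in>UNIV. christoffel A g c (snd c (F p)) k i j *
                       push B A F p v c $ i * E p c $ j)
          else 0)"

text \<open>\<open>riemann A g c y l k i j\<close> is the component of index \<open>l\<close> of
  \<open>R(\<partial>\<^sub>i, \<partial>\<^sub>j) \<partial>\<^sub>k\<close>, where
  \<open>R(X, Y) = \<nabla>\<^sub>X \<nabla>\<^sub>Y - \<nabla>\<^sub>Y \<nabla>\<^sub>X - \<nabla>\<^bsub>[X, Y]\<^esub>\<close>. With the Ricci tensor
  \<open>Ric(Y, Z) = tr (X \<mapsto> R(X, Y) Z)\<close>, round spheres have positive scalar curvature.\<close>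

definition riemann ::
    "('a, 'n::finite) atlas \<Rightarrow> ('a, 'n) bilin \<Rightarrow> ('a, 'n) chart \<Rightarrow> real ^ 'n \<Rightarrow> 'n \<Rightarrow> 'n \<Rightarrow> 'n \<Rightarrow> 'n \<Rightarrow> real" where
  "riemann A g c y l k i j = (let \<Gamma> = christoffel A g c in
     pdiff i (\<lambda>z. \<Gamma> z l j k) y - pdiff j (\<lambda>z. \<Gamma> z l i k) y +
     (\<Sum>m\<in>UNIV. \<Gamma> y l i m * \<Gamma> y m j k - \<Gamma> y l j m * \<Gamma> y m i k))"

definition scalar_curvature :: "('a, 'n::finite) atlas \<Rightarrow> ('a, 'n) bilin \<Rightarrow> 'a \<Rightarrow> real" where
  "scalar_curvature A g x = (let c = chart_at A x; y = snd c x in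
     \<Sum>j\<in>UNIV. \<Sum>k\<in>UNIV. matrix_inv (metric_matrix A g c y) $ j $ k *
       (\<Sum>i\<in>UNIV. riemann A g c y i k i j))"

definition grad :: "('a, 'n::finite) atlas \<Rightarrow> ('a, 'n) bilin \<Rightarrow> ('a \<Rightarrow> real) \<Rightarrow> 'a \<Rightarrow> ('a, 'n) tvec" where
  "grad A g f x = (THE v. v \<in> tangent_space A x \<and> (\<forall>w\<in>tangent_space A x. g x v w = tdiff A f x w))"

definition divergence :: "('a, 'n::finite) atlas \<Rightarrow> ('a, 'n) bilin \<Rightarrow> ('a \<Rightarrow> ('a, 'n) tvec) \<Rightarrow> 'a \<Rightarrow> real" where
  "divergence A g X x = (let c = chart_at A x in
     \<Sum>i\<in>UNIV. cov_along A A g (\<lambda>x. x) X x (coord_vec A c x (axis i 1)) c $ i)"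

definition laplacian :: "('a, 'n::finite) atlas \<Rightarrow> ('a, 'n) bilin \<Rightarrow> ('a \<Rightarrow> real) \<Rightarrow> 'a \<Rightarrow> real" where
  "laplacian A g f x = - divergence A g (grad A g f) x"

definition oriented_frames ::
    "('a, 'n::finite) atlas \<Rightarrow> ('a, 'n) bilin \<Rightarrow> 'a \<Rightarrow> ('n \<Rightarrow> ('a, 'n) tvec) set" where
  "oriented_frames A g x =
     {e. (\<forall>i. e i \<in> tangent_space A x) \<and>
         (\<forall>i j. g x (e i) (e j) = (if i = j then 1 else 0)) \<and>
         (\<forall>c\<in>charts_at A x. det (\<chi> k i. e i c $ k) > 0)}"


section \<open>Principal bundles\<close>

text \<open>A group of matrices (or of complex numbers) is given by its underlying set \<open>G\<close>, its
  multiplication and its unit. The second atlas is that of the base.\<close>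

definition principal_bundle ::
    "('p::topological_space, 'k::finite) atlas \<Rightarrow> ('a::topological_space, 'n::finite) atlas \<Rightarrow>
     ('g::euclidean_space) set \<Rightarrow> ('g \<Rightarrow> 'g \<Rightarrow> 'g) \<Rightarrow> 'g \<Rightarrow> ('p \<Rightarrow> 'a) \<Rightarrow> ('p \<Rightarrow> 'g \<Rightarrow> 'p) \<Rightarrow> bool" where
  "principal_bundle B A G mul one \<pi> act \<longleftrightarrow>
     smooth_atlas B \<and> smooth_map B A \<pi> \<and>
     (\<forall>p. act p one = p) \<and>
     (\<forall>p. \<forall>g\<in>G. \<forall>h\<in>G. act (act p g) h = act p (mul g h)) \<and>
     (\<forall>p. \<forall>g\<in>G. \<pi> (act p g) = \<pi> p) \<and>
     (\<forall>x. \<exists>U \<tau>. open U \<and> x \<in> U \<and>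
        bij_betw (\<lambda>p. (\<pi> p, \<tau> p)) (\<pi> -` U) (U \<times> G) \<and>
        (\<forall>p\<in>\<pi> -` U. \<forall>g\<in>G. \<tau> (act p g) = mul (\<tau> p) g) \<and>
        smooth_fun B (\<pi> -` U) \<tau> \<and>
        (\<forall>c\<in>A. smooth_into B ((snd c ` (fst c \<inter> U)) \<times> G)
           (\<lambda>(y, g). inv_into (\<pi> -` U) (\<lambda>p. (\<pi> p, \<tau> p)) (chart_inv c y, g))))"

abbreviation unit_circle :: "complex set" where
  "unit_circle \<equiv> {z. cmod z = 1}"

text \<open>Connection 1-forms on a circle bundle take values in the Lie algebra
  \<open>\<i>\<real>\<close> of the circle and reproduce the generators of the fundamental vector fields.\<close>

definition connection_form ::
    "('q, 'k::finite) atlas \<Rightarrow> ('q \<Rightarrow> complex \<Rightarrow> 'q) \<Rightarrow> ('q \<Rightarrow> ('q, 'k) tvec \<Rightarrow> complex) \<Rightarrow> bool" where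
  "connection_form B act \<alpha> \<longleftrightarrow>
     (\<forall>q. \<forall>u\<in>tangent_space B q. \<forall>v\<in>tangent_space B q. \<forall>a b.
        \<alpha> q (\<lambda>c. a *\<^sub>R u c + b *\<^sub>R v c) = a *\<^sub>R \<alpha> q u + b *\<^sub>R \<alpha> q v) \<and>
     (\<forall>q. \<forall>v\<in>tangent_space B q. Re (\<alpha> q v) = 0) \<and>
     (\<forall>c\<in>B. \<forall>w. smooth_on (snd c ` fst c) (\<lambda>y. \<alpha> (chart_inv c y) (coord_vec B c (chart_inv c y) w))) \<and>
     (\<forall>q. \<forall>v\<in>tangent_space B q. \<forall>z\<in>unit_circle.
        \<alpha> (act q z) (push B B (\<lambda>q'. act q' z) q v) = \<alpha> q v) \<and>
     (\<forall>q. \<alpha> q (\<lambda>c. if c \<in> charts_at B q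
                   then vector_derivative (\<lambda>t. snd c (act q (cis t))) (at 0) else 0) = \<i>)"

text \<open>Convention: \<open>d\<alpha>(X, Y) = X(\<alpha>(Y)) - Y(\<alpha>(X)) - \<alpha>([X, Y])\<close>.\<close>

definition ext_deriv ::
    "('q, 'k::finite) atlas \<Rightarrow> ('q \<Rightarrow> ('q, 'k) tvec \<Rightarrow> complex) \<Rightarrow> 'q \<Rightarrow> ('q, 'k) tvec \<Rightarrow> ('q, 'k) tvec \<Rightarrow> complex" where
  "ext_deriv B \<alpha> q u v = (let c = chart_at B q;
       a = (\<lambda>w y. \<alpha> (chart_inv c y) (coord_vec B c (chart_inv c y) w)) in
     frechet_derivative (a (v c)) (at (snd c q)) (u c) -
     frechet_derivative (a (u c)) (at (snd c q)) (v c))"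


section \<open>Clifford algebra and the spin groups in dimension 2\<close>

text \<open>The matrices of the two basis vectors in the complex spinor representation on
  \<open>\<complex>\<^sup>2\<close>. It identifies the complexified Clifford algebra of \<open>\<real>\<^sup>2\<close> with the algebra of
  complex \<open>2 \<times> 2\<close> matrices, so the spin groups are taken as groups of matrices and their
  spinor representation is the action of matrices on \<open>\<complex>\<^sup>2\<close>.\<close>

definition gamma1 :: "complex ^ 2 ^ 2" where
  "gamma1 = vector [vector [0, \<i>], vector [\<i>, 0]]"

definition gamma2 :: "complex ^ 2 ^ 2" where
  "gamma2 = vector [vector [0, -1], vector [1, 0]]"

definition cl :: "real ^ 2 \<Rightarrow> complex ^ 2 ^ 2" where
  "cl v = v $ 1 *\<^sub>R gamma1 + v $ 2 *\<^sub>R gamma2"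

lemma cl_square: "cl v ** cl v = mat (- of_real ((norm v)\<^sup>2))"
  by (simp add: cl_def gamma1_def gamma2_def matrix_matrix_mult_def mat_def vec_eq_iff forall_2
      sum_2 norm_vec_def L2_set_def complex_eq_iff power2_eq_square)

inductive_set spin2 :: "(complex ^ 2 ^ 2) set" where
  one: "mat 1 \<in> spin2"
| mult: "s \<in> spin2 \<Longrightarrow> norm u = 1 \<Longrightarrow> norm v = 1 \<Longrightarrow> s ** cl u ** cl v \<in> spin2"

definition spinc2 :: "(complex ^ 2 ^ 2) set" where
  "spinc2 = {mat z ** s |z s. cmod z = 1 \<and> s \<in> spin2}"

definition Ad :: "complex ^ 2 ^ 2 \<Rightarrow> real ^ 2 ^ 2" where
  "Ad s = (THE R. \<forall>v. cl (R *v v) = s ** cl v ** matrix_inv s)"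

definition hermitian :: "complex ^ 2 \<Rightarrow> complex ^ 2 \<Rightarrow> complex" where
  "hermitian \<sigma> \<tau> = (\<Sum>i\<in>UNIV. \<sigma> $ i * cnj (\<tau> $ i))"


section \<open>Spin-c structures with a connection on the auxiliary bundle\<close>

text \<open>Fields: the surface \<open>'m\<close> with its metric; the total space \<open>'p\<close> of the
  \<open>Spin\<^sup>c\<close> bundle; the total space \<open>'q\<close> of the circle bundle with its connection form; the
  two components of \<open>\<theta>\<close>, with values in the oriented orthonormal frames and in the
  circle bundle. The dimensions of the total spaces are \<open>2 + dim Spin\<^sup>c\<^sub>2 = 4\<close> and
  \<open>2 + 1 = 3\<close>.\<close>

record ('m, 'p, 'q) spinc_data =
  M_atlas :: "('m, 2) atlas"
  metric :: "('m, 2) bilin"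
  P_atlas :: "('p, 4) atlas"
  P_proj :: "'p \<Rightarrow> 'm"
  P_act :: "'p \<Rightarrow> complex ^ 2 ^ 2 \<Rightarrow> 'p"
  Q_atlas :: "('q, 3) atlas"
  Q_proj :: "'q \<Rightarrow> 'm"
  Q_act :: "'q \<Rightarrow> complex \<Rightarrow> 'q"
  theta_frame :: "'p \<Rightarrow> 2 \<Rightarrow> ('m, 2) tvec"
  theta_circle :: "'p \<Rightarrow> 'q"
  conn :: "'q \<Rightarrow> ('q, 3) tvec \<Rightarrow> complex"

abbreviation so_frames :: "('m, 'p, 'q) spinc_data \<Rightarrow> 'm \<Rightarrow> (2 \<Rightarrow> ('m, 2) tvec) set" where
  "so_frames S x \<equiv> oriented_frames (M_atlas S) (metric S) x"

text \<open>The covering \<open>Spin\<^sup>c\<^sub>2 \<rightarrow> SO\<^sub>2 \<times> S\<^sup>1\<close> sends \<open>z s\<close> to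
  \<open>(Ad s, z\<^sup>2)\<close>, for \<open>z\<close> on the unit circle and \<open>s\<close> in the spin group. The right action
  of a rotation \<open>R\<close> on a frame \<open>e\<close> gives the frame with vectors
  \<open>\<Sum>\<^sub>i R\<^sub>i\<^sub>j e\<^sub>i\<close>. The last clause says that \<open>\<theta>\<close> maps onto the fibre product and is
  two-to-one; that \<open>\<theta>\<close> is locally a diffeomorphism, hence a double covering, follows from
  smoothness, equivariance and local triviality.\<close>

definition double_covering :: "('m, 'p, 'q) spinc_data \<Rightarrow> bool" where
  "double_covering S \<longleftrightarrow>
     (\<forall>p. theta_frame S p \<in> so_frames S (P_proj S p)) \<and>
     (\<forall>p. Q_proj S (theta_circle S p) = P_proj S p) \<and>
     (\<forall>i. \<forall>c\<in>M_atlas S. smooth_fun (P_atlas S) (P_proj S -` fst c) (\<lambda>p. theta_frame S p i c)) \<and>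
     smooth_map (P_atlas S) (Q_atlas S) (theta_circle S) \<and>
     (\<forall>p z. \<forall>s\<in>spin2. cmod z = 1 \<longrightarrow>
        theta_frame S (P_act S p (mat z ** s)) =
          (\<lambda>j c. \<Sum>i\<in>UNIV. Ad s $ i $ j *\<^sub>R theta_frame S p i c) \<and>
        theta_circle S (P_act S p (mat z ** s)) = Q_act S (theta_circle S p) (z\<^sup>2)) \<and>
     (\<forall>q. \<forall>e\<in>so_frames S (Q_proj S q).
        card {p. theta_frame S p = e \<and> theta_circle S p = q} = 2)"

definition spinc_surface ::
    "('m::topological_space, 'p::topological_space, 'q::topological_space) spinc_data \<Rightarrow> bool" where
  "spinc_surface S \<longleftrightarrow>
     oriented_atlas (M_atlas S) \<and>
     riemannian_metric (M_atlas S) (metric S) \<and>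
     principal_bundle (P_atlas S) (M_atlas S) spinc2 (**) (mat 1) (P_proj S) (P_act S) \<and>
     principal_bundle (Q_atlas S) (M_atlas S) unit_circle (*) 1 (Q_proj S) (Q_act S) \<and>
     double_covering S \<and>
     connection_form (Q_atlas S) (Q_act S) (conn S)"

text \<open>\<open>i\<Omega>\<close> is the curvature form: its pull-back to the circle bundle is \<open>d\<alpha>\<close>, the group being
  abelian.\<close>

definition curvature_form :: "('m, 'p, 'q) spinc_data \<Rightarrow> ('m, 2) bilin \<Rightarrow> bool" where
  "curvature_form S \<Omega> \<longleftrightarrow>
     (\<forall>q. \<forall>u\<in>tangent_space (Q_atlas S) q. \<forall>v\<in>tangent_space (Q_atlas S) q.
        ext_deriv (Q_atlas S) (conn S) q u v =
          \<i> * of_real (\<Omega> (Q_proj S q) (push (Q_atlas S) (M_atlas S) (Q_proj S) q u)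
                                    (push (Q_atlas S) (M_atlas S) (Q_proj S) q v)))"


section \<open>The spinor bundle\<close>

text \<open>A spinor is an equivalence class \<open>[p, \<sigma>]\<close> of the associated bundle. As a set of
  pairs, it is the graph of a function on a fibre of the principal bundle, and the operations
  below act on the components over each \<open>p\<close>.\<close>

type_synonym 'p spinor = "('p \<times> (complex ^ 2)) set"

definition spinor_class :: "('m, 'p, 'q) spinc_data \<Rightarrow> 'p \<Rightarrow> complex ^ 2 \<Rightarrow> 'p spinor" where
  "spinor_class S p \<sigma> = {(P_act S p h, matrix_inv h *v \<sigma>) |h. h \<in> spinc2}"

definition spinor_fibre :: "('m, 'p, 'q) spinc_data \<Rightarrow> 'm \<Rightarrow> 'p spinor set" where
  "spinor_fibre S x = {spinor_class S p \<sigma> |p \<sigma>. P_proj S p = x}"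

definition sp_comp :: "'p \<Rightarrow> 'p spinor \<Rightarrow> complex ^ 2" where
  "sp_comp p \<Phi> = (THE \<sigma>. (p, \<sigma>) \<in> \<Phi>)"

definition sp_add :: "'p spinor \<Rightarrow> 'p spinor \<Rightarrow> 'p spinor" where
  "sp_add \<Phi> \<Psi> = {(p, \<sigma> + \<tau>) |p \<sigma> \<tau>. (p, \<sigma>) \<in> \<Phi> \<and> (p, \<tau>) \<in> \<Psi>}"

definition sp_scale :: "complex \<Rightarrow> 'p spinor \<Rightarrow> 'p spinor" where
  "sp_scale a \<Phi> = {(p, a *s \<sigma>) |p \<sigma>. (p, \<sigma>) \<in> \<Phi>}"

abbreviation sp_diff :: "'p spinor \<Rightarrow> 'p spinor \<Rightarrow> 'p spinor" where
  "sp_diff \<Phi> \<Psi> \<equiv> sp_add \<Phi> (sp_scale (-1) \<Psi>)"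

definition sp_herm :: "'p spinor \<Rightarrow> 'p spinor \<Rightarrow> complex" where
  "sp_herm \<Phi> \<Psi> = (THE z. \<forall>p \<sigma> \<tau>. (p, \<sigma>) \<in> \<Phi> \<and> (p, \<tau>) \<in> \<Psi> \<longrightarrow> z = hermitian \<sigma> \<tau>)"

definition sp_norm2 :: "'p spinor \<Rightarrow> real" where
  "sp_norm2 \<Phi> = Re (sp_herm \<Phi> \<Phi>)"

text \<open>Clifford multiplication by \<open>X\<close>: \<open>X \<cdot> [p, \<sigma>] = [p, \<rho>(v) \<sigma>]\<close>, where
  \<open>v\<close> are the coordinates of \<open>X\<close> in the orthonormal frame defined by \<open>p\<close>.\<close>

definition cliff :: "('m, 'p, 'q) spinc_data \<Rightarrow> ('m, 2) tvec \<Rightarrow> 'p spinor \<Rightarrow> 'p spinor" where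
  "cliff S X \<Phi> =
     {(p, cl (\<chi> i. metric S (P_proj S p) X (theta_frame S p i)) *v \<sigma>) |p \<sigma>. (p, \<sigma>) \<in> \<Phi>}"

definition smooth_spinor_field ::
    "('m, 'p, 'q) spinc_data \<Rightarrow> ('m \<Rightarrow> 'p spinor) \<Rightarrow> bool" where
  "smooth_spinor_field S \<psi> \<longleftrightarrow>
     (\<forall>x. \<psi> x \<in> spinor_fibre S x) \<and>
     smooth_fun (P_atlas S) UNIV (\<lambda>p. sp_comp p (\<psi> (P_proj S p)))"

text \<open>Horizontal lift of \<open>X\<close> to the point \<open>p\<close> of the \<open>Spin\<^sup>c\<close> bundle, for the lift through
  \<open>\<theta>\<close> of the Levi-Civita connection and the connection of the circle bundle: the image of
  the lift in the frame bundle is horizontal for the Levi-Civita connection (the frame is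
  parallel) and its image in the circle bundle is horizontal for \<open>conn\<close>.\<close>

definition hor_lift :: "('m, 'p, 'q) spinc_data \<Rightarrow> 'p \<Rightarrow> ('m, 2) tvec \<Rightarrow> ('p, 4) tvec" where
  "hor_lift S p X = (THE v. v \<in> tangent_space (P_atlas S) p \<and>
     push (P_atlas S) (M_atlas S) (P_proj S) p v = X \<and>
     (\<forall>i. cov_along (P_atlas S) (M_atlas S) (metric S) (P_proj S) (\<lambda>p'. theta_frame S p' i) p v
          = (\<lambda>_. 0)) \<and>
     conn S (theta_circle S p) (push (P_atlas S) (Q_atlas S) (theta_circle S) p v) = 0)"

definition nabla ::
    "('m, 'p, 'q) spinc_data \<Rightarrow> ('m \<Rightarrow> 'p spinor) \<Rightarrow> 'm \<Rightarrow> ('m, 2) tvec \<Rightarrow> 'p spinor" where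
  "nabla S \<psi> x X =
     {(p, tdiff (P_atlas S) (\<lambda>p'. sp_comp p' (\<psi> (P_proj S p'))) p (hor_lift S p X)) |p. P_proj S p = x}"

definition on_frame :: "('m, 'p, 'q) spinc_data \<Rightarrow> 'm \<Rightarrow> 2 \<Rightarrow> ('m, 2) tvec" where
  "on_frame S x = (SOME e. e \<in> so_frames S x)"

definition dirac :: "('m, 'p, 'q) spinc_data \<Rightarrow> ('m \<Rightarrow> 'p spinor) \<Rightarrow> 'm \<Rightarrow> 'p spinor" where
  "dirac S \<psi> x = (let e = on_frame S x in
     sp_add (cliff S (e 1) (nabla S \<psi> x (e 1))) (cliff S (e 2) (nabla S \<psi> x (e 2))))"

definition eigenspinor_dirac_sq ::
    "('m, 'p, 'q) spinc_data \<Rightarrow> ('m \<Rightarrow> 'p spinor) \<Rightarrow> real \<Rightarrow> bool" where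
  "eigenspinor_dirac_sq S \<psi> \<mu> \<longleftrightarrow>
     smooth_spinor_field S \<psi> \<and> (\<exists>x. sp_norm2 (\<psi> x) \<noteq> 0) \<and>
     (\<forall>x. dirac S (dirac S \<psi>) x = sp_scale (of_real \<mu>) (\<psi> x))"

definition cliff_form2 ::
    "('m, 'p, 'q) spinc_data \<Rightarrow> ('m, 2) bilin \<Rightarrow> 'm \<Rightarrow> 'p spinor \<Rightarrow> 'p spinor" where
  "cliff_form2 S \<Omega> x \<Phi> = (let e = on_frame S x in
     sp_scale (of_real (\<Omega> x (e 1) (e 2))) (cliff S (e 1) (cliff S (e 2) \<Phi>)))"

definition sp_div_norm2 :: "'p spinor \<Rightarrow> 'p spinor" where
  "sp_div_norm2 \<Phi> = sp_scale (of_real (1 / sp_norm2 \<Phi>)) \<Phi>"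

definition T_tensor :: "('m, 'p, 'q) spinc_data \<Rightarrow> ('m \<Rightarrow> 'p spinor) \<Rightarrow> ('m, 2) bilin" where
  "T_tensor S \<psi> x X Z = 1 / 2 * Re (sp_herm
     (sp_add (cliff S X (nabla S \<psi> x Z)) (cliff S Z (nabla S \<psi> x X))) (sp_div_norm2 (\<psi> x)))"

definition Q_tensor :: "('m, 'p, 'q) spinc_data \<Rightarrow> ('m \<Rightarrow> 'p spinor) \<Rightarrow> ('m, 2) bilin" where
  "Q_tensor S \<psi> x X Z = 1 / 2 * Re (sp_herm
     (sp_diff (cliff S X (nabla S \<psi> x Z)) (cliff S Z (nabla S \<psi> x X))) (sp_div_norm2 (\<psi> x)))"

definition tensor_norm2 :: "('m, 'p, 'q) spinc_data \<Rightarrow> ('m, 2) bilin \<Rightarrow> 'm \<Rightarrow> real" where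
  "tensor_norm2 S B x = (let e = on_frame S x in
     \<Sum>i\<in>UNIV. \<Sum>j\<in>UNIV. (B x (e i) (e j))\<^sup>2)"

end

theory Submission
  imports Defs
begin

text \<open>A section of the \<open>Spin\<^sup>c\<close> bundle over a chart turns a spinor field into a function
  \<open>\<phi> = (\<phi>\<^sub>1, \<phi>\<^sub>2)\<close> with values in \<open>\<complex>\<^sup>2\<close>. Let \<open>e\<^sub>1, e\<^sub>2\<close> be the orthonormal frame given
  by the section, \<open>\<omega>\<close> its connection form (\<open>\<nabla>e\<^sub>1 = \<omega> e\<^sub>2\<close>) and \<open>i a\<close> the pull-back of the connection
  of the circle bundle. Since \<open>Spin\<^sup>c\<^sub>2\<close> is a torus of diagonal matrices,
  \<open>\<nabla>\<^sub>X \<phi> = d\<phi>(X) + i/2 ((a + \<omega>)(X) \<phi>\<^sub>1, (a - \<omega>)(X) \<phi>\<^sub>2)\<close>. The structure equations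
  \<open>S = - 2 d\<omega>(e\<^sub>1, e\<^sub>2)\<close> and \<open>\<Omega> = da\<close> and the commutator of the covariant derivatives turn
  \<open>D\<^sup>2 \<phi> = \<lambda>\<^sup>2 \<phi>\<close> into the Schroedinger-Lichnerowicz formula. Its real inner product with \<open>\<phi>\<close>
  expresses \<open>\<lambda>\<^sup>2\<close> by \<open>S\<close>, \<open>\<Omega>\<close>, \<open>\<Delta>f - 2 |df|\<^sup>2\<close> and \<open>|\<nabla>\<psi>|\<^sup>2 / |\<psi>|\<^sup>2\<close>. Now \<open>\<psi>\<close>, \<open>e\<^sub>1 \<cdot> \<psi>\<close>,
  \<open>e\<^sub>2 \<cdot> \<psi>\<close>, \<open>e\<^sub>1 \<cdot> e\<^sub>2 \<cdot> \<psi>\<close> are orthogonal over the reals and of equal length, and the components of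
  \<open>\<nabla>\<psi> / |\<psi>|\<close> along them are \<open>df\<close>, \<open>- B\<^sub>1\<close>, \<open>- B\<^sub>2\<close>, \<open>\<beta>\<close> with
  \<open>|B|\<^sup>2 = |T|\<^sup>2 + |Q|\<^sup>2\<close> and \<open>Y - df = (\<beta>\<^sub>2, - \<beta>\<^sub>1)\<close>. Hence
  \<open>|\<nabla>\<psi>|\<^sup>2 / |\<psi>|\<^sup>2 = |df|\<^sup>2 + |T|\<^sup>2 + |Q|\<^sup>2 + |Y - df|\<^sup>2\<close>, which is the claim.\<close>

section \<open>Smooth functions on open subsets of Euclidean spaces\<close>

text \<open>The definitions fix horizontal lifts, gradients and components of spinors by definite
  descriptions, and pick an orthonormal frame arbitrarily at every point, with no smoothness in the
  point. Each description needs existence and uniqueness before it can be computed, and the choice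
  of frame must be harmless wherever an object is differentiated. Since
  \<open>D\<^sup>2\<psi>\<close> differentiates \<open>D\<psi>\<close>, the Dirac operator is shown
  to be independent of the frame at all nearby points. The tensor norms and the action of the 2-form
  are evaluated at one point only; there the section is taken through a point of the bundle lying
  over the chosen frame, so the two frames coincide. The chart is matched in the same way to the one
  selected in the definitions of scalar curvature and divergence. The weights
  \<open>(a + \<omega>) / 2\<close> and \<open>(a - \<omega>) / 2\<close> come from the covering:
  the diagonal matrix with angles \<open>u\<close>, \<open>t\<close> rotates the frame by
  \<open>u - t\<close> and the circle by \<open>u + t\<close>, and a horizontal motion has to
  compensate \<open>\<omega>\<close> and \<open>a\<close> respectively.\<close>

lemma frechet_derivative_eqI:
  "(f has_derivative f') (at x) \<Longrightarrow> frechet_derivative f (at x) = f'"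
  using frechet_derivative_at by metis

lemma differentiable_cong_open:
  assumes "open W" "y \<in> W" "\<And>z. z \<in> W \<Longrightarrow> F z = G z"
  shows "F differentiable (at y) \<longleftrightarrow> G differentiable (at y)"
    and "frechet_derivative F (at y) = frechet_derivative G (at y)"
proof -
  have "(F has_derivative D) (at y) \<longleftrightarrow> (G has_derivative D) (at y)" for D
    using has_derivative_transform_within_open[OF _ assms(1,2), of F D UNIV G]
      has_derivative_transform_within_open[OF _ assms(1,2), of G D UNIV F] assms(3) by auto
  then show "F differentiable (at y) \<longleftrightarrow> G differentiable (at y)"
    and "frechet_derivative F (at y) = frechet_derivative G (at y)"
    unfolding differentiable_def frechet_derivative_def by auto
qed

lemma Ck_on_cong:
  assumes "open W"
  shows "(\<And>y. y \<in> W \<Longrightarrow> F y = G y) \<Longrightarrow> Ck_on k W F \<longleftrightarrow> Ck_on k W G"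
proof (induction k arbitrary: F G)
  case 0
  then show ?case by (simp cong: continuous_on_cong)
next
  case (Suc k)
  have d: "F differentiable (at y) \<longleftrightarrow> G differentiable (at y)"
    "frechet_derivative F (at y) = frechet_derivative G (at y)" if "y \<in> W" for y
    using differentiable_cong_open[OF assms that, of F G] Suc.prems by auto
  have "Ck_on k W (\<lambda>y. frechet_derivative F (at y) v) \<longleftrightarrow> Ck_on k W (\<lambda>y. frechet_derivative G (at y) v)" for v
    by (rule Suc.IH) (simp add: d)
  then show ?case using d by simp
qed

lemma Ck_on_subset: "Ck_on k W F \<Longrightarrow> V \<subseteq> W \<Longrightarrow> Ck_on k V F"
  by (induction k arbitrary: F) (auto intro: continuous_on_subset)

lemma Ck_on_local:
  assumes "\<And>y. y \<in> W \<Longrightarrow> \<exists>V. open V \<and> y \<in> V \<and> Ck_on k V F"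
  shows "Ck_on k W F"
  using assms
proof (induction k arbitrary: F)
  case 0
  show ?case
    unfolding Ck_on.simps
  proof (rule continuous_at_imp_continuous_on, rule ballI)
    fix y assume "y \<in> W"
    with 0 obtain V where "open V" "y \<in> V" "continuous_on V F" by auto
    then show "isCont F y" by (simp add: continuous_on_eq_continuous_at)
  qed
next
  case (Suc k)
  have "\<exists>V. open V \<and> y \<in> V \<and> Ck_on k V (\<lambda>y. frechet_derivative F (at y) v)" if "y \<in> W" for y v
    using Suc.prems[OF that] by auto
  then have "Ck_on k W (\<lambda>y. frechet_derivative F (at y) v)" for v by (intro Suc.IH)
  moreover have "F differentiable (at y)" if "y \<in> W" for y using Suc.prems[OF that] by auto
  ultimately show ?case by simp
qed

lemma Ck_on_SucD: "Ck_on (Suc k) W F \<Longrightarrow> Ck_on k W F"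
proof (induction k arbitrary: F)
  case 0
  then show ?case
    by (auto intro!: continuous_at_imp_continuous_on differentiable_imp_continuous_within)
qed auto

lemma Ck_on_const: "Ck_on k W (\<lambda>y. c)"
  by (induction k arbitrary: c) auto

lemma Ck_on_bounded_linear:
  assumes "bounded_linear F"
  shows "Ck_on k W F"
proof (cases k)
  case 0
  then show ?thesis using assms by (simp add: linear_continuous_on)
next
  case (Suc k)
  have "(F has_derivative F) (at y)" for y using assms by (rule bounded_linear_imp_has_derivative)
  then have "frechet_derivative F (at y) = F" "F differentiable (at y)" for y
    using frechet_derivative_eqI differentiable_def by blast+
  then show ?thesis by (simp add: Suc Ck_on_const)
qed

lemma Ck_on_add:
  assumes "open W"
  shows "Ck_on k W F \<Longrightarrow> Ck_on k W G \<Longrightarrow> Ck_on k W (\<lambda>y. F y + G y)"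
proof (induction k arbitrary: F G)
  case 0
  then show ?case by (simp add: continuous_on_add)
next
  case (Suc k)
  have "((\<lambda>y. F y + G y) has_derivative
      (\<lambda>v. frechet_derivative F (at y) v + frechet_derivative G (at y) v)) (at y)" if "y \<in> W" for y
    using Suc.prems that by (auto intro!: has_derivative_add simp: frechet_derivative_works[symmetric])
  then have e: "frechet_derivative (\<lambda>y. F y + G y) (at y) =
      (\<lambda>v. frechet_derivative F (at y) v + frechet_derivative G (at y) v)"
    "(\<lambda>y. F y + G y) differentiable (at y)" if "y \<in> W" for y
    using frechet_derivative_eqI differentiable_def that by blast+
  have "Ck_on k W (\<lambda>y. frechet_derivative F (at y) v + frechet_derivative G (at y) v)" for v
    using Suc by auto
  then have "Ck_on k W (\<lambda>y. frechet_derivative (\<lambda>y. F y + G y) (at y) v)" for v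
    using Ck_on_cong[OF assms, of "\<lambda>y. frechet_derivative F (at y) v + frechet_derivative G (at y) v"
        "\<lambda>y. frechet_derivative (\<lambda>y. F y + G y) (at y) v"] e by auto
  then show ?case using e by auto
qed

lemma Ck_on_sum:
  assumes "open W"
  shows "(\<And>i. i \<in> I \<Longrightarrow> Ck_on k W (F i)) \<Longrightarrow> Ck_on k W (\<lambda>y. \<Sum>i\<in>I. F i y)"
  by (induction I rule: infinite_finite_induct) (auto intro!: Ck_on_const Ck_on_add assms)

text \<open>The Leibniz rule writes the derivative as a sum of two terms of the same shape, so the
  induction runs over all \<open>F\<close> and \<open>G\<close> at once; the undifferentiated factor
  is used with one order of differentiability less.\<close>

lemma Ck_on_bounded_bilinear:
  assumes "open W" "bounded_bilinear B"
  shows "Ck_on k W F \<Longrightarrow> Ck_on k W G \<Longrightarrow> Ck_on k W (\<lambda>y. B (F y) (G y))"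
proof (induction k arbitrary: F G)
  case 0
  then show ?case using assms by (simp add: bounded_bilinear.continuous_on)
next
  case (Suc k)
  let ?D = "\<lambda>y v. B (F y) (frechet_derivative G (at y) v) + B (frechet_derivative F (at y) v) (G y)"
  have "((\<lambda>y. B (F y) (G y)) has_derivative ?D y) (at y)" if "y \<in> W" for y
    using Suc.prems that
    by (auto intro!: bounded_bilinear.FDERIV[OF assms(2)] simp: frechet_derivative_works[symmetric])
  then have e: "frechet_derivative (\<lambda>y. B (F y) (G y)) (at y) = ?D y"
    "(\<lambda>y. B (F y) (G y)) differentiable (at y)" if "y \<in> W" for y
    using frechet_derivative_eqI differentiable_def that by blast+
  have "Ck_on k W (\<lambda>y. ?D y v)" for v
    using Suc.prems Ck_on_SucD[OF Suc.prems(1)] Ck_on_SucD[OF Suc.prems(2)]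
    by (auto intro!: Ck_on_add assms Suc.IH)
  then have "Ck_on k W (\<lambda>y. frechet_derivative (\<lambda>y. B (F y) (G y)) (at y) v)" for v
    using Ck_on_cong[OF assms(1), of "\<lambda>y. ?D y v"
        "\<lambda>y. frechet_derivative (\<lambda>y. B (F y) (G y)) (at y) v"] e by auto
  then show ?case using e by auto
qed

lemma frechet_derivative_Basis:
  fixes F :: "'e::euclidean_space \<Rightarrow> 'b::real_normed_vector"
  assumes "F differentiable (at y)"
  shows "frechet_derivative F (at y) v = (\<Sum>b\<in>Basis. (v \<bullet> b) *\<^sub>R frechet_derivative F (at y) b)"
proof -
  have l: "linear (frechet_derivative F (at y))" using assms by (rule linear_frechet_derivative)
  have "frechet_derivative F (at y) v = frechet_derivative F (at y) (\<Sum>b\<in>Basis. (v \<bullet> b) *\<^sub>R b)"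
    by (simp add: euclidean_representation)
  also have "\<dots> = (\<Sum>b\<in>Basis. (v \<bullet> b) *\<^sub>R frechet_derivative F (at y) b)"
    by (simp add: linear_sum[OF l] linear_scale[OF l])
  finally show ?thesis .
qed

lemma frechet_derivative_comp:
  assumes "G differentiable (at y)" "F differentiable (at (G y))"
  shows "(\<lambda>y. F (G y)) differentiable (at y)"
    "frechet_derivative (\<lambda>y. F (G y)) (at y) v = frechet_derivative F (at (G y)) (frechet_derivative G (at y) v)"
  using frechet_derivative_compose[OF assms] differentiable_chain_at[OF assms]
  by (simp_all add: o_def)

text \<open>The chain rule differentiates \<open>F\<close> in the direction \<open>dG(v)\<close>,
  which varies with the point, while \<open>Ck_on\<close> speaks of fixed directions only. Expanding
  this direction in the basis gives a finite sum of products of a scalar function with a derivative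
  of \<open>F\<close> in a fixed direction, to which the induction hypothesis applies.\<close>

lemma Ck_on_compose:
  fixes F :: "'e::euclidean_space \<Rightarrow> 'b::real_normed_vector" and G :: "'d::euclidean_space \<Rightarrow> 'e"
  assumes "open W" "open V"
  shows "Ck_on k V F \<Longrightarrow> Ck_on k W G \<Longrightarrow> G ` W \<subseteq> V \<Longrightarrow> Ck_on k W (\<lambda>y. F (G y))"
proof (induction k arbitrary: F)
  case 0
  then show ?case by (auto intro: continuous_on_compose2)
next
  case (Suc k)
  let ?D = "\<lambda>y v. \<Sum>b\<in>Basis. (frechet_derivative G (at y) v \<bullet> b) *\<^sub>R frechet_derivative F (at (G y)) b"
  have e: "frechet_derivative (\<lambda>y. F (G y)) (at y) v = ?D y v"
    "(\<lambda>y. F (G y)) differentiable (at y)" if "y \<in> W" for y v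
  proof -
    have d: "G differentiable (at y)" "F differentiable (at (G y))"
      using Suc.prems that by auto
    show "frechet_derivative (\<lambda>y. F (G y)) (at y) v = ?D y v"
      unfolding frechet_derivative_comp(2)[OF d] by (rule frechet_derivative_Basis[OF d(2)])
    show "(\<lambda>y. F (G y)) differentiable (at y)" by (rule frechet_derivative_comp(1)[OF d])
  qed
  have "Ck_on k W (\<lambda>y. ?D y v)" for v
  proof (intro Ck_on_sum assms Ck_on_bounded_bilinear[OF assms(1) bounded_bilinear_scaleR] ballI)
    fix b :: 'e
    show "Ck_on k W (\<lambda>y. frechet_derivative F (at (G y)) b)"
      by (rule Suc.IH) (use Suc.prems(1,3) Ck_on_SucD[OF Suc.prems(2)] in auto)
    show "Ck_on k W (\<lambda>y. frechet_derivative G (at y) v \<bullet> b)"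
      by (rule Ck_on_bounded_bilinear[OF assms(1) bounded_bilinear_inner]) (use Suc.prems Ck_on_const in auto)
  qed
  then have "Ck_on k W (\<lambda>y. frechet_derivative (\<lambda>y. F (G y)) (at y) v)" for v
    using Ck_on_cong[OF assms(1), of "\<lambda>y. ?D y v" "\<lambda>y. frechet_derivative (\<lambda>y. F (G y)) (at y) v"] e by auto
  then show ?case using e by auto
qed

section \<open>Closure properties of smooth functions\<close>

lemma smooth_on_cong: "open W \<Longrightarrow> (\<And>y. y \<in> W \<Longrightarrow> F y = G y) \<Longrightarrow> smooth_on W F \<longleftrightarrow> smooth_on W G"
  unfolding smooth_on_def using Ck_on_cong by blast

lemma smooth_on_subset: "smooth_on W F \<Longrightarrow> V \<subseteq> W \<Longrightarrow> smooth_on V F"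
  unfolding smooth_on_def using Ck_on_subset by blast

lemma smooth_on_local:
  assumes "\<And>y. y \<in> W \<Longrightarrow> \<exists>V. open V \<and> y \<in> V \<and> smooth_on V F"
  shows "smooth_on W F"
  unfolding smooth_on_def using Ck_on_local assms unfolding smooth_on_def by metis

lemma smooth_on_const: "smooth_on W (\<lambda>y. c)"
  by (simp add: smooth_on_def Ck_on_const)

lemma smooth_on_bounded_linear: "bounded_linear F \<Longrightarrow> smooth_on W F"
  by (simp add: smooth_on_def Ck_on_bounded_linear)

lemma smooth_on_add: "open W \<Longrightarrow> smooth_on W F \<Longrightarrow> smooth_on W G \<Longrightarrow> smooth_on W (\<lambda>y. F y + G y)"
  by (simp add: smooth_on_def Ck_on_add)

lemma smooth_on_Pair_const: "open V \<Longrightarrow> smooth_on V (\<lambda>y :: 'e::euclidean_space. (y, k :: 'f::euclidean_space))"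
proof -
  assume V: "open V"
  have "smooth_on V (\<lambda>y. (y, 0) + (0, k))"
    by (intro smooth_on_add[OF V] smooth_on_const smooth_on_bounded_linear bounded_linear_Pair bounded_linear_ident bounded_linear_zero)
  then show ?thesis by simp
qed

lemma smooth_on_sum:
  "open W \<Longrightarrow> (\<And>i. i \<in> I \<Longrightarrow> smooth_on W (F i)) \<Longrightarrow> smooth_on W (\<lambda>y. \<Sum>i\<in>I. F i y)"
  by (simp add: smooth_on_def Ck_on_sum)

lemma smooth_on_bounded_bilinear:
  "open W \<Longrightarrow> bounded_bilinear B \<Longrightarrow> smooth_on W F \<Longrightarrow> smooth_on W G \<Longrightarrow> smooth_on W (\<lambda>y. B (F y) (G y))"
  by (simp add: smooth_on_def Ck_on_bounded_bilinear)

lemma smooth_on_compose: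
  fixes F :: "'e::euclidean_space \<Rightarrow> 'b::real_normed_vector" and G :: "'d::euclidean_space \<Rightarrow> 'e"
  shows "open W \<Longrightarrow> open V \<Longrightarrow> smooth_on V F \<Longrightarrow> smooth_on W G \<Longrightarrow> G ` W \<subseteq> V \<Longrightarrow> smooth_on W (\<lambda>y. F (G y))"
  by (simp add: smooth_on_def Ck_on_compose)

lemma smooth_on_linear_compose:
  fixes F :: "'e::euclidean_space \<Rightarrow> 'b::real_normed_vector" and G :: "'d::euclidean_space \<Rightarrow> 'e"
  shows "open W \<Longrightarrow> bounded_linear F \<Longrightarrow> smooth_on W G \<Longrightarrow> smooth_on W (\<lambda>y. F (G y))"
  by (rule smooth_on_compose[where V = UNIV]) (auto intro: smooth_on_bounded_linear)

lemma smooth_on_differentiable: "smooth_on W F \<Longrightarrow> y \<in> W \<Longrightarrow> F differentiable (at y)"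
  unfolding smooth_on_def using Ck_on.simps(2) by blast

lemma smooth_on_frechet_derivative:
  "smooth_on W F \<Longrightarrow> smooth_on W (\<lambda>y. frechet_derivative F (at y) v)"
  unfolding smooth_on_def using Ck_on.simps(2) by blast

lemma smooth_on_continuous_on: "smooth_on W F \<Longrightarrow> continuous_on W F"
  unfolding smooth_on_def using Ck_on.simps(1) by blast

lemma smooth_on_vec_nth: "open W \<Longrightarrow> smooth_on W F \<Longrightarrow> smooth_on W (\<lambda>y. F y $ i)"
  for F :: "'e::euclidean_space \<Rightarrow> ('b::euclidean_space) ^ 'n"
  by (rule smooth_on_linear_compose[OF _ bounded_linear_vec_nth])

lemma bounded_linear_axis: "bounded_linear (axis i :: 'b::euclidean_space \<Rightarrow> 'b ^ 'n)"
proof -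
  have "linear (axis i :: 'b \<Rightarrow> 'b ^ 'n)"
    by (rule linearI) (auto simp: axis_def vec_eq_iff)
  then show ?thesis using linear_linear by blast
qed

section \<open>Symmetry of second derivatives\<close>

lemma directional_derivative:
  fixes F :: "'e::euclidean_space \<Rightarrow> real"
  assumes "F differentiable (at (p + s *\<^sub>R u))"
  shows "((\<lambda>s. F (p + s *\<^sub>R u)) has_real_derivative frechet_derivative F (at (p + s *\<^sub>R u)) u) (at s)"
proof -
  have "((\<lambda>s. p + s *\<^sub>R u) has_derivative (\<lambda>r. r *\<^sub>R u)) (at s)"
    by (auto intro!: derivative_eq_intros)
  from has_derivative_compose[OF this assms[unfolded frechet_derivative_works]]
  have "((\<lambda>s. F (p + s *\<^sub>R u)) has_derivative (\<lambda>r. frechet_derivative F (at (p + s *\<^sub>R u)) (r *\<^sub>R u))) (at s)" .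
  moreover have "frechet_derivative F (at (p + s *\<^sub>R u)) (r *\<^sub>R u) = frechet_derivative F (at (p + s *\<^sub>R u)) u * r" for r
    using linear_scale[OF linear_frechet_derivative[OF assms]] by simp
  ultimately show ?thesis by (simp add: has_field_derivative_def)
qed

text \<open>The mean value theorem is used twice: for the difference across \<open>v\<close> as a
  function of the step along \<open>u\<close>, then for the derivative in direction \<open>u\<close>
  as a function of the step along \<open>v\<close>. The hypothesis on \<open>W\<close> keeps all
  intermediate points in the domain.\<close>

lemma second_difference_mvt:
  fixes F :: "'e::euclidean_space \<Rightarrow> real"
  assumes W: "\<And>s t. 0 \<le> s \<Longrightarrow> s \<le> h \<Longrightarrow> 0 \<le> t \<Longrightarrow> t \<le> h \<Longrightarrow> y + s *\<^sub>R u + t *\<^sub>R v \<in> W"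
    and F: "Ck_on 2 W F" and h: "0 < h"
  shows "\<exists>s t. 0 < s \<and> s < h \<and> 0 < t \<and> t < h \<and>
    F (y + h *\<^sub>R u + h *\<^sub>R v) - F (y + h *\<^sub>R u) - F (y + h *\<^sub>R v) + F y =
      h * h * frechet_derivative (\<lambda>z. frechet_derivative F (at z) u) (at (y + s *\<^sub>R u + t *\<^sub>R v)) v"
proof -
  define F1 where "F1 z = frechet_derivative F (at z) u" for z
  have d: "F differentiable (at z)" "F1 differentiable (at z)" if "z \<in> W" for z
    unfolding F1_def using F that by (auto simp: numeral_2_eq_2)
  have "((\<lambda>s. F (y + h *\<^sub>R v + s *\<^sub>R u) - F (y + s *\<^sub>R u)) has_real_derivative
      F1 (y + h *\<^sub>R v + s *\<^sub>R u) - F1 (y + s *\<^sub>R u)) (at s)" if "0 \<le> s" "s \<le> h" for s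
    unfolding F1_def
    using W[OF that, of h] W[OF that, of 0] h
    by (intro DERIV_diff directional_derivative d) (auto simp: algebra_simps)
  from MVT2[OF h this] obtain s where s: "0 < s" "s < h"
    and es: "F (y + h *\<^sub>R v + h *\<^sub>R u) - F (y + h *\<^sub>R u) - (F (y + h *\<^sub>R v) - F y) =
      h * (F1 (y + h *\<^sub>R v + s *\<^sub>R u) - F1 (y + s *\<^sub>R u))" by auto
  have "((\<lambda>t. F1 (y + s *\<^sub>R u + t *\<^sub>R v)) has_real_derivative
      frechet_derivative F1 (at (y + s *\<^sub>R u + t *\<^sub>R v)) v) (at t)" if "0 \<le> t" "t \<le> h" for t
    using W[OF _ _ that, of s] s by (intro directional_derivative d) auto
  from MVT2[OF h this] obtain t where t: "0 < t" "t < h"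
    and et: "F1 (y + s *\<^sub>R u + h *\<^sub>R v) - F1 (y + s *\<^sub>R u) =
      h * frechet_derivative F1 (at (y + s *\<^sub>R u + t *\<^sub>R v)) v" by auto
  have "F (y + h *\<^sub>R u + h *\<^sub>R v) - F (y + h *\<^sub>R u) - F (y + h *\<^sub>R v) + F y =
      h * h * frechet_derivative F1 (at (y + s *\<^sub>R u + t *\<^sub>R v)) v"
    using es et by (simp add: algebra_simps)
  then show ?thesis using s t unfolding F1_def by blast
qed

text \<open>The second difference over a small parallelogram is symmetric in \<open>u\<close> and
  \<open>v\<close>. Read in the two orders, it is \<open>h * h\<close> times one or the other mixed
  derivative at a nearby point, and both mixed derivatives are continuous at
  \<open>y\<close>.\<close>

lemma frechet_derivative_symmetric_real:
  fixes F :: "'e::euclidean_space \<Rightarrow> real"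
  assumes W: "open W" "y \<in> W" and F: "smooth_on W F"
  shows "frechet_derivative (\<lambda>z. frechet_derivative F (at z) u) (at y) v =
    frechet_derivative (\<lambda>z. frechet_derivative F (at z) v) (at y) u"
proof -
  define A where "A u v z = frechet_derivative (\<lambda>z. frechet_derivative F (at z) u) (at z) v" for u v z
  have "\<bar>A u v y - A v u y\<bar> \<le> e" if e: "e > 0" for e
  proof -
    have "\<exists>d>0. \<forall>z. dist z y < d \<longrightarrow> z \<in> W \<and> dist (A a b z) (A a b y) < e / 2" for a b
    proof -
      have "continuous_on W (A a b)"
        unfolding A_def
        by (intro smooth_on_continuous_on smooth_on_frechet_derivative F)
      then have "isCont (A a b) y" using W by (simp add: continuous_on_eq_continuous_at)
      then obtain d1 where "d1 > 0" "\<forall>z. dist z y < d1 \<longrightarrow> dist (A a b z) (A a b y) < e / 2"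
        unfolding continuous_at_eps_delta dist_norm using e half_gt_zero by blast
      moreover obtain d2 where "d2 > 0" "\<forall>z. dist z y < d2 \<longrightarrow> z \<in> W"
        using W unfolding open_dist by blast
      ultimately show ?thesis by (intro exI[of _ "min d1 d2"]) auto
    qed
    then obtain d1 d2 where d: "d1 > 0" "d2 > 0"
      "\<And>z. dist z y < d1 \<Longrightarrow> z \<in> W \<and> dist (A u v z) (A u v y) < e / 2"
      "\<And>z. dist z y < d2 \<Longrightarrow> z \<in> W \<and> dist (A v u z) (A v u y) < e / 2" by metis
    define r where "r = min d1 d2"
    \<comment> \<open>Scaled so that the whole parallelogram stays within distance \<open>r\<close>
      of \<open>y\<close>; the summand 1 avoids a division by zero when \<open>u\<close> and
      \<open>v\<close> both vanish.\<close>
    define h where "h = r / 2 / (norm u + norm v + 1)"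
    have np: "norm u + norm v + 1 > 0" by (smt (verit) norm_ge_zero)
    have h: "h > 0" unfolding h_def r_def using d np by simp
    have hr: "h * (norm u + norm v) < r"
    proof -
      have "h * (norm u + norm v) \<le> h * (norm u + norm v + 1)" using h by simp
      also have "\<dots> = r / 2" unfolding h_def using np by (metis less_irrefl nonzero_eq_divide_eq)
      also have "\<dots> < r" unfolding r_def using d by linarith
      finally show ?thesis .
    qed
    have near: "dist (y + s *\<^sub>R u + t *\<^sub>R v) y < r" if "0 \<le> s" "s \<le> h" "0 \<le> t" "t \<le> h" for s t
    proof -
      have "dist (y + s *\<^sub>R u + t *\<^sub>R v) y = norm (s *\<^sub>R u + t *\<^sub>R v)" by (simp add: dist_norm)
      also have "\<dots> \<le> s * norm u + t * norm v" using norm_triangle_ineq[of "s *\<^sub>R u" "t *\<^sub>R v"] that by simp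
      also have "\<dots> \<le> h * norm u + h * norm v" using that by (intro add_mono mult_right_mono) auto
      finally show ?thesis using hr by (simp add: algebra_simps)
    qed
    have near': "dist (y + s *\<^sub>R v + t *\<^sub>R u) y < r" if "0 \<le> s" "s \<le> h" "0 \<le> t" "t \<le> h" for s t
      using near[OF that(3,4,1,2)] by (simp add: algebra_simps)
    have F2: "Ck_on 2 W F" using F by (simp add: smooth_on_def)
    define \<Delta> where "\<Delta> = F (y + h *\<^sub>R u + h *\<^sub>R v) - F (y + h *\<^sub>R u) - F (y + h *\<^sub>R v) + F y"
    have "\<exists>s t. 0 < s \<and> s < h \<and> 0 < t \<and> t < h \<and> \<Delta> = h * h * A u v (y + s *\<^sub>R u + t *\<^sub>R v)"
      unfolding \<Delta>_def A_def by (rule second_difference_mvt[OF _ F2 h]) (use near d r_def in auto)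
    then obtain s t where st: "0 < s" "s < h" "0 < t" "t < h" "\<Delta> = h * h * A u v (y + s *\<^sub>R u + t *\<^sub>R v)"
      by blast
    have "\<exists>s t. 0 < s \<and> s < h \<and> 0 < t \<and> t < h \<and>
      F (y + h *\<^sub>R v + h *\<^sub>R u) - F (y + h *\<^sub>R v) - F (y + h *\<^sub>R u) + F y = h * h * A v u (y + s *\<^sub>R v + t *\<^sub>R u)"
      unfolding A_def
      by (rule second_difference_mvt[OF _ F2 h]) (use near' d r_def in auto)
    then obtain s' t' where st': "0 < s'" "s' < h" "0 < t'" "t' < h" "\<Delta> = h * h * A v u (y + s' *\<^sub>R v + t' *\<^sub>R u)"
      unfolding \<Delta>_def by (auto simp: algebra_simps)
    have "A u v (y + s *\<^sub>R u + t *\<^sub>R v) = A v u (y + s' *\<^sub>R v + t' *\<^sub>R u)"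
      using st(5) st'(5) h by simp
    moreover have "dist (A u v (y + s *\<^sub>R u + t *\<^sub>R v)) (A u v y) < e / 2"
      using near[of s t] st d r_def by auto
    moreover have "dist (A v u (y + s' *\<^sub>R v + t' *\<^sub>R u)) (A v u y) < e / 2"
      using near'[of s' t'] st' d r_def by auto
    ultimately show ?thesis unfolding dist_real_def by linarith
  qed
  then have "\<bar>A u v y - A v u y\<bar> \<le> 0" by (rule field_le_epsilon) simp
  then show ?thesis unfolding A_def by simp
qed

lemma frechet_derivative_linear_compose:
  assumes "bounded_linear L" "F differentiable (at y)"
  shows "frechet_derivative (\<lambda>z. L (F z)) (at y) v = L (frechet_derivative F (at y) v)"
    "(\<lambda>z. L (F z)) differentiable (at y)"
proof -
  have "((\<lambda>z. L (F z)) has_derivative (\<lambda>v. L (frechet_derivative F (at y) v))) (at y)"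
    using bounded_linear.has_derivative[OF assms(1)] assms(2) frechet_derivative_works by blast
  then show "frechet_derivative (\<lambda>z. L (F z)) (at y) v = L (frechet_derivative F (at y) v)"
    "(\<lambda>z. L (F z)) differentiable (at y)"
    using frechet_derivative_eqI differentiable_def by metis+
qed

lemma frechet_derivative_symmetric:
  fixes F :: "'e::euclidean_space \<Rightarrow> 'b::euclidean_space"
  assumes W: "open W" "y \<in> W" and F: "smooth_on W F"
  shows "frechet_derivative (\<lambda>z. frechet_derivative F (at z) u) (at y) v =
    frechet_derivative (\<lambda>z. frechet_derivative F (at z) v) (at y) u"
proof (rule euclidean_eqI)
  fix b :: 'b
  let ?L = "\<lambda>x::'b. x \<bullet> b"
  note bl = bounded_linear_inner_left[of b]
  have 1: "frechet_derivative (\<lambda>z. F z \<bullet> b) (at z) u = frechet_derivative F (at z) u \<bullet> b" if "z \<in> W" for z u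
    using frechet_derivative_linear_compose[OF bl smooth_on_differentiable[OF F that]] by simp
  have "frechet_derivative (\<lambda>z. frechet_derivative F (at z) u) (at y) v \<bullet> b =
    frechet_derivative (\<lambda>z. frechet_derivative (\<lambda>z. F z \<bullet> b) (at z) u) (at y) v" for u v
  proof -
    have "frechet_derivative (\<lambda>z. frechet_derivative F (at z) u) (at y) v \<bullet> b =
      frechet_derivative (\<lambda>z. frechet_derivative F (at z) u \<bullet> b) (at y) v"
      using frechet_derivative_linear_compose[OF bl smooth_on_differentiable[OF smooth_on_frechet_derivative[OF F] W(2)]] by simp
    also have "\<dots> = frechet_derivative (\<lambda>z. frechet_derivative (\<lambda>z. F z \<bullet> b) (at z) u) (at y) v"
      by (subst differentiable_cong_open(2)[OF W]) (auto simp: 1)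
    finally show ?thesis .
  qed
  then show "frechet_derivative (\<lambda>z. frechet_derivative F (at z) u) (at y) v \<bullet> b =
    frechet_derivative (\<lambda>z. frechet_derivative F (at z) v) (at y) u \<bullet> b"
    using frechet_derivative_symmetric_real[OF W, of "\<lambda>z. F z \<bullet> b" u v]
      smooth_on_linear_compose[OF W(1) bl F] by simp
qed

section \<open>Velocities of parametrized families of points\<close>

text \<open>\<open>vel A h y w\<close> is the tangent vector \<open>dh\<^sub>y(w)\<close> of a map \<open>h\<close> from a Euclidean space to the
  manifold. Every tangent vector arises in this way from the inverse of a chart, and on such
  vectors \<open>tdiff\<close>, \<open>push\<close> and \<open>cov_along\<close> are Frechet derivatives of composed maps.\<close>

definition dif_par :: "('a, 'n::finite) atlas \<Rightarrow> ('e::euclidean_space \<Rightarrow> 'a) \<Rightarrow> 'e \<Rightarrow> bool" where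
  "dif_par A h y \<longleftrightarrow> (\<exists>c\<in>A. (\<forall>\<^sub>F z in nhds y. h z \<in> fst c) \<and> (\<lambda>z. snd c (h z)) differentiable (at y))"

definition vel :: "('a, 'n::finite) atlas \<Rightarrow> ('e::euclidean_space \<Rightarrow> 'a) \<Rightarrow> 'e \<Rightarrow> 'e \<Rightarrow> ('a, 'n) tvec" where
  "vel A h y w = (\<lambda>d. if d \<in> charts_at A (h y) then frechet_derivative (\<lambda>z. snd d (h z)) (at y) w else 0)"

definition dif_fun :: "('a, 'n::finite) atlas \<Rightarrow> ('a \<Rightarrow> 'b::real_normed_vector) \<Rightarrow> 'a \<Rightarrow> bool" where
  "dif_fun A F x \<longleftrightarrow> (\<exists>c\<in>charts_at A x. (\<lambda>z. F (chart_inv c z)) differentiable (at (snd c x)))"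

definition dif_map :: "('a, 'n::finite) atlas \<Rightarrow> ('b, 'k::finite) atlas \<Rightarrow> ('a \<Rightarrow> 'b) \<Rightarrow> 'a \<Rightarrow> bool" where
  "dif_map A B F x \<longleftrightarrow> (\<exists>c\<in>charts_at A x. dif_par B (\<lambda>z. F (chart_inv c z)) (snd c x))"

lemma eventually_cong_derivative:
  assumes "\<forall>\<^sub>F z in nhds y. F z = G z"
  shows "F differentiable (at y) \<longleftrightarrow> G differentiable (at y)"
    and "frechet_derivative F (at y) = frechet_derivative G (at y)"
  using assms differentiable_cong_open[of _ y F G] unfolding eventually_nhds by blast+

lemma smooth_atlasD:
  assumes "smooth_atlas A"
  shows "\<exists>c\<in>A. x \<in> fst c"
    and "c \<in> A \<Longrightarrow> open (fst c)"
    and "c \<in> A \<Longrightarrow> open (snd c ` fst c)"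
    and "c \<in> A \<Longrightarrow> inj_on (snd c) (fst c)"
    and "c \<in> A \<Longrightarrow> continuous_on (fst c) (snd c)"
    and "c \<in> A \<Longrightarrow> continuous_on (snd c ` fst c) (chart_inv c)"
    and "c \<in> A \<Longrightarrow> d \<in> A \<Longrightarrow> smooth_on (snd c ` (fst c \<inter> fst d)) (\<lambda>z. snd d (chart_inv c z))"
  using assms unfolding smooth_atlas_def o_def by blast+

lemma chart_inv_snd: "smooth_atlas A \<Longrightarrow> c \<in> A \<Longrightarrow> x \<in> fst c \<Longrightarrow> chart_inv c (snd c x) = x"
  by (simp add: smooth_atlasD inv_into_f_f)

lemma chart_inv_in:
  "z \<in> snd c ` fst c \<Longrightarrow> chart_inv c z \<in> fst c"
  "z \<in> snd c ` fst c \<Longrightarrow> snd c (chart_inv c z) = z"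
  by (simp_all add: inv_into_into f_inv_into_f)

lemma chart_image_Int:
  assumes "smooth_atlas A" "c \<in> A"
  shows "snd c ` (fst c \<inter> V) = {z \<in> snd c ` fst c. chart_inv c z \<in> V}"
proof -
  have "z \<in> snd c ` (fst c \<inter> V)" if "z \<in> snd c ` fst c" "chart_inv c z \<in> V" for z
    by (rule image_eqI[where x = "chart_inv c z"]) (use that chart_inv_in[OF that(1)] in auto)
  moreover have "z \<in> snd c ` fst c \<and> chart_inv c z \<in> V" if "z \<in> snd c ` (fst c \<inter> V)" for z
    using that chart_inv_snd[OF assms] by auto
  ultimately show ?thesis by blast
qed

lemma open_chart_image:
  assumes "smooth_atlas A" "c \<in> A" "open V"
  shows "open (snd c ` (fst c \<inter> V))"
proof -
  have "open (snd c ` fst c \<inter> chart_inv c -` V)"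
    using smooth_atlasD[OF assms(1)] assms by (intro continuous_open_preimage) auto
  moreover have "snd c ` (fst c \<inter> V) = snd c ` fst c \<inter> chart_inv c -` V"
    using chart_image_Int[OF assms(1,2)] by blast
  ultimately show ?thesis by simp
qed

lemma transition_differentiable:
  assumes "smooth_atlas A" "c \<in> charts_at A x" "d \<in> charts_at A x"
  shows "(\<lambda>z. snd d (chart_inv c z)) differentiable (at (snd c x))"
  by (rule smooth_on_differentiable[OF smooth_atlasD(7)[OF assms(1)]])
    (use assms in \<open>auto simp: charts_at_def\<close>)

lemma chart_at_in: "smooth_atlas A \<Longrightarrow> chart_at A x \<in> charts_at A x"
  unfolding chart_at_def
  using someI_ex[of "\<lambda>c. c \<in> charts_at A x"] smooth_atlasD(1)[of A x] by (auto simp: charts_at_def simp del: split_paired_Ex)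

section \<open>Chart independence of velocities and differentials\<close>

lemma dif_par_comp:
  assumes "dif_par A h (g y)" "g differentiable (at y)"
  shows "dif_par A (\<lambda>z. h (g z)) y"
proof -
  from assms(1) obtain c where c: "c \<in> A" "\<forall>\<^sub>F z in nhds (g y). h z \<in> fst c"
    "(\<lambda>z. snd c (h z)) differentiable (at (g y))" unfolding dif_par_def by blast
  have "filterlim g (nhds (g y)) (nhds y)"
    using differentiable_imp_continuous_within[OF assms(2)]
    by (simp add: isCont_def flip: tendsto_at_iff_tendsto_nhds)
  then have "\<forall>\<^sub>F z in nhds y. h (g z) \<in> fst c"
    using c(2) by (rule eventually_compose_filterlim[rotated])
  moreover have "(\<lambda>z. snd c (h (g z))) differentiable (at y)"
    using frechet_derivative_comp(1)[OF assms(2) c(3)] .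
  ultimately show ?thesis using c(1) unfolding dif_par_def by blast
qed

text \<open>\<open>dif_par\<close> asks for a single chart, which makes it easy to establish.
  Continuity of \<open>h\<close> in that chart keeps its values in the overlap with any other chart
  around \<open>h y\<close>, where the transition map is differentiable. Hence every chart will do,
  and the coordinates of the velocity transform like those of a tangent vector.\<close>

lemma dif_par_chart:
  assumes A: "smooth_atlas A" and h: "dif_par A h y" and d: "d \<in> charts_at A (h y)"
  shows "\<forall>\<^sub>F z in nhds y. h z \<in> fst d" "(\<lambda>z. snd d (h z)) differentiable (at y)"
    and "c \<in> charts_at A (h y) \<Longrightarrow> frechet_derivative (\<lambda>z. snd d (h z)) (at y) w =
      frechet_derivative (\<lambda>z. snd d (chart_inv c z)) (at (snd c (h y))) (frechet_derivative (\<lambda>z. snd c (h z)) (at y) w)"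
proof -
  have tr: "(\<forall>\<^sub>F z in nhds y. h z \<in> fst d') \<and> (\<lambda>z. snd d' (h z)) differentiable (at y) \<and>
    frechet_derivative (\<lambda>z. snd d' (h z)) (at y) w =
      frechet_derivative (\<lambda>z. snd d' (chart_inv c z)) (at (snd c (h y))) (frechet_derivative (\<lambda>z. snd c (h z)) (at y) w)"
    if c: "c \<in> A" "\<forall>\<^sub>F z in nhds y. h z \<in> fst c" "(\<lambda>z. snd c (h z)) differentiable (at y)"
      and d': "d' \<in> charts_at A (h y)" for c d' w
  proof -
    have hc: "h y \<in> fst c" using c(2) eventually_nhds_x_imp_x by blast
    have cc: "c \<in> charts_at A (h y)" using c hc by (simp add: charts_at_def)
    let ?V = "snd c ` (fst c \<inter> fst d')"
    have "d' \<in> A" using d' by (simp add: charts_at_def)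
    then have "open ?V" by (intro open_chart_image[OF A c(1)] smooth_atlasD(2)[OF A])
    moreover have "snd c (h y) \<in> ?V" using d' hc by (auto simp: charts_at_def)
    ultimately have nV: "\<forall>\<^sub>F z in nhds (snd c (h y)). z \<in> ?V" by (rule eventually_nhds_in_open)
    have "filterlim (\<lambda>z. snd c (h z)) (nhds (snd c (h y))) (nhds y)"
      using differentiable_imp_continuous_within[OF c(3)] tendsto_at_iff_tendsto_nhds[of "\<lambda>z. snd c (h z)" y]
      by (simp add: isCont_def)
    with nV have "\<forall>\<^sub>F z in nhds y. snd c (h z) \<in> ?V" by (rule eventually_compose_filterlim)
    with c(2) have ev: "\<forall>\<^sub>F z in nhds y. h z \<in> fst c \<and> h z \<in> fst d'"
    proof eventually_elim
      case (elim z)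
      then show ?case
        using chart_inv_snd[OF A c(1)] unfolding chart_image_Int[OF A c(1)] by auto
    qed
    then have e1: "\<forall>\<^sub>F z in nhds y. h z \<in> fst d'" by eventually_elim blast
    have eq: "\<forall>\<^sub>F z in nhds y. snd d' (chart_inv c (snd c (h z))) = snd d' (h z)"
      using ev by eventually_elim (simp add: chart_inv_snd[OF A c(1)])
    note cmp = frechet_derivative_comp[OF c(3) transition_differentiable[OF A cc d']]
    show ?thesis
      using e1 eventually_cong_derivative[OF eq] cmp by auto
  qed
  from h obtain c0 where c0: "c0 \<in> A" "\<forall>\<^sub>F z in nhds y. h z \<in> fst c0" "(\<lambda>z. snd c0 (h z)) differentiable (at y)"
    unfolding dif_par_def by blast
  show 1: "\<forall>\<^sub>F z in nhds y. h z \<in> fst d" "(\<lambda>z. snd d (h z)) differentiable (at y)"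
    using tr[OF c0 d] by auto
  show "frechet_derivative (\<lambda>z. snd d (h z)) (at y) w =
      frechet_derivative (\<lambda>z. snd d (chart_inv c z)) (at (snd c (h y))) (frechet_derivative (\<lambda>z. snd c (h z)) (at y) w)"
    if c: "c \<in> charts_at A (h y)"
  proof -
    have "c \<in> A" using c by (simp add: charts_at_def)
    from tr[OF this _ _ d, of w] tr[OF c0 c, of w] show ?thesis by simp
  qed
qed

lemma vel_in_tangent_space:
  assumes "smooth_atlas A" "dif_par A h y"
  shows "vel A h y w \<in> tangent_space A (h y)"
proof -
  have "vel A h y w d = frechet_derivative (snd d \<circ> chart_inv c) (at (snd c (h y))) (vel A h y w c)"
    if "c \<in> charts_at A (h y)" "d \<in> charts_at A (h y)" for c d
    unfolding vel_def o_def if_P[OF that(1)] if_P[OF that(2)] by (rule dif_par_chart(3)[OF assms that(2,1)])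
  moreover have "vel A h y w c = 0" if "c \<notin> charts_at A (h y)" for c using that by (simp add: vel_def)
  ultimately show ?thesis unfolding tangent_space_def by blast
qed

lemma vel_linear:
  assumes "smooth_atlas A" "dif_par A h y"
  shows "vel A h y (a *\<^sub>R u + b *\<^sub>R v) = (\<lambda>c. a *\<^sub>R vel A h y u c + b *\<^sub>R vel A h y v c)"
proof
  fix c
  show "vel A h y (a *\<^sub>R u + b *\<^sub>R v) c = a *\<^sub>R vel A h y u c + b *\<^sub>R vel A h y v c"
    using linear_frechet_derivative[OF dif_par_chart(2)[OF assms, of c]]
    by (auto simp: vel_def linear_add linear_scale)
qed

lemma vel_comp:
  assumes "smooth_atlas A" "dif_par A h (g y)" "g differentiable (at y)"
  shows "vel A (\<lambda>z. h (g z)) y w = vel A h (g y) (frechet_derivative g (at y) w)"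
  using frechet_derivative_comp(2)[OF assms(3) dif_par_chart(2)[OF assms(1,2)]]
  by (auto simp: vel_def)

lemma dif_par_cong:
  fixes A :: "('a, 'n::finite) atlas"
  assumes "\<forall>\<^sub>F z in nhds y. h z = k z"
  shows "dif_par A h y \<longleftrightarrow> dif_par A k y" "vel A h y w = vel A k y w"
proof -
  have "dif_par A h y \<Longrightarrow> dif_par A k y" if ev: "\<forall>\<^sub>F z in nhds y. h z = k z" for h k
  proof -
    assume "dif_par A h y"
    then obtain c where c: "c \<in> A" "\<forall>\<^sub>F z in nhds y. h z \<in> fst c" "(\<lambda>z. snd c (h z)) differentiable (at y)"
      unfolding dif_par_def by blast
    have "\<forall>\<^sub>F z in nhds y. k z \<in> fst c" using c(2) ev by eventually_elim simp
    have "\<forall>\<^sub>F z in nhds y. snd c (h z) = snd c (k z)" using ev by eventually_elim simp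
    from eventually_cong_derivative(1)[OF this] have "(\<lambda>z. snd c (k z)) differentiable (at y)" using c(3) by simp
    with \<open>\<forall>\<^sub>F z in nhds y. k z \<in> fst c\<close> show ?thesis using c(1) unfolding dif_par_def by blast
  qed
  from this[OF assms] this[of k h] show "dif_par A h y \<longleftrightarrow> dif_par A k y"
    using assms by (auto simp: eq_commute)
  show "vel A h y w = vel A k y w"
  proof
    fix d :: "('a, 'n) chart"
    have "\<forall>\<^sub>F z in nhds y. snd d (h z) = snd d (k z)" using assms by eventually_elim simp
    from eventually_cong_derivative(2)[OF this] show "vel A h y w d = vel A k y w d"
      using eventually_nhds_x_imp_x[OF assms] by (simp add: vel_def)
  qed
qed

lemma dif_par_chart_inv:
  assumes A: "smooth_atlas A" and c: "c \<in> A" and z: "z \<in> snd c ` fst c"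
  shows "dif_par A (chart_inv c) z"
    "x \<in> fst c \<Longrightarrow> coord_vec A c x w = vel A (chart_inv c) (snd c x) w"
    "vel A (chart_inv c) z w c = w"
    "coord_vec A c (chart_inv c z) w = vel A (chart_inv c) z w"
proof -
  have ev: "\<forall>\<^sub>F z in nhds z. z \<in> snd c ` fst c"
    using smooth_atlasD(3)[OF A c] z by (rule eventually_nhds_in_open)
  have e1: "\<forall>\<^sub>F z in nhds z. snd c (chart_inv c z) = z"
    using ev by eventually_elim (rule chart_inv_in)
  have "((\<lambda>z. z) has_derivative (\<lambda>w. w)) (at z)" by (rule has_derivative_ident)
  then have d: "(\<lambda>z. snd c (chart_inv c z)) differentiable (at z)"
    "frechet_derivative (\<lambda>z. snd c (chart_inv c z)) (at z) = (\<lambda>w. w)"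
    using eventually_cong_derivative[OF e1] frechet_derivative_eqI by auto
  have "\<forall>\<^sub>F z in nhds z. chart_inv c z \<in> fst c" using ev by eventually_elim (rule chart_inv_in)
  with d(1) c show "dif_par A (chart_inv c) z" unfolding dif_par_def by blast
  show "x \<in> fst c \<Longrightarrow> coord_vec A c x w = vel A (chart_inv c) (snd c x) w"
    using chart_inv_snd[OF A c] by (auto simp: coord_vec_def vel_def o_def)
  show "coord_vec A c (chart_inv c z) w = vel A (chart_inv c) z w"
    using chart_inv_in[OF z] by (auto simp: coord_vec_def vel_def o_def)
  show "vel A (chart_inv c) z w c = w"
    using d(2) c chart_inv_in[OF z] by (simp add: vel_def charts_at_def)
qed

text \<open>The compatibility clause of \<open>tangent_space\<close> recovers all coordinates of a
  vector from those in one chart, and the inverse of that chart has a velocity with the same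
  coordinates.\<close>

lemma tangent_vector_eq_vel:
  assumes A: "smooth_atlas A" and v: "v \<in> tangent_space A x" and c: "c \<in> charts_at A x"
  shows "v = vel A (chart_inv c) (snd c x) (v c)"
proof
  fix d
  have x: "chart_inv c (snd c x) = x" using c chart_inv_snd[OF A] by (simp add: charts_at_def)
  have "v d = 0" if "d \<notin> charts_at A x" using v that unfolding tangent_space_def by blast
  moreover have "v d = frechet_derivative (\<lambda>z. snd d (chart_inv c z)) (at (snd c x)) (v c)" if "d \<in> charts_at A x"
    using v c that unfolding tangent_space_def o_def by blast
  ultimately show "v d = vel A (chart_inv c) (snd c x) (v c) d"
    unfolding vel_def x by presburger
qed

lemma tangent_space_eqI:
  assumes A: "smooth_atlas A" and "u \<in> tangent_space A x" "v \<in> tangent_space A x" "c \<in> charts_at A x" "u c = v c"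
  shows "u = v"
  by (subst tangent_vector_eq_vel[OF A assms(2,4)], subst tangent_vector_eq_vel[OF A assms(3,4)], subst assms(5)) (rule refl)

lemma dif_fun_chart:
  assumes A: "smooth_atlas A" and F: "dif_fun A F x" and d: "d \<in> charts_at A x"
  shows "(\<lambda>z. F (chart_inv d z)) differentiable (at (snd d x))"
proof -
  from F obtain c where c: "c \<in> charts_at A x" "(\<lambda>z. F (chart_inv c z)) differentiable (at (snd c x))"
    unfolding dif_fun_def by blast
  have cA: "c \<in> A" "x \<in> fst c" and dA: "d \<in> A" "x \<in> fst d" using c d by (auto simp: charts_at_def)
  have dp: "dif_par A (chart_inv d) (snd d x)" using dif_par_chart_inv(1)[OF A dA(1)] dA by blast
  have xx: "chart_inv d (snd d x) = x" using chart_inv_snd[OF A dA] .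
  have ev: "\<forall>\<^sub>F z in nhds (snd d x). chart_inv d z \<in> fst c"
    and df: "(\<lambda>z. snd c (chart_inv d z)) differentiable (at (snd d x))"
    using dif_par_chart[OF A dp, of c] c xx by auto
  have e: "\<forall>\<^sub>F z in nhds (snd d x). F (chart_inv c (snd c (chart_inv d z))) = F (chart_inv d z)"
    using ev by eventually_elim (simp add: chart_inv_snd[OF A cA(1)])
  have "(\<lambda>z. F (chart_inv c (snd c (chart_inv d z)))) differentiable (at (snd d x))"
    using frechet_derivative_comp(1)[OF df, of "\<lambda>z. F (chart_inv c z)"] c xx by simp
  then show ?thesis using eventually_cong_derivative(1)[OF e] by simp
qed

lemma tdiff_vel:
  assumes A: "smooth_atlas A" and F: "dif_fun A F (h y)" and h: "dif_par A h y"
  shows "tdiff A F (h y) (vel A h y w) = frechet_derivative (\<lambda>z. F (h z)) (at y) w"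
    and "(\<lambda>z. F (h z)) differentiable (at y)"
proof -
  define c where "c = chart_at A (h y)"
  have c: "c \<in> charts_at A (h y)" unfolding c_def using A by (rule chart_at_in)
  have cA: "c \<in> A" using c by (simp add: charts_at_def)
  have ev: "\<forall>\<^sub>F z in nhds y. h z \<in> fst c" and df: "(\<lambda>z. snd c (h z)) differentiable (at y)"
    using dif_par_chart[OF A h c] by auto
  have e: "\<forall>\<^sub>F z in nhds y. F (chart_inv c (snd c (h z))) = F (h z)"
    using ev by eventually_elim (simp add: chart_inv_snd[OF A cA])
  note cmp = frechet_derivative_comp[OF df dif_fun_chart[OF A F c]]
  show "(\<lambda>z. F (h z)) differentiable (at y)"
    using cmp eventually_cong_derivative[OF e] by simp
  show "tdiff A F (h y) (vel A h y w) = frechet_derivative (\<lambda>z. F (h z)) (at y) w"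
    using cmp eventually_cong_derivative[OF e] c
    by (simp add: tdiff_def Let_def vel_def o_def flip: c_def)
qed

lemma dif_map_comp:
  assumes A: "smooth_atlas A" and B: "smooth_atlas B" and F: "dif_map A B F (h y)" and h: "dif_par A h y"
  shows "dif_par B (\<lambda>z. F (h z)) y"
proof -
  from F obtain c where c: "c \<in> charts_at A (h y)" "dif_par B (\<lambda>z. F (chart_inv c z)) (snd c (h y))"
    unfolding dif_map_def by blast
  have cA: "c \<in> A" using c by (simp add: charts_at_def)
  have ev: "\<forall>\<^sub>F z in nhds y. h z \<in> fst c" and df: "(\<lambda>z. snd c (h z)) differentiable (at y)"
    using dif_par_chart[OF A h c(1)] by auto
  have e: "\<forall>\<^sub>F z in nhds y. F (chart_inv c (snd c (h z))) = F (h z)"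
    using ev by eventually_elim (simp add: chart_inv_snd[OF A cA])
  then show ?thesis
    using dif_par_comp[OF c(2) df] dif_par_cong(1)[OF e, of B] by simp
qed

lemma dif_map_fun:
  assumes A: "smooth_atlas A" and B: "smooth_atlas B" and F: "dif_map A B F x" and d: "d \<in> charts_at B (F x)"
  shows "dif_fun A (\<lambda>x. snd d (F x)) x"
proof -
  from F obtain c where c: "c \<in> charts_at A x" "dif_par B (\<lambda>z. F (chart_inv c z)) (snd c x)"
    unfolding dif_map_def by blast
  have "chart_inv c (snd c x) = x" using chart_inv_snd[OF A] c by (auto simp: charts_at_def)
  then show ?thesis
    using dif_par_chart(2)[OF B c(2), of d] d c unfolding dif_fun_def by auto
qed

lemma push_vel:
  assumes A: "smooth_atlas A" and B: "smooth_atlas B" and F: "dif_map A B F (h y)" and h: "dif_par A h y"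
  shows "push A B F (h y) (vel A h y w) = vel B (\<lambda>z. F (h z)) y w"
  using tdiff_vel(1)[OF A dif_map_fun[OF A B F] h]
  by (auto simp: push_def vel_def o_def)

lemma cov_along_vel:
  assumes P: "smooth_atlas P" and A: "smooth_atlas A"
    and F: "dif_map P A F (h y)" and h: "dif_par P h y"
    and E: "dif_fun P (\<lambda>p. E p c) (h y)" and c: "c \<in> charts_at A (F (h y))"
  shows "cov_along P A g F E (h y) (vel P h y w) c =
    frechet_derivative (\<lambda>z. E (h z) c) (at y) w +
      (\<chi> k. \<Sum>i\<in>UNIV. \<Sum>j\<in>UNIV. christoffel A g c (snd c (F (h y))) k i j *
         frechet_derivative (\<lambda>z. snd c (F (h z))) (at y) w $ i * E (h y) c $ j)"
  using tdiff_vel(1)[OF P E h] push_vel[OF P A F h] c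
  by (simp add: cov_along_def vel_def)

text \<open>Since \<open>W\<close> is open, the local extension in \<open>smooth_into\<close> agrees
  with \<open>h\<close> itself after shrinking, and the preimage of the overlap of two charts is
  open. So any prescribed chart around the value can replace the one supplied by the
  definition.\<close>

lemma smooth_into_local:
  assumes A: "smooth_atlas A" and W: "open W" and h: "smooth_into A W h" and y: "y \<in> W" and d: "d \<in> charts_at A (h y)"
  shows "\<exists>N. open N \<and> y \<in> N \<and> N \<subseteq> W \<and> h ` N \<subseteq> fst d \<and> smooth_on N (\<lambda>z. snd d (h z))"
proof -
  from h y obtain N h' c where N: "open N" "y \<in> N" "\<And>z. z \<in> N \<inter> W \<Longrightarrow> h' z = h z" "c \<in> A"
    "h' ` N \<subseteq> fst c" "smooth_on N (snd c \<circ> h')"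
    unfolding smooth_into_def by (metis (no_types, lifting))
  let ?V = "snd c ` (fst c \<inter> fst d)"
  have oV: "open ?V" using open_chart_image[OF A N(4)] smooth_atlasD(2)[OF A] d by (auto simp: charts_at_def)
  have oNW: "open (N \<inter> W)" using N W by auto
  have sm: "smooth_on (N \<inter> W) (\<lambda>z. snd c (h z))"
    using smooth_on_subset[OF N(6), of "N \<inter> W"] N(3) smooth_on_cong[OF oNW, of "snd c \<circ> h'" "\<lambda>z. snd c (h z)"] by auto
  define M where "M = N \<inter> W \<inter> (\<lambda>z. snd c (h z)) -` ?V"
  have oM: "open M" unfolding M_def
    by (rule continuous_open_preimage[OF smooth_on_continuous_on[OF sm] oNW oV])
  have hc: "h z \<in> fst c" if "z \<in> N \<inter> W" for z using N(3)[OF that] N(5) that by (metis IntD1 image_subset_iff)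
  have hd: "h z \<in> fst d" if "z \<in> M" for z
  proof -
    have "chart_inv c (snd c (h z)) \<in> fst d"
      using that unfolding M_def chart_image_Int[OF A N(4)] by auto
    then show ?thesis using chart_inv_snd[OF A N(4) hc] that M_def by auto
  qed
  have "smooth_on M (\<lambda>z. snd d (chart_inv c (snd c (h z))))"
    by (rule smooth_on_compose[OF oM oV smooth_atlasD(7)[OF A N(4)]])
      (use d smooth_on_subset[OF sm, of M] in \<open>auto simp: charts_at_def M_def\<close>)
  then have "smooth_on M (\<lambda>z. snd d (h z))"
    by (subst smooth_on_cong[OF oM, of _ "\<lambda>z. snd d (chart_inv c (snd c (h z)))"])
      (use chart_inv_snd[OF A N(4) hc] M_def in auto)
  moreover have "y \<in> M" using hc[of y] y N(2) d unfolding M_def by (auto simp: charts_at_def)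
  moreover have "M \<subseteq> W" unfolding M_def by blast
  ultimately show ?thesis using oM hd by blast
qed

lemma smooth_into_dif_par:
  assumes A: "smooth_atlas A" and W: "open W" and h: "smooth_into A W h" and y: "y \<in> W"
  shows "dif_par A h y"
proof -
  obtain d where d: "d \<in> charts_at A (h y)" using chart_at_in[OF A] by blast
  obtain N where N: "open N" "y \<in> N" "h ` N \<subseteq> fst d" "smooth_on N (\<lambda>z. snd d (h z))"
    using smooth_into_local[OF A W h y d] by blast
  have "\<forall>\<^sub>F z in nhds y. h z \<in> fst d" using eventually_nhds_in_open[OF N(1,2)] by eventually_elim (use N(3) in auto)
  moreover have "d \<in> A" using d by (simp add: charts_at_def)
  ultimately show ?thesis unfolding dif_par_def using smooth_on_differentiable[OF N(4,2)] by blast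
qed

lemma smooth_intoI:
  assumes "\<And>y. y \<in> W \<Longrightarrow> \<exists>N c. open N \<and> y \<in> N \<and> c \<in> A \<and> h ` N \<subseteq> fst c \<and> smooth_on N (\<lambda>z. snd c (h z))"
  shows "smooth_into A W h"
  unfolding smooth_into_def
proof
  fix y assume "y \<in> W"
  with assms obtain N c where "open N" "y \<in> N" "c \<in> A" "h ` N \<subseteq> fst c" "smooth_on N (\<lambda>z. snd c (h z))" by metis
  then show "\<exists>N F'. open N \<and> y \<in> N \<and> (\<forall>z\<in>N \<inter> W. F' z = h z) \<and> (\<exists>c\<in>A. F' ` N \<subseteq> fst c \<and> smooth_on N (snd c \<circ> F'))"
    by (intro exI[of _ N] exI[of _ h]) (auto simp: o_def)
qed

lemma smooth_fun_comp_into: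
  assumes A: "smooth_atlas A" and V: "open V" and F: "smooth_fun A V F"
    and W: "open W" and h: "smooth_into A W h" "h ` W \<subseteq> V"
  shows "smooth_on W (\<lambda>z. F (h z))"
proof (rule smooth_on_local)
  fix y assume y: "y \<in> W"
  obtain d where d: "d \<in> charts_at A (h y)" using chart_at_in[OF A] by blast
  have dA: "d \<in> A" using d by (simp add: charts_at_def)
  obtain N where N: "open N" "y \<in> N" "N \<subseteq> W" "h ` N \<subseteq> fst d" "smooth_on N (\<lambda>z. snd d (h z))"
    using smooth_into_local[OF A W h(1) y d] by blast
  have "smooth_on N (\<lambda>z. F (chart_inv d (snd d (h z))))"
  proof (rule smooth_on_compose[OF N(1) _ _ N(5)])
    show "open (snd d ` (fst d \<inter> V))" using open_chart_image[OF A dA V] .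
    show "smooth_on (snd d ` (fst d \<inter> V)) (\<lambda>z. F (chart_inv d z))"
      using F dA by (auto simp: smooth_fun_def o_def)
    show "(\<lambda>z. snd d (h z)) ` N \<subseteq> snd d ` (fst d \<inter> V)" using N h by blast
  qed
  then have "smooth_on N (\<lambda>z. F (h z))"
    by (subst smooth_on_cong[OF N(1), of _ "\<lambda>z. F (chart_inv d (snd d (h z)))"])
      (use chart_inv_snd[OF A dA] N in auto)
  then show "\<exists>V. open V \<and> y \<in> V \<and> smooth_on V (\<lambda>z. F (h z))" using N by blast
qed

lemma smooth_map_comp_into:
  assumes A: "smooth_atlas A" and B: "smooth_atlas B" and F: "smooth_map A B F"
    and W: "open W" and h: "smooth_into A W h"
  shows "smooth_into B W (\<lambda>z. F (h z))"
proof (rule smooth_intoI)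
  fix y assume y: "y \<in> W"
  obtain d where d: "d \<in> charts_at A (h y)" using chart_at_in[OF A] by blast
  have dA: "d \<in> A" and hd: "h y \<in> fst d" using d by (auto simp: charts_at_def)
  obtain e where e: "e \<in> charts_at B (F (h y))" using chart_at_in[OF B] by blast
  obtain N where N: "open N" "y \<in> N" "N \<subseteq> W" "h ` N \<subseteq> fst d" "smooth_on N (\<lambda>z. snd d (h z))"
    using smooth_into_local[OF A W h(1) y d] by blast
  have F': "smooth_into B (snd d ` fst d) (\<lambda>z. F (chart_inv d z))"
    using F dA by (simp add: smooth_map_def o_def)
  obtain M where M: "open M" "snd d (h y) \<in> M" "M \<subseteq> snd d ` fst d" "(\<lambda>z. F (chart_inv d z)) ` M \<subseteq> fst e"
    "smooth_on M (\<lambda>z. snd e (F (chart_inv d z)))"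
    using smooth_into_local[OF B smooth_atlasD(3)[OF A dA] F', of "snd d (h y)" e] e hd chart_inv_snd[OF A dA hd] by auto
  define K where "K = N \<inter> (\<lambda>z. snd d (h z)) -` M"
  have oK: "open K" unfolding K_def by (rule continuous_open_preimage[OF smooth_on_continuous_on[OF N(5)] N(1) M(1)])
  have hh: "chart_inv d (snd d (h z)) = h z" if "z \<in> K" for z
    using that N(4) chart_inv_snd[OF A dA] by (auto simp: K_def)
  have "smooth_on K (\<lambda>z. snd e (F (chart_inv d (snd d (h z)))))"
    by (rule smooth_on_compose[OF oK M(1) M(5)]) (use smooth_on_subset[OF N(5), of K] K_def in auto)
  then have "smooth_on K (\<lambda>z. snd e (F (h z)))"
    by (subst smooth_on_cong[OF oK, of _ "\<lambda>z. snd e (F (chart_inv d (snd d (h z))))"]) (use hh in auto)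
  moreover have "(\<lambda>z. F (h z)) ` K \<subseteq> fst e"
  proof
    fix a assume "a \<in> (\<lambda>z. F (h z)) ` K"
    then obtain z where "z \<in> K" "a = F (chart_inv d (snd d (h z)))" using hh by force
    then show "a \<in> fst e" using M(4) by (auto simp: K_def)
  qed
  moreover have "y \<in> K" using N M by (auto simp: K_def)
  moreover have "e \<in> B" using e by (simp add: charts_at_def)
  ultimately show "\<exists>N c. open N \<and> y \<in> N \<and> c \<in> B \<and> (\<lambda>z. F (h z)) ` N \<subseteq> fst c \<and> smooth_on N (\<lambda>z. snd c (F (h z)))"
    using oK by blast
qed

lemma smooth_map_dif_map:
  assumes A: "smooth_atlas A" and B: "smooth_atlas B" and F: "smooth_map A B F"
  shows "dif_map A B F x"
proof -
  obtain d where d: "d \<in> charts_at A x" using chart_at_in[OF A] by blast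
  have dA: "d \<in> A" and hd: "x \<in> fst d" using d by (auto simp: charts_at_def)
  have F': "smooth_into B (snd d ` fst d) (\<lambda>z. F (chart_inv d z))"
    using F dA by (simp add: smooth_map_def o_def)
  have "snd d x \<in> snd d ` fst d" using hd by blast
  from smooth_into_dif_par[OF B smooth_atlasD(3)[OF A dA] F' this] show ?thesis
    unfolding dif_map_def using d by blast
qed

lemma smooth_fun_dif_fun:
  assumes A: "smooth_atlas A" and F: "smooth_fun A V F" and x: "x \<in> V"
  shows "dif_fun A F x"
proof -
  obtain d where d: "d \<in> charts_at A x" using chart_at_in[OF A] by blast
  have dA: "d \<in> A" and hd: "x \<in> fst d" using d by (auto simp: charts_at_def)
  have "smooth_on (snd d ` (fst d \<inter> V)) (\<lambda>z. F (chart_inv d z))"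
    using F dA by (auto simp: smooth_fun_def o_def)
  moreover have "snd d x \<in> snd d ` (fst d \<inter> V)" using hd x by blast
  ultimately have "(\<lambda>z. F (chart_inv d z)) differentiable (at (snd d x))" by (rule smooth_on_differentiable)
  then show ?thesis unfolding dif_fun_def using d by blast
qed

lemma smooth_into_chart_inv:
  assumes A: "smooth_atlas A" and c: "c \<in> A"
  shows "smooth_into A (snd c ` fst c) (chart_inv c)"
proof (rule smooth_intoI)
  fix y assume y: "y \<in> snd c ` fst c"
  note o = smooth_atlasD(3)[OF A c]
  have "smooth_on (snd c ` fst c) (\<lambda>z. snd c (chart_inv c z))"
    by (subst smooth_on_cong[OF o, of _ "\<lambda>z. z"]) (auto intro: chart_inv_in smooth_on_bounded_linear bounded_linear_ident)
  moreover have "chart_inv c ` (snd c ` fst c) \<subseteq> fst c" by (auto intro: inv_into_into)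
  ultimately show "\<exists>N c'. open N \<and> y \<in> N \<and> c' \<in> A \<and> chart_inv c ` N \<subseteq> fst c' \<and> smooth_on N (\<lambda>z. snd c' (chart_inv c z))"
    using o y c by (intro exI[of _ "snd c ` fst c"] exI[of _ c] conjI)
qed

lemma smooth_into_subset:
  assumes "smooth_into A W h" "V \<subseteq> W"
  shows "smooth_into A V h"
  unfolding smooth_into_def
proof
  fix z assume "z \<in> V"
  then have "z \<in> W" using assms(2) by blast
  obtain N F' where "open N" "z \<in> N" "\<forall>y\<in>N \<inter> W. F' y = h y"
    "\<exists>c\<in>A. F' ` N \<subseteq> fst c \<and> smooth_on N (snd c \<circ> F')"
    using bspec[OF assms(1)[unfolded smooth_into_def] \<open>z \<in> W\<close>] by (elim exE conjE)
  then show "\<exists>N F'. open N \<and> z \<in> N \<and> (\<forall>y\<in>N \<inter> V. F' y = h y) \<and>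
      (\<exists>c\<in>A. F' ` N \<subseteq> fst c \<and> smooth_on N (snd c \<circ> F'))"
    by (intro exI[of _ N] exI[of _ F'] conjI ballI) (use assms(2) in \<open>blast+\<close>)
qed

section \<open>The group \<open>Spin\<^sup>c\<^sub>2\<close> and its representations\<close>

text \<open>The diagonal unitary matrices in additive angles: products become sums, at the price
  that one matrix has many pairs of angles.\<close>

definition tor :: "real \<Rightarrow> real \<Rightarrow> complex ^ 2 ^ 2" where
  "tor u t = vector [vector [cis u, 0], vector [0, cis t]]"

lemma vec2_eq_iff: "x = y \<longleftrightarrow> x $ 1 = y $ 1 \<and> x $ 2 = y $ 2" for x y :: "'a ^ 2"
  by (simp add: vec_eq_iff forall_2)

lemma matrix2_eq_iff:
  "A = B \<longleftrightarrow> A $ 1 $ 1 = B $ 1 $ 1 \<and> A $ 1 $ 2 = B $ 1 $ 2 \<and> A $ 2 $ 1 = B $ 2 $ 1 \<and> A $ 2 $ 2 = B $ 2 $ 2"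
  for A B :: "'a ^ 2 ^ 2"
  by (auto simp: vec2_eq_iff)

lemma matrix2_mult_nth: "(A ** B) $ i $ j = A $ i $ 1 * B $ 1 $ j + A $ i $ 2 * B $ 2 $ j"
  for A B :: "'a::semiring_1 ^ 2 ^ 2"
  by (simp add: matrix_matrix_mult_def sum_2)

lemma matrix2_vector_nth: "(A *v x) $ i = A $ i $ 1 * x $ 1 + A $ i $ 2 * x $ 2"
  for A :: "'a::semiring_1 ^ 2 ^ 2"
  by (simp add: matrix_vector_mult_def sum_2)

lemma tor_nth [simp]: "tor u t $ 1 $ 1 = cis u" "tor u t $ 1 $ 2 = 0" "tor u t $ 2 $ 1 = 0" "tor u t $ 2 $ 2 = cis t"
  by (simp_all add: tor_def)

lemma cl_nth [simp]: "cl v $ 1 $ 1 = 0" "cl v $ 1 $ 2 = \<i> * Complex (v $ 1) (v $ 2)"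
  "cl v $ 2 $ 1 = \<i> * cnj (Complex (v $ 1) (v $ 2))" "cl v $ 2 $ 2 = 0"
  by (simp_all add: cl_def gamma1_def gamma2_def complex_eq_iff)

lemma tor_mult: "tor u t ** tor u' t' = tor (u + u') (t + t')"
  by (simp add: matrix2_eq_iff matrix2_mult_nth cis_mult)

lemma tor_zero: "tor 0 0 = mat 1"
  by (simp add: matrix2_eq_iff mat_def)

lemma matrix_inv_eqI:
  fixes A B :: "'a::semiring_1 ^ 'n ^ 'n"
  assumes "A ** B = mat 1" "B ** A = mat 1"
  shows "matrix_inv A = B"
proof -
  have "matrix_inv A ** A = mat 1"
    unfolding matrix_inv_def using someI[of "\<lambda>B. A ** B = mat 1 \<and> B ** A = mat 1"] assms by blast
  then have "(matrix_inv A ** A) ** B = B" by simp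
  then show ?thesis by (simp add: assms flip: matrix_mul_assoc)
qed

lemma matrix_inv_tor: "matrix_inv (tor u t) = tor (-u) (-t)"
  by (rule matrix_inv_eqI) (simp_all add: tor_mult tor_zero)

lemma tor_vector: "tor u t *v \<sigma> = vector [cis u * \<sigma> $ 1, cis t * \<sigma> $ 2]"
  by (simp add: vec2_eq_iff matrix2_vector_nth)

lemma unit_cis: "cmod z = 1 \<Longrightarrow> \<exists>a. z = cis a"
  using rcis_cmod_Arg[of z] unfolding rcis_def by (intro exI[of _ "Arg z"]) simp

lemma spin2_eq: "spin2 = {tor a (-a) |a. True}"
proof (intro equalityI subsetI)
  fix s assume "s \<in> spin2"
  then show "s \<in> {tor a (-a) |a. True}"
  proof induction
    case one
    have "mat 1 = tor 0 (-0)" by (simp add: tor_zero)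
    then show ?case by blast
  next
    case (mult s u v)
    then obtain a where s: "s = tor a (-a)" by blast
    have n: "cmod (Complex (w $ 1) (w $ 2)) = 1" if "norm w = 1" for w :: "real ^ 2"
      using that by (simp add: norm_vec_def L2_set_def sum_2 cmod_def)
    obtain b where b: "Complex (u $ 1) (u $ 2) = cis b" using unit_cis[OF n[OF mult(2)]] by blast
    obtain c where c: "Complex (v $ 1) (v $ 2) = cis c" using unit_cis[OF n[OF mult(3)]] by blast
    \<comment> \<open>\<open>cl u\<close> is antidiagonal with entries \<open>\<i> * z\<close> and
      \<open>\<i> * cnj z\<close>, so a product of two such matrices is diagonal with
      \<open>- z * cnj w\<close> and its conjugate. The sign is the summand
      \<open>pi\<close>.\<close>
    have "s ** cl u ** cl v = tor (a + b - c + pi) (-(a + b - c + pi))"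
      by (simp add: matrix2_eq_iff matrix2_mult_nth s b c cis_cnj cis_divide[symmetric] cis_mult[symmetric]
          cis_inverse[symmetric] divide_inverse del: cis_inverse cis_mult)
        (simp add: cis_mult cis_divide complex_eq_iff algebra_simps)
    then show ?case by blast
  qed
next
  fix s assume "s \<in> {tor a (-a) |a. True}"
  then obtain a where s: "s = tor a (-a)" by blast
  \<comment> \<open>With \<open>v\<close> the first basis vector, the product has \<open>- z\<close>
    and its conjugate on the diagonal, where \<open>z\<close> is \<open>u\<close> read as a complex
    number; hence the minus signs.\<close>
  define u v :: "real ^ 2" where "u = vector [- cos a, - sin a]" and "v = vector [1, 0]"
  have "mat 1 ** cl u ** cl v \<in> spin2"
    by (intro spin2.mult spin2.one) (simp_all add: u_def v_def norm_vec_def L2_set_def sum_2)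
  moreover have "mat 1 ** cl u ** cl v = s"
    by (simp add: s u_def v_def matrix2_eq_iff matrix2_mult_nth complex_eq_iff mat_def)
  ultimately show "s \<in> spin2" by simp
qed

text \<open>This is the factorization \<open>z s\<close> in terms of which the covering of
  \<open>SO\<^sub>2 \<times> S\<^sup>1\<close> is specified: the half sum of the angles goes to the
  circle, the half difference to the spin group.\<close>

lemma tor_eq_mat_mult: "tor u t = mat (cis ((u + t) / 2)) ** tor ((u - t) / 2) (- ((u - t) / 2))"
proof -
  have "(u + t) / 2 + (u - t) / 2 = u" "(u + t) / 2 - (u - t) / 2 = t" by (simp_all add: field_simps)
  then show ?thesis by (simp add: matrix2_eq_iff matrix2_mult_nth mat_def cis_mult)
qed

lemma spinc2_eq: "spinc2 = {tor u t |u t. True}"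
proof (intro equalityI subsetI)
  fix s assume "s \<in> spinc2"
  then obtain z a where z: "s = mat z ** tor a (-a)" "cmod z = 1"
    unfolding spinc2_def spin2_eq by blast
  obtain b where "z = cis b" using unit_cis[OF z(2)] by blast
  then have "s = tor (b + a) (b - a)"
    by (simp add: z matrix2_eq_iff matrix2_mult_nth mat_def cis_mult)
  then show "s \<in> {tor u t |u t. True}" by blast
next
  fix s assume "s \<in> {tor u t |u t. True}"
  then obtain u t where s: "s = tor u t" by blast
  have "tor ((u - t) / 2) (- ((u - t) / 2)) \<in> spin2" unfolding spin2_eq by blast
  then show "s \<in> spinc2" unfolding spinc2_def s tor_eq_mat_mult[of u t] by fastforce
qed

lemma tor_in_spinc2 [simp]: "tor u t \<in> spinc2"
  unfolding spinc2_eq by blast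

lemma cl_inject: "cl v = cl w \<Longrightarrow> v = w"
  by (auto simp: matrix2_eq_iff complex_eq_iff vec2_eq_iff)

text \<open>Conjugation multiplies the entry \<open>\<i> * z\<close> of \<open>cl v\<close> by
  \<open>cis (a + a)\<close>, a rotation by twice the angle. Injectivity of \<open>cl\<close> makes
  this matrix the only one that satisfies the definite description.\<close>

lemma Ad_tor: "Ad (tor a (-a)) = vector [vector [cos (a + a), - sin (a + a)], vector [sin (a + a), cos (a + a)]]"
proof -
  let ?R = "vector [vector [cos (a + a), - sin (a + a)], vector [sin (a + a), cos (a + a)]] :: real ^ 2 ^ 2"
  have d: "cos (a + a) = cos a * cos a - sin a * sin a" "cos (a * 2) = cos a * cos a - sin a * sin a"
    "sin (a + a) = 2 * sin a * cos a" "sin (a * 2) = 2 * sin a * cos a"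
    using cos_add[of a a] sin_add[of a a] by (simp_all add: mult.commute)
  have *: "cl (?R *v v) = tor a (-a) ** cl v ** matrix_inv (tor a (-a))" for v
    by (simp add: matrix2_eq_iff matrix2_mult_nth matrix_inv_tor matrix2_vector_nth complex_eq_iff
        d algebra_simps)
  show ?thesis unfolding Ad_def
  proof (rule the_equality)
    fix R assume "\<forall>v. cl (R *v v) = tor a (-a) ** cl v ** matrix_inv (tor a (-a))"
    then have "R *v v = ?R *v v" for v using * cl_inject by metis
    then show "R = ?R" by (simp add: matrix_eq)
  qed (use * in blast)
qed

lemma hermitian_sum: "hermitian \<sigma> \<tau> = \<sigma> $ 1 * cnj (\<tau> $ 1) + \<sigma> $ 2 * cnj (\<tau> $ 2)"
  by (simp add: hermitian_def sum_2)

lemma hermitian_tor: "hermitian (tor u t *v \<sigma>) (tor u t *v \<tau>) = hermitian \<sigma> \<tau>"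
proof -
  have "cis a * x * cnj (cis a * y) = x * cnj y" for a x y
  proof -
    have "cis a * cnj (cis a) = 1" by (simp add: complex_mult_cnj complex_eq_iff)
    then have "(cis a * cnj (cis a)) * (x * cnj y) = x * cnj y" by simp
    then show ?thesis by (simp add: ac_simps)
  qed
  then show ?thesis unfolding hermitian_sum tor_vector vector_2 by (simp only:)
qed

text \<open>\<open>smooth_map\<close> is phrased through charts, so continuity has to be recovered
  from the coordinate expressions. It is used for the projections of the two bundles.\<close>

lemma open_vimage_smooth_map:
  assumes A: "smooth_atlas A" and B: "smooth_atlas B" and F: "smooth_map A B F" and O: "open V"
  shows "open (F -` V)"
proof (subst open_subopen, rule ballI)
  fix x assume x: "x \<in> F -` V"
  define d where "d = chart_at A x"
  have d: "d \<in> A" "x \<in> fst d" using chart_at_in[OF A, of x] by (simp_all add: d_def charts_at_def)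
  define e where "e = chart_at B (F x)"
  have e: "e \<in> charts_at B (F x)" using chart_at_in[OF B] by (simp add: e_def)
  have eB: "e \<in> B" using e by (simp add: charts_at_def)
  have Fd: "smooth_into B (snd d ` fst d) (\<lambda>z. F (chart_inv d z))"
    using F d(1) by (simp add: smooth_map_def o_def)
  have xx: "chart_inv d (snd d x) = x" using chart_inv_snd[OF A d] .
  from smooth_into_local[OF B smooth_atlasD(3)[OF A d(1)] Fd, of "snd d x" e]
  obtain N where N: "open N" "snd d x \<in> N" "N \<subseteq> snd d ` fst d" "(\<lambda>z. F (chart_inv d z)) ` N \<subseteq> fst e"
    "smooth_on N (\<lambda>z. snd e (F (chart_inv d z)))"
    using d(2) e xx by auto
  define K where "K = N \<inter> (\<lambda>z. snd e (F (chart_inv d z))) -` (snd e ` (fst e \<inter> V))"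
  have oK: "open K" unfolding K_def
    by (rule continuous_open_preimage[OF smooth_on_continuous_on[OF N(5)] N(1) open_chart_image[OF B eB O]])
  define T where "T = fst d \<inter> snd d -` K"
  have "open T" unfolding T_def
    by (rule continuous_open_preimage[OF smooth_atlasD(5)[OF A d(1)] smooth_atlasD(2)[OF A d(1)] oK])
  moreover have "x \<in> T"
    using d(2) N(2,4) x xx by (auto simp: T_def K_def)
  moreover have "T \<subseteq> F -` V"
  proof
    fix p assume "p \<in> T"
    then have p: "p \<in> fst d" "snd d p \<in> K" by (auto simp: T_def)
    have pp: "chart_inv d (snd d p) = p" using chart_inv_snd[OF A d(1) p(1)] .
    have "F p \<in> fst e" using p N(4) pp by (force simp: K_def)
    moreover have "chart_inv e (snd e (F p)) \<in> V"
      using p(2) pp unfolding K_def chart_image_Int[OF B eB] by simp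
    ultimately show "p \<in> F -` V" using chart_inv_snd[OF B eB] by simp
  qed
  ultimately show "\<exists>T. open T \<and> x \<in> T \<and> T \<subseteq> F -` V" by blast
qed

text \<open>\<open>W\<close> is an arbitrary set because inverse trivializations are smooth on (open
  set) times (group), and the group is a thin subset of a space of matrices. Composition with a
  smooth map from an open set into that product gives a parametrization with open domain.\<close>

lemma smooth_into_compose:
  fixes m :: "'d::euclidean_space \<Rightarrow> 'e::euclidean_space"
  assumes V: "open V" and K: "smooth_into B W K" and m: "smooth_on V m" "m ` V \<subseteq> W"
  shows "smooth_into B V (\<lambda>z. K (m z))"
proof (rule smooth_intoI)
  fix y assume y: "y \<in> V"
  have "m y \<in> W" using m(2) y by blast
  obtain N K' c where N: "open N" "m y \<in> N" "\<forall>y\<in>N \<inter> W. K' y = K y" "c \<in> B" "K' ` N \<subseteq> fst c"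
    "smooth_on N (snd c \<circ> K')"
    using bspec[OF K[unfolded smooth_into_def] \<open>m y \<in> W\<close>] by (elim exE conjE bexE)
  define M where "M = V \<inter> m -` N"
  have oM: "open M" unfolding M_def
    by (rule continuous_open_preimage[OF smooth_on_continuous_on[OF m(1)] V N(1)])
  have e: "K' (m z) = K (m z)" if "z \<in> M" for z
    using that N(3) m(2) by (auto simp: M_def)
  have "smooth_on M (\<lambda>z. (snd c \<circ> K') (m z))"
    by (rule smooth_on_compose[OF oM N(1) N(6) smooth_on_subset[OF m(1)]]) (auto simp: M_def)
  then have "smooth_on M (\<lambda>z. snd c (K (m z)))"
    by (subst smooth_on_cong[OF oM, of _ "\<lambda>z. (snd c \<circ> K') (m z)"]) (use e in auto)
  moreover have "(\<lambda>z. K (m z)) ` M \<subseteq> fst c"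
  proof
    fix a assume "a \<in> (\<lambda>z. K (m z)) ` M"
    then obtain z where z: "z \<in> M" "a = K' (m z)" using e by auto
    then have "m z \<in> N" by (simp add: M_def)
    then show "a \<in> fst c" using N(5) z(2) by blast
  qed
  moreover have "y \<in> M" using y N(2) by (simp add: M_def)
  ultimately show "\<exists>N c. open N \<and> y \<in> N \<and> c \<in> B \<and> (\<lambda>z. K (m z)) ` N \<subseteq> fst c \<and> smooth_on N (\<lambda>z. snd c (K (m z)))"
    using oM N(4) by (intro exI[of _ M] exI[of _ c] conjI)
qed

lemma cis_has_derivative: "(cis has_derivative (\<lambda>v. v *\<^sub>R (\<i> * cis t))) (at t)"
proof -
  have "cis = (\<lambda>t. of_real (cos t) + \<i> * of_real (sin t))" by (simp add: fun_eq_iff complex_eq_iff)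
  moreover have "((\<lambda>t. of_real (cos t) + \<i> * of_real (sin t)) has_derivative (\<lambda>v. v *\<^sub>R (\<i> * cis t))) (at t)"
    by (auto intro!: derivative_eq_intros simp: fun_eq_iff complex_eq_iff)
  ultimately show ?thesis by simp
qed

text \<open>The directional derivatives of \<open>cis\<close> are constant multiples of
  \<open>cis\<close>, so the induction on the order closes.\<close>

lemma smooth_on_cis: "smooth_on UNIV cis"
proof -
  have e: "frechet_derivative cis (at t) v = v *\<^sub>R (\<i> * cis t)" for t v
    using frechet_derivative_eqI[OF cis_has_derivative] by simp
  have "Ck_on k UNIV cis" for k
  proof (induction k)
    case 0
    show ?case by (auto intro!: continuous_at_imp_continuous_on differentiable_imp_continuous_within differentiableI[OF cis_has_derivative])
  next
    case (Suc k)
    have "Ck_on k UNIV (\<lambda>t. v *\<^sub>R (\<i> * cis t))" for v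
      by (intro Ck_on_bounded_bilinear[OF open_UNIV bounded_bilinear_scaleR] Ck_on_bounded_bilinear[OF open_UNIV bounded_bilinear_mult]
          Ck_on_const Suc)
    then show ?case by (auto simp: e intro: differentiableI[OF cis_has_derivative])
  qed
  then show ?thesis by (simp add: smooth_on_def)
qed

section \<open>Spinors over a surface\<close>

locale spinc =
  fixes S :: "('m::topological_space, 'p::topological_space, 'q::topological_space) spinc_data"
  assumes spinc_surface: "spinc_surface S"
begin

section \<open>The Spin-c bundle as a principal bundle for the torus\<close>

lemma atlases: "smooth_atlas (M_atlas S)" "smooth_atlas (P_atlas S)" "smooth_atlas (Q_atlas S)"
  using spinc_surface unfolding spinc_surface_def oriented_atlas_def principal_bundle_def by blast+

lemma P_principal: "principal_bundle (P_atlas S) (M_atlas S) spinc2 (**) (mat 1) (P_proj S) (P_act S)"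
  and Q_principal: "principal_bundle (Q_atlas S) (M_atlas S) unit_circle (*) 1 (Q_proj S) (Q_act S)"
  and double_covering: "double_covering S"
  and riemannian: "riemannian_metric (M_atlas S) (metric S)"
  and connection: "connection_form (Q_atlas S) (Q_act S) (conn S)"
  using spinc_surface unfolding spinc_surface_def by blast+

lemma P_act_tor: "P_act S (P_act S p (tor u t)) (tor u' t') = P_act S p (tor (u + u') (t + t'))"
proof -
  have "P_act S (P_act S p (tor u t)) (tor u' t') = P_act S p (tor u t ** tor u' t')"
    using P_principal tor_in_spinc2 unfolding principal_bundle_def by blast
  then show ?thesis by (simp add: tor_mult)
qed

lemma P_act_one [simp]: "P_act S p (mat 1) = p"
  using P_principal unfolding principal_bundle_def by blast

lemma P_proj_act: "P_proj S (P_act S p (tor u t)) = P_proj S p"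
  using P_principal tor_in_spinc2 unfolding principal_bundle_def by blast

text \<open>A name for the local triviality clause, which in \<open>principal_bundle\<close> stands
  under an existential quantifier, so that its conjuncts can be used one at a time.\<close>

definition P_triv :: "'m set \<Rightarrow> ('p \<Rightarrow> complex ^ 2 ^ 2) \<Rightarrow> bool" where
  "P_triv U \<tau> \<longleftrightarrow> open U \<and>
     bij_betw (\<lambda>p. (P_proj S p, \<tau> p)) (P_proj S -` U) (U \<times> spinc2) \<and>
     (\<forall>p\<in>P_proj S -` U. \<forall>g\<in>spinc2. \<tau> (P_act S p g) = \<tau> p ** g) \<and>
     smooth_fun (P_atlas S) (P_proj S -` U) \<tau> \<and>
     (\<forall>c\<in>M_atlas S. smooth_into (P_atlas S) ((snd c ` (fst c \<inter> U)) \<times> spinc2)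
        (\<lambda>(y, g). inv_into (P_proj S -` U) (\<lambda>p. (P_proj S p, \<tau> p)) (chart_inv c y, g)))"

lemma P_trivialization: "\<exists>U \<tau>. x \<in> U \<and> P_triv U \<tau>"
  using P_principal unfolding principal_bundle_def P_triv_def by blast

lemma P_trivD:
  assumes "P_triv U \<tau>"
  shows "open U" and "bij_betw (\<lambda>p. (P_proj S p, \<tau> p)) (P_proj S -` U) (U \<times> spinc2)"
    and "P_proj S p \<in> U \<Longrightarrow> \<tau> (P_act S p (tor u t)) = \<tau> p ** tor u t"
    and "smooth_fun (P_atlas S) (P_proj S -` U) \<tau>"
    and "c \<in> M_atlas S \<Longrightarrow> smooth_into (P_atlas S) ((snd c ` (fst c \<inter> U)) \<times> spinc2)
           (\<lambda>(y, g). inv_into (P_proj S -` U) (\<lambda>p. (P_proj S p, \<tau> p)) (chart_inv c y, g))"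
    and "P_proj S p \<in> U \<Longrightarrow> \<exists>a b. \<tau> p = tor a b"
proof -
  note a = assms[unfolded P_triv_def]
  from a show "open U" by (rule conjunct1)
  from a show bij: "bij_betw (\<lambda>p. (P_proj S p, \<tau> p)) (P_proj S -` U) (U \<times> spinc2)" by (elim conjE)
  from a have "\<forall>p\<in>P_proj S -` U. \<forall>g\<in>spinc2. \<tau> (P_act S p g) = \<tau> p ** g" by (elim conjE)
  from bspec[OF bspec[OF this, of p] tor_in_spinc2[of u t]]
  show "P_proj S p \<in> U \<Longrightarrow> \<tau> (P_act S p (tor u t)) = \<tau> p ** tor u t" by (simp only: vimage_eq)
  from a show "smooth_fun (P_atlas S) (P_proj S -` U) \<tau>" by (elim conjE)
  from a have "\<forall>c\<in>M_atlas S. smooth_into (P_atlas S) ((snd c ` (fst c \<inter> U)) \<times> spinc2)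
           (\<lambda>(y, g). inv_into (P_proj S -` U) (\<lambda>p. (P_proj S p, \<tau> p)) (chart_inv c y, g))" by (elim conjE)
  then show "c \<in> M_atlas S \<Longrightarrow> smooth_into (P_atlas S) ((snd c ` (fst c \<inter> U)) \<times> spinc2)
           (\<lambda>(y, g). inv_into (P_proj S -` U) (\<lambda>p. (P_proj S p, \<tau> p)) (chart_inv c y, g))" by (rule bspec)
  have "(P_proj S p, \<tau> p) \<in> U \<times> spinc2" if "P_proj S p \<in> U" using bspec[OF bij_betwE[OF bij], of p] that by simp
  then show "P_proj S p \<in> U \<Longrightarrow> \<exists>a b. \<tau> p = tor a b" unfolding spinc2_eq by blast
qed

text \<open>In a trivialization the action is right multiplication in the group and can be
  cancelled. Only matrices are compared, as the angles are determined just up to multiples of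
  \<open>2 * pi\<close>.\<close>

lemma P_act_inject:
  assumes "P_act S p (tor u t) = P_act S p (tor u' t')"
  shows "tor u t = tor u' t'"
proof -
  obtain U \<tau> where U: "P_proj S p \<in> U" "P_triv U \<tau>" using P_trivialization by blast
  obtain a b where ab: "\<tau> p = tor a b" using P_trivD(6)[OF U(2,1)] by blast
  have "tor a b ** tor u t = tor a b ** tor u' t'"
    using P_trivD(3)[OF U(2,1), of u t] P_trivD(3)[OF U(2,1), of u' t'] assms ab by simp
  then have "tor (-a) (-b) ** (tor a b ** tor u t) = tor (-a) (-b) ** (tor a b ** tor u' t')" by simp
  then show ?thesis by (simp add: tor_mult)
qed

lemma P_act_transitive:
  assumes "P_proj S p' = P_proj S p"
  obtains u t where "p' = P_act S p (tor u t)"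
proof -
  obtain U \<tau> where U: "P_proj S p \<in> U" "P_triv U \<tau>" using P_trivialization by blast
  obtain a b where ab: "\<tau> p = tor a b" using P_trivD(6)[OF U(2,1)] by blast
  obtain a' b' where ab': "\<tau> p' = tor a' b'" using P_trivD(6)[OF U(2), of p'] U(1) assms by auto
  have "p' = P_act S p (tor (a' - a) (b' - b))"
  proof (rule inj_onD[OF bij_betw_imp_inj_on[OF P_trivD(2)[OF U(2)]]])
    show "(P_proj S p', \<tau> p') = (P_proj S (P_act S p (tor (a' - a) (b' - b))), \<tau> (P_act S p (tor (a' - a) (b' - b))))"
      using assms by (simp add: P_proj_act P_trivD(3)[OF U(2,1)] ab ab' tor_mult)
  qed (use assms U(1) in \<open>simp_all add: P_proj_act\<close>)
  then show thesis by (rule that)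
qed

section \<open>Spinors as equivariant functions on a fibre\<close>

lemma mem_spinor_class:
  "(p', \<sigma>') \<in> spinor_class S p \<sigma> \<longleftrightarrow> (\<exists>u t. p' = P_act S p (tor u t) \<and> \<sigma>' = tor (-u) (-t) *v \<sigma>)"
proof -
  have "(p', \<sigma>') \<in> spinor_class S p \<sigma> \<longleftrightarrow> (\<exists>h\<in>spinc2. p' = P_act S p h \<and> \<sigma>' = matrix_inv h *v \<sigma>)"
    unfolding spinor_class_def by blast
  also have "\<dots> \<longleftrightarrow> (\<exists>u t. p' = P_act S p (tor u t) \<and> \<sigma>' = matrix_inv (tor u t) *v \<sigma>)"
    unfolding spinc2_eq by blast
  finally show ?thesis unfolding matrix_inv_tor .
qed

lemma mem_spinor_class_act:
  "(P_act S p (tor u t), \<sigma>') \<in> spinor_class S p \<sigma> \<longleftrightarrow> \<sigma>' = tor (-u) (-t) *v \<sigma>"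
proof -
  have "tor (-u) (-t) = tor (-u') (-t')" if "P_act S p (tor u t) = P_act S p (tor u' t')" for u' t'
    using P_act_inject[OF that] matrix_inv_tor by metis
  then show ?thesis unfolding mem_spinor_class by metis
qed

lemma sp_comp_class: "sp_comp (P_act S p (tor u t)) (spinor_class S p \<sigma>) = tor (-u) (-t) *v \<sigma>"
  by (simp add: sp_comp_def mem_spinor_class_act)

text \<open>The torus is transitive on each fibre, so a set of pairs over one fibre is known from
  its members at the points \<open>P_act S p (tor u t)\<close>. Sums, multiples, Clifford products
  and covariant derivatives of spinors are all computed by this criterion.\<close>

lemma spinor_class_eqI:
  assumes "\<And>p' \<sigma>'. (p', \<sigma>') \<in> \<Phi> \<Longrightarrow> P_proj S p' = P_proj S p"
    and "\<And>u t \<sigma>'. (P_act S p (tor u t), \<sigma>') \<in> \<Phi> \<longleftrightarrow> \<sigma>' = tor (-u) (-t) *v \<sigma>"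
  shows "\<Phi> = spinor_class S p \<sigma>"
proof (intro set_eqI)
  fix z :: "'p \<times> (complex ^ 2)"
  obtain p' \<sigma>' where z: "z = (p', \<sigma>')" by (cases z)
  show "z \<in> \<Phi> \<longleftrightarrow> z \<in> spinor_class S p \<sigma>"
  proof (cases "P_proj S p' = P_proj S p")
    case True
    then obtain u t where "p' = P_act S p (tor u t)" by (rule P_act_transitive)
    then show ?thesis using assms(2) mem_spinor_class_act by (simp add: z)
  next
    case False
    moreover have "P_proj S p' = P_proj S p" if "(p', \<sigma>') \<in> spinor_class S p \<sigma>"
      using that P_proj_act unfolding mem_spinor_class by blast
    ultimately show ?thesis using assms(1) by (auto simp: z)
  qed
qed

lemma proj_spinor_class: "(p', \<sigma>') \<in> spinor_class S p \<sigma> \<Longrightarrow> P_proj S p' = P_proj S p"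
  using P_proj_act unfolding mem_spinor_class by blast

lemma spinor_class_self: "(p, \<sigma>) \<in> spinor_class S p \<sigma>"
  using mem_spinor_class_act[of p 0 0 \<sigma> \<sigma>] by (simp add: tor_zero)

lemma sp_add_class: "sp_add (spinor_class S p \<sigma>) (spinor_class S p \<tau>) = spinor_class S p (\<sigma> + \<tau>)"
  by (rule spinor_class_eqI)
    (auto simp: sp_add_def mem_spinor_class_act matrix_vector_right_distrib dest: proj_spinor_class)

lemma sp_scale_class: "sp_scale a (spinor_class S p \<sigma>) = spinor_class S p (a *s \<sigma>)"
proof (rule spinor_class_eqI)
  have "a *s (tor (-u) (-t) *v \<sigma>) = tor (-u) (-t) *v (a *s \<sigma>)" for u t
    by (simp add: vec2_eq_iff tor_vector)
  then show "(P_act S p (tor u t), \<sigma>') \<in> sp_scale a (spinor_class S p \<sigma>) \<longleftrightarrow> \<sigma>' = tor (- u) (- t) *v (a *s \<sigma>)" for u t \<sigma>'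
    by (simp add: sp_scale_def mem_spinor_class_act)
  show "P_proj S p' = P_proj S p" if "(p', \<sigma>') \<in> sp_scale a (spinor_class S p \<sigma>)" for p' \<sigma>'
    using that by (auto simp: sp_scale_def dest: proj_spinor_class)
qed

lemma sp_herm_class: "sp_herm (spinor_class S p \<sigma>) (spinor_class S p \<tau>) = hermitian \<sigma> \<tau>"
  unfolding sp_herm_def
proof (rule the_equality)
  show "\<forall>p' \<sigma>' \<tau>'. (p', \<sigma>') \<in> spinor_class S p \<sigma> \<and> (p', \<tau>') \<in> spinor_class S p \<tau> \<longrightarrow>
      hermitian \<sigma> \<tau> = hermitian \<sigma>' \<tau>'"
  proof (intro allI impI)
    fix p' \<sigma>' \<tau>' assume a: "(p', \<sigma>') \<in> spinor_class S p \<sigma> \<and> (p', \<tau>') \<in> spinor_class S p \<tau>"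
    then obtain u t where "p' = P_act S p (tor u t)" using mem_spinor_class by blast
    then show "hermitian \<sigma> \<tau> = hermitian \<sigma>' \<tau>'"
      using a mem_spinor_class_act hermitian_tor by simp
  qed
  fix z assume z: "\<forall>p' \<sigma>' \<tau>'. (p', \<sigma>') \<in> spinor_class S p \<sigma> \<and> (p', \<tau>') \<in> spinor_class S p \<tau> \<longrightarrow>
      z = hermitian \<sigma>' \<tau>'"
  show "z = hermitian \<sigma> \<tau>" using z spinor_class_self by blast
qed

lemma spinor_class_inject: "spinor_class S p \<sigma> = spinor_class S p \<tau> \<longleftrightarrow> \<sigma> = \<tau>"
  using spinor_class_self[of p \<sigma>] mem_spinor_class_act[of p 0 0 \<sigma> \<tau>] by (auto simp: tor_zero)

text \<open>Any point of the fibre can serve as base point of a class, in particular the value of a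
  local section; changing the base point multiplies the component by an element of the
  torus.\<close>

lemma spinor_fibre_class:
  assumes "\<Phi> \<in> spinor_fibre S (P_proj S p)"
  shows "\<Phi> = spinor_class S p (sp_comp p \<Phi>)"
proof -
  obtain p' \<sigma> where p': "\<Phi> = spinor_class S p' \<sigma>" "P_proj S p' = P_proj S p"
    using assms unfolding spinor_fibre_def by blast
  obtain u t where p: "p = P_act S p' (tor u t)"
    using p'(2) P_act_transitive by metis
  have c: "sp_comp p \<Phi> = tor (-u) (-t) *v \<sigma>" unfolding p p'(1) by (rule sp_comp_class)
  show ?thesis unfolding c
  proof (rule spinor_class_eqI)
    show "(P_act S p (tor u' t'), \<sigma>') \<in> \<Phi> \<longleftrightarrow> \<sigma>' = tor (-u') (-t') *v (tor (-u) (-t) *v \<sigma>)" for u' t' \<sigma>'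
      unfolding p'(1) p P_act_tor mem_spinor_class_act
      by (simp add: matrix_vector_mul_assoc tor_mult add.commute)
    show "P_proj S q = P_proj S p" if "(q, \<sigma>') \<in> \<Phi>" for q \<sigma>'
      using that proj_spinor_class p' by simp
  qed
qed

section \<open>Frames, the metric and Clifford multiplication\<close>

lemma theta_frame_in: "theta_frame S p \<in> so_frames S (P_proj S p)"
  using double_covering unfolding double_covering_def by blast

text \<open>The halves in \<open>tor_eq_mat_mult\<close> are undone by the double angle in
  \<open>Ad_tor\<close> and by the square of \<open>z\<close>. The combinations \<open>u - t\<close>
  and \<open>u + t\<close> obtained here become the two equations for a horizontal lift.\<close>

lemma theta_act:
  shows "theta_frame S (P_act S p (tor u t)) 1 =
      (\<lambda>c. cos (u - t) *\<^sub>R theta_frame S p 1 c + sin (u - t) *\<^sub>R theta_frame S p 2 c)"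
    and "theta_frame S (P_act S p (tor u t)) 2 =
      (\<lambda>c. - sin (u - t) *\<^sub>R theta_frame S p 1 c + cos (u - t) *\<^sub>R theta_frame S p 2 c)"
    and "theta_circle S (P_act S p (tor u t)) = Q_act S (theta_circle S p) (cis (u + t))"
proof -
  let ?s = "tor ((u - t) / 2) (- ((u - t) / 2))"
  have s: "?s \<in> spin2" unfolding spin2_eq by blast
  have "theta_frame S (P_act S p (mat z ** s)) =
          (\<lambda>j c. \<Sum>i\<in>UNIV. Ad s $ i $ j *\<^sub>R theta_frame S p i c) \<and>
        theta_circle S (P_act S p (mat z ** s)) = Q_act S (theta_circle S p) (z\<^sup>2)"
    if "s \<in> spin2" "cmod z = 1" for z s
    using double_covering that unfolding double_covering_def by blast
  from this[OF s, of "cis ((u + t) / 2)"]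
  have 1: "theta_frame S (P_act S p (tor u t)) = (\<lambda>j c. \<Sum>i\<in>UNIV. Ad ?s $ i $ j *\<^sub>R theta_frame S p i c)"
    "theta_circle S (P_act S p (tor u t)) = Q_act S (theta_circle S p) ((cis ((u + t) / 2))\<^sup>2)"
    unfolding tor_eq_mat_mult[symmetric] by simp_all
  have h: "(u - t) / 2 + (u - t) / 2 = u - t" by simp
  show "theta_frame S (P_act S p (tor u t)) 1 =
      (\<lambda>c. cos (u - t) *\<^sub>R theta_frame S p 1 c + sin (u - t) *\<^sub>R theta_frame S p 2 c)"
    "theta_frame S (P_act S p (tor u t)) 2 =
      (\<lambda>c. - sin (u - t) *\<^sub>R theta_frame S p 1 c + cos (u - t) *\<^sub>R theta_frame S p 2 c)"
    unfolding 1(1) Ad_tor h by (simp_all add: sum_2)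
  show "theta_circle S (P_act S p (tor u t)) = Q_act S (theta_circle S p) (cis (u + t))"
    unfolding 1(2) by (simp add: power2_eq_square cis_mult)
qed

lemma metric_linear:
  assumes "u \<in> tangent_space (M_atlas S) x" "v \<in> tangent_space (M_atlas S) x" "w \<in> tangent_space (M_atlas S) x"
  shows "metric S x (\<lambda>c. a *\<^sub>R u c + b *\<^sub>R v c) w = a * metric S x u w + b * metric S x v w"
  using riemannian assms unfolding riemannian_metric_def by blast

lemma metric_sym:
  assumes "u \<in> tangent_space (M_atlas S) x" "v \<in> tangent_space (M_atlas S) x"
  shows "metric S x u v = metric S x v u"
  using riemannian assms unfolding riemannian_metric_def by blast

lemma tangent_space_linear:
  assumes "u \<in> tangent_space (M_atlas S) x" "v \<in> tangent_space (M_atlas S) x"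
  shows "(\<lambda>c. a *\<^sub>R u c + b *\<^sub>R v c) \<in> tangent_space (M_atlas S) x"
proof -
  define c where "c = chart_at (M_atlas S) x"
  have c: "c \<in> charts_at (M_atlas S) x" using chart_at_in[OF atlases(1)] by (simp add: c_def)
  have cA: "c \<in> M_atlas S" "x \<in> fst c" using c by (auto simp: charts_at_def)
  have x: "chart_inv c (snd c x) = x" using chart_inv_snd[OF atlases(1) cA] .
  have z: "snd c x \<in> snd c ` fst c" using cA by blast
  note dp = dif_par_chart_inv(1)[OF atlases(1) cA(1) z]
  have "vel (M_atlas S) (chart_inv c) (snd c x) (a *\<^sub>R u c + b *\<^sub>R v c) = (\<lambda>c. a *\<^sub>R u c + b *\<^sub>R v c)"
    unfolding vel_linear[OF atlases(1) dp]
    using tangent_vector_eq_vel[OF atlases(1) assms(1) c] tangent_vector_eq_vel[OF atlases(1) assms(2) c] by simp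
  then show ?thesis using vel_in_tangent_space[OF atlases(1) dp] x by metis
qed

definition coords :: "'p \<Rightarrow> ('m, 2) tvec \<Rightarrow> real ^ 2" where
  "coords p X = (\<chi> i. metric S (P_proj S p) X (theta_frame S p i))"

lemma theta_frame_tangent: "theta_frame S p i \<in> tangent_space (M_atlas S) (P_proj S p)"
  using theta_frame_in unfolding oriented_frames_def by blast

lemma theta_frame_orthonormal:
  "metric S (P_proj S p) (theta_frame S p i) (theta_frame S p j) = (if i = j then 1 else 0)"
  using theta_frame_in unfolding oriented_frames_def by blast

text \<open>Equivariance of Clifford multiplication. The frame turns by \<open>u - t\<close>, so the
  coordinates, read as a complex number, acquire the factor \<open>cis (-(u - t))\<close>. This
  factor is exactly what exchanges the entries \<open>cis (-u)\<close> and \<open>cis (-t)\<close>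
  across the antidiagonal matrix \<open>cl\<close>.\<close>

lemma coords_act:
  assumes X: "X \<in> tangent_space (M_atlas S) (P_proj S p)"
  shows "cl (coords (P_act S p (tor u t)) X) *v (tor (-u) (-t) *v \<sigma>) = tor (-u) (-t) *v (cl (coords p X) *v \<sigma>)"
proof -
  note f = theta_frame_tangent[of p]
  have m: "metric S (P_proj S p) X (\<lambda>c. a *\<^sub>R theta_frame S p 1 c + b *\<^sub>R theta_frame S p 2 c) =
    a * coords p X $ 1 + b * coords p X $ 2" for a b
    using metric_linear[OF f[of 1] f[of 2] X, of a b] metric_sym[OF tangent_space_linear[OF f[of 1] f[of 2]] X, of a b]
      metric_sym[OF f X] by (simp add: coords_def)
  have c: "coords (P_act S p (tor u t)) X $ 1 = cos (u - t) * coords p X $ 1 + sin (u - t) * coords p X $ 2"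
    "coords (P_act S p (tor u t)) X $ 2 = - sin (u - t) * coords p X $ 1 + cos (u - t) * coords p X $ 2"
    unfolding m[symmetric] by (simp_all add: coords_def P_proj_act theta_act)
  define z where "z = Complex (coords p X $ 1) (coords p X $ 2)"
  have z: "Complex (coords (P_act S p (tor u t)) X $ 1) (coords (P_act S p (tor u t)) X $ 2) = cis (-(u - t)) * z"
  proof -
    have "Complex (cos d * a + sin d * b) (- sin d * a + cos d * b) = cis (-d) * Complex a b" for d a b
      by (simp add: complex_eq_iff)
    then show ?thesis unfolding c z_def .
  qed
  have t: "cis (-(u - t)) * cis (-t) = cis (-u)" "cnj (cis (-(u - t))) * cis (-u) = cis (-t)"
    by (simp_all add: cis_mult cis_cnj)
  show ?thesis
    unfolding vec2_eq_iff matrix2_vector_nth cl_nth tor_nth z z_def[symmetric] complex_cnj_mult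
    using t by (simp add: ac_simps)
qed

lemma cliff_class:
  assumes X: "X \<in> tangent_space (M_atlas S) (P_proj S p)"
  shows "cliff S X (spinor_class S p \<sigma>) = spinor_class S p (cl (coords p X) *v \<sigma>)"
proof (rule spinor_class_eqI)
  show "(P_act S p (tor u t), \<sigma>') \<in> cliff S X (spinor_class S p \<sigma>) \<longleftrightarrow>
    \<sigma>' = tor (- u) (- t) *v (cl (coords p X) *v \<sigma>)" for u t \<sigma>'
    unfolding cliff_def coords_act[OF X, symmetric] by (auto simp: mem_spinor_class_act coords_def)
  show "P_proj S p' = P_proj S p" if "(p', \<sigma>') \<in> cliff S X (spinor_class S p \<sigma>)" for p' \<sigma>'
    using that unfolding cliff_def by (auto dest: proj_spinor_class)
qed

end

lemma smooth_on_tor_pair: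
  fixes V :: "((real ^ 2) \<times> real \<times> real) set"
  assumes V: "open V"
  shows "smooth_on V (\<lambda>z. (fst z, tor (a + fst (snd z)) (b + snd (snd z))))"
proof -
  define L1 L2 :: "complex \<Rightarrow> (real ^ 2) \<times> (complex ^ 2 ^ 2)"
    where "L1 w = (0, vector [vector [w, 0], vector [0, 0]])" and "L2 w = (0, vector [vector [0, 0], vector [0, w]])" for w
  have L: "bounded_linear L1" "bounded_linear L2"
    unfolding linear_conv_bounded_linear[symmetric]
    by (auto intro!: linearI simp: L1_def L2_def matrix2_eq_iff)
  have e: "(\<lambda>z. (fst z, tor (a + fst (snd z)) (b + snd (snd z)))) =
    (\<lambda>z :: (real ^ 2) \<times> real \<times> real. (fst z, 0) + (L1 (cis (a + fst (snd z))) + L2 (cis (b + snd (snd z)))))"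
    by (auto simp: fun_eq_iff L1_def L2_def matrix2_eq_iff)
  have c: "smooth_on V (\<lambda>z. cis (k + l z))" if "bounded_linear l" for k l
    by (rule smooth_on_compose[OF V open_UNIV smooth_on_cis smooth_on_add[OF V smooth_on_const smooth_on_bounded_linear[OF that]]]) simp
  show ?thesis unfolding e
    by (intro smooth_on_add V smooth_on_linear_compose[OF V L(1)] smooth_on_linear_compose[OF V L(2)] c
        smooth_on_bounded_linear bounded_linear_intros bounded_linear_fst bounded_linear_snd
        bounded_linear_compose[OF bounded_linear_fst bounded_linear_snd] bounded_linear_compose[OF bounded_linear_snd bounded_linear_snd]
        bounded_linear_Pair bounded_linear_zero)
qed

lemma cis_Im_Ln: "cmod z = 1 \<Longrightarrow> cis (Im (Ln z)) = z"
proof -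
  assume z: "cmod z = 1"
  then have nz: "z \<noteq> 0" by auto
  have "exp (Ln z) = z" using nz by simp
  moreover have "Re (Ln z) = 0" using nz z by simp
  ultimately show ?thesis by (metis exp_eq_polar exp_zero mult_1 of_real_1)
qed

section \<open>Local parametrizations of the \<open>Spin\<^sup>c\<close> bundle\<close>

text \<open>\<open>Psi (y, u, t)\<close> is the point obtained from a local section at the point with coordinates \<open>y\<close>
  by the action of \<open>tor u t\<close>. The covering of the torus by \<open>\<real>\<^sup>2\<close> replaces the group by a
  Euclidean space; accordingly \<open>Psi\<close> is only locally invertible.\<close>

locale spinc_local = spinc S
  for S :: "('m::topological_space, 'p::topological_space, 'q::topological_space) spinc_data" +
  fixes c :: "('m, 2) chart" and W :: "(real ^ 2) set" and Psi :: "(real ^ 2) \<times> real \<times> real \<Rightarrow> 'p"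
  assumes c: "c \<in> M_atlas S" and W: "open W" "W \<subseteq> snd c ` fst c"
    and Psi_act: "y \<in> W \<Longrightarrow> Psi (y, u, t) = P_act S (Psi (y, 0, 0)) (tor u t)"
    and Psi_proj: "y \<in> W \<Longrightarrow> P_proj S (Psi (y, u, t)) = chart_inv c y"
    and Psi_smooth: "smooth_into (P_atlas S) (W \<times> UNIV) Psi"
    and Psi_inv: "y \<in> W \<Longrightarrow> \<exists>d\<in>charts_at (P_atlas S) (Psi (y, u, t)). \<exists>Th.
      (\<lambda>z. Th (chart_inv d z)) differentiable (at (snd d (Psi (y, u, t)))) \<and> Th (Psi (y, u, t)) = (y, u, t) \<and>
      (\<forall>\<^sub>F z in nhds (snd d (Psi (y, u, t))). Psi (Th (chart_inv d z)) = chart_inv d z)"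

context spinc
begin

lemma P_proj_smooth: "smooth_map (P_atlas S) (M_atlas S) (P_proj S)"
  using P_principal unfolding principal_bundle_def by blast

text \<open>\<open>Psi\<close> is an inverse trivialization composed with the angles, shifted by the
  angles \<open>a\<close>, \<open>b\<close> of \<open>p0\<close> so that the section passes through
  the prescribed point.\<close>

lemma local_parametrization:
  assumes c: "c \<in> M_atlas S" and p0: "P_proj S p0 \<in> fst c"
  shows "\<exists>W Psi. spinc_local S c W Psi \<and> snd c (P_proj S p0) \<in> W \<and> Psi (snd c (P_proj S p0), 0, 0) = p0"
proof -
  note MA = atlases(1) and PA = atlases(2)
  obtain U \<tau> where U: "P_proj S p0 \<in> U" "P_triv U \<tau>" using P_trivialization by blast
  obtain a b where ab: "\<tau> p0 = tor a b" using P_trivD(6)[OF U(2,1)] by blast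
  define W where "W = snd c ` (fst c \<inter> U)"
  have oW: "open W" unfolding W_def using open_chart_image[OF MA c P_trivD(1)[OF U(2)]] .
  have Wc: "W \<subseteq> snd c ` fst c" unfolding W_def by blast
  let ?F = "\<lambda>p. (P_proj S p, \<tau> p)"
  define K where "K = inv_into (P_proj S -` U) ?F"
  note bij = P_trivD(2)[OF U(2)]
  note inj = bij_betw_imp_inj_on[OF bij]
  have K: "P_proj S (K (x, g)) = x" "\<tau> (K (x, g)) = g" if "x \<in> U" "g \<in> spinc2" for x g
  proof -
    have "(x, g) \<in> ?F ` (P_proj S -` U)" using bij_betw_imp_surj_on[OF bij] that by simp
    then have "?F (K (x, g)) = (x, g)" unfolding K_def by (rule f_inv_into_f)
    then show "P_proj S (K (x, g)) = x" "\<tau> (K (x, g)) = g" by simp_all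
  qed
  define Psi where "Psi = (\<lambda>z. K (chart_inv c (fst z), tor (a + fst (snd z)) (b + snd (snd z))))"
  have yW: "chart_inv c y \<in> U" "chart_inv c y \<in> fst c" "snd c (chart_inv c y) = y" if "y \<in> W" for y
    using that Wc chart_inv_in[of y c] unfolding W_def chart_image_Int[OF MA c] by auto
  have Psi: "P_proj S (Psi (y, u, t)) = chart_inv c y" "\<tau> (Psi (y, u, t)) = tor (a + u) (b + t)" if "y \<in> W" for y u t
    using K[OF yW(1)[OF that] tor_in_spinc2, of "a + u" "b + t"] by (simp_all add: Psi_def)
  have act: "Psi (y, u, t) = P_act S (Psi (y, 0, 0)) (tor u t)" if y: "y \<in> W" for y u t
  proof (rule inj_onD[OF inj])
    show "?F (Psi (y, u, t)) = ?F (P_act S (Psi (y, 0, 0)) (tor u t))"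
      using P_trivD(3)[OF U(2), of "Psi (y, 0, 0)" u t] yW(1)[OF y] by (simp add: P_proj_act Psi[OF y] tor_mult)
  qed (use yW(1)[OF y] in \<open>simp_all add: P_proj_act Psi[OF y]\<close>)
  have oWU: "open (W \<times> (UNIV :: (real \<times> real) set))" using oW by (simp add: open_Times)
  have smooth: "smooth_into (P_atlas S) (W \<times> UNIV) Psi"
  proof -
    have "smooth_into (P_atlas S) (W \<times> spinc2) (\<lambda>(y, g). K (chart_inv c y, g))"
      using P_trivD(5)[OF U(2) c] unfolding K_def W_def .
    moreover have "(\<lambda>z. (fst z, tor (a + fst (snd z)) (b + snd (snd z)))) ` (W \<times> UNIV) \<subseteq> W \<times> spinc2"
      by (intro image_subsetI) (simp add: mem_Times_iff)
    ultimately have "smooth_into (P_atlas S) (W \<times> UNIV)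
      (\<lambda>z. case (fst z, tor (a + fst (snd z)) (b + snd (snd z))) of (y, g) \<Rightarrow> K (chart_inv c y, g))"
      by (rule smooth_into_compose[OF oWU _ smooth_on_tor_pair[OF oWU, of a b]])
    then show ?thesis unfolding Psi_def by simp
  qed
  have inv: "\<exists>d\<in>charts_at (P_atlas S) (Psi (y, u, t)). \<exists>Th.
      (\<lambda>z. Th (chart_inv d z)) differentiable (at (snd d (Psi (y, u, t)))) \<and> Th (Psi (y, u, t)) = (y, u, t) \<and>
      (\<forall>\<^sub>F z in nhds (snd d (Psi (y, u, t))). Psi (Th (chart_inv d z)) = chart_inv d z)"
    if y: "y \<in> W" for y u t
  proof -
    define p where "p = Psi (y, u, t)"
    have pp: "P_proj S p = chart_inv c y" "\<tau> p = tor (a + u) (b + t)" using Psi[OF y] by (simp_all add: p_def)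
    define d where "d = chart_at (P_atlas S) p"
    have d: "d \<in> charts_at (P_atlas S) p" unfolding d_def by (rule chart_at_in[OF PA])
    have dP: "d \<in> P_atlas S" "p \<in> fst d" using d by (auto simp: charts_at_def)
    define zd where "zd = snd d p"
    have zd: "zd \<in> snd d ` fst d" "chart_inv d zd = p" using dP chart_inv_snd[OF PA dP] by (auto simp: zd_def)
    note dk = dif_par_chart_inv(1)[OF PA dP(1) zd(1)]
    \<comment> \<open>A local inverse of \<open>Psi\<close> at \<open>p\<close>. The group
      coordinates are divided by their values at \<open>p\<close> before the logarithm is taken, so
      that the argument of \<open>Ln\<close> is 1 at \<open>p\<close> and \<open>Ln\<close> is
      differentiable there.\<close>
    define Th where "Th p' = (snd c (P_proj S p'), u + Im (Ln (\<tau> p' $ 1 $ 1 * cis (-(a + u)))),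
      t + Im (Ln (\<tau> p' $ 2 $ 2 * cis (-(b + t)))))" for p'
    \<comment> \<open>The branch of the logarithm does not matter in this direction:
      \<open>cis\<close> of the imaginary part of \<open>Ln\<close> returns every unit complex
      number unchanged.\<close>
    have inv: "Psi (Th p') = p'" if p': "P_proj S p' \<in> U" "P_proj S p' \<in> fst c" for p'
    proof -
      obtain a' b' where ab': "\<tau> p' = tor a' b'" using P_trivD(6)[OF U(2) p'(1)] by blast
      have cis: "cis (k + (l + Im (Ln (cis m * cis (-(k + l)))))) = cis m" for k l m
      proof -
        have "cis (k + (l + Im (Ln (cis m * cis (-(k + l)))))) = cis (k + l) * cis (Im (Ln (cis m * cis (-(k + l)))))"
          by (simp add: cis_mult add.assoc)
        also have "cis (Im (Ln (cis m * cis (-(k + l))))) = cis m * cis (-(k + l))"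
          by (rule cis_Im_Ln) (simp add: norm_mult)
        finally show ?thesis by (simp add: cis_mult)
      qed
      have yy: "snd c (P_proj S p') \<in> W" using p' by (auto simp: W_def)
      have "tor (a + fst (snd (Th p'))) (b + snd (snd (Th p'))) = \<tau> p'"
        unfolding ab' using cis[of a u a'] cis[of b t b'] by (simp add: Th_def ab' matrix2_eq_iff)
      then have "?F (Psi (Th p')) = ?F p'"
        using Psi[OF yy, of "fst (snd (Th p'))" "snd (snd (Th p'))"] chart_inv_snd[OF MA c p'(2)] by (simp add: Th_def)
      moreover have "P_proj S (Psi (Th p')) = P_proj S p'" using calculation by simp
      ultimately show ?thesis using inj_onD[OF inj, of "Psi (Th p')" p'] p'(1) by simp
    qed
    have Thp: "Th p = (y, u, t)"
      using yW(3)[OF y] by (simp add: Th_def pp cis_mult)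
    have dif: "(\<lambda>z. Th (chart_inv d z)) differentiable (at zd)"
    proof -
      have F1: "dif_fun (P_atlas S) (\<lambda>p. snd c (P_proj S p)) p"
        by (rule dif_map_fun[OF PA MA smooth_map_dif_map[OF PA MA P_proj_smooth]])
          (use c yW(2)[OF y] pp in \<open>simp add: charts_at_def\<close>)
      have F2: "dif_fun (P_atlas S) \<tau> p"
        by (rule smooth_fun_dif_fun[OF PA P_trivD(4)[OF U(2)]]) (use yW(1)[OF y] pp in simp)
      have d1: "(\<lambda>z. snd c (P_proj S (chart_inv d z))) differentiable (at zd)"
        using dif_fun_chart[OF PA F1 d] by (simp add: zd_def)
      have d2: "(\<lambda>z. \<tau> (chart_inv d z)) differentiable (at zd)"
        using dif_fun_chart[OF PA F2 d] by (simp add: zd_def)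
      have ln: "(\<lambda>z. r + Im (Ln (\<tau> (chart_inv d z) $ i $ i * k))) differentiable (at zd)"
        if one: "\<tau> p $ i $ i * k = 1" for i k r
      proof -
        have "bounded_linear (\<lambda>M :: complex ^ 2 ^ 2. M $ i $ i * k)"
          by (intro bounded_linear_compose[OF bounded_linear_mult_left] bounded_linear_compose[OF bounded_linear_vec_nth bounded_linear_vec_nth])
        from frechet_derivative_linear_compose(2)[OF this d2]
        have 1: "(\<lambda>z. \<tau> (chart_inv d z) $ i $ i * k) differentiable (at zd)" .
        have "Ln differentiable (at (\<tau> (chart_inv d zd) $ i $ i * k))"
          unfolding zd(2) one by (rule field_differentiable_imp_differentiable[OF field_differentiable_at_Ln]) simp
        from frechet_derivative_linear_compose(2)[OF bounded_linear_Im frechet_derivative_comp(1)[OF 1 this]]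
        show ?thesis by (intro derivative_intros)
      qed
      have n: "\<tau> p $ 1 $ 1 * cis (-(a + u)) = 1" "\<tau> p $ 2 $ 2 * cis (-(b + t)) = 1"
        by (simp_all add: pp cis_mult)
      show ?thesis unfolding Th_def
        by (intro differentiable_Pair d1 ln n)
    qed
    have "open (P_proj S -` (U \<inter> fst c))"
      by (rule open_vimage_smooth_map[OF PA MA P_proj_smooth]) (use P_trivD(1)[OF U(2)] smooth_atlasD(2)[OF MA c] in auto)
    then have "open (snd d ` fst d \<inter> chart_inv d -` (P_proj S -` (U \<inter> fst c)))"
      by (rule continuous_open_preimage[OF smooth_atlasD(6)[OF PA dP(1)] smooth_atlasD(3)[OF PA dP(1)]])
    moreover have "zd \<in> snd d ` fst d \<inter> chart_inv d -` (P_proj S -` (U \<inter> fst c))"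
      using zd pp yW[OF y] by simp
    ultimately have "\<forall>\<^sub>F z in nhds zd. z \<in> snd d ` fst d \<inter> chart_inv d -` (P_proj S -` (U \<inter> fst c))"
      by (rule eventually_nhds_in_open)
    then have ev: "\<forall>\<^sub>F z in nhds zd. Psi (Th (chart_inv d z)) = chart_inv d z"
      by eventually_elim (use inv in simp)
    show ?thesis unfolding p_def[symmetric]
      by (rule bexI[OF _ d], rule exI[of _ Th], intro conjI Thp) (use dif ev in \<open>simp_all only: zd_def\<close>)
  qed
  have "spinc_local S c W Psi"
    using spinc_axioms spinc_local_axioms.intro[OF c oW Wc act Psi(1) smooth inv]
    by (rule spinc_local.intro)
  moreover have x0: "snd c (P_proj S p0) \<in> W" using p0 U(1) by (auto simp: W_def)
  moreover have "Psi (snd c (P_proj S p0), 0, 0) = p0"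
  proof (rule inj_onD[OF inj])
    show "?F (Psi (snd c (P_proj S p0), 0, 0)) = ?F p0"
      using Psi[OF x0, of 0 0] chart_inv_snd[OF MA c p0] ab by simp
  qed (use Psi[OF x0, of 0 0] chart_inv_snd[OF MA c p0] U(1) in simp_all)
  ultimately show ?thesis by blast
qed

end

lemma frechet_derivative_real2:
  fixes F :: "real ^ 2 \<Rightarrow> 'b::real_normed_vector"
  assumes "F differentiable (at y)"
  shows "frechet_derivative F (at y) w = w $ 1 *\<^sub>R frechet_derivative F (at y) (axis 1 1) + w $ 2 *\<^sub>R frechet_derivative F (at y) (axis 2 1)"
proof -
  have l: "linear (frechet_derivative F (at y))" using assms by (rule linear_frechet_derivative)
  have "w = w $ 1 *\<^sub>R axis 1 1 + w $ 2 *\<^sub>R axis 2 1" by (simp add: vec2_eq_iff axis_def)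
  then have "frechet_derivative F (at y) w = frechet_derivative F (at y) (w $ 1 *\<^sub>R axis 1 1 + w $ 2 *\<^sub>R axis 2 1)" by simp
  then show ?thesis by (simp add: linear_add[OF l] linear_scale[OF l])
qed

lemma differentiable_has_derivative:
  "F differentiable (at y) \<Longrightarrow> (F has_derivative frechet_derivative F (at y)) (at y)"
  by (simp add: frechet_derivative_works)

lemma frechet_derivative_vec_nth:
  fixes F :: "'e::euclidean_space \<Rightarrow> 'b::euclidean_space ^ 'n"
  assumes "F differentiable (at y)"
  shows "frechet_derivative (\<lambda>z. F z $ i) (at y) w = frechet_derivative F (at y) w $ i"
    "(\<lambda>z. F z $ i) differentiable (at y)"
    "((\<lambda>z. F z $ i) has_derivative (\<lambda>w. frechet_derivative F (at y) w $ i)) (at y)"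
  using frechet_derivative_linear_compose[OF bounded_linear_vec_nth assms, of i]
    bounded_linear.has_derivative[OF bounded_linear_vec_nth differentiable_has_derivative[OF assms], of i] by auto

section \<open>Orthonormal frames on open subsets of the plane\<close>

definition chr :: "(real ^ 2 \<Rightarrow> real ^ 2 ^ 2) \<Rightarrow> real ^ 2 \<Rightarrow> 2 \<Rightarrow> 2 \<Rightarrow> 2 \<Rightarrow> real" where
  "chr G y k i j = 1 / 2 * (\<Sum>l\<in>UNIV. matrix_inv (G y) $ k $ l *
       (pdiff i (\<lambda>z. G z $ j $ l) y + pdiff j (\<lambda>z. G z $ i $ l) y - pdiff l (\<lambda>z. G z $ i $ j) y))"

lemma christoffel_chr: "christoffel A g c = chr (metric_matrix A g c)"
  by (simp add: fun_eq_iff christoffel_def chr_def Let_def)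

locale frame2 =
  fixes W :: "(real ^ 2) set" and G :: "real ^ 2 \<Rightarrow> real ^ 2 ^ 2" and e1 e2 :: "real ^ 2 \<Rightarrow> real ^ 2"
  assumes W: "open W"
    and G: "smooth_on W G" "\<And>y i j. y \<in> W \<Longrightarrow> G y $ i $ j = G y $ j $ i"
    and e: "smooth_on W e1" "smooth_on W e2"
    and on: "\<And>y. y \<in> W \<Longrightarrow> e1 y \<bullet> (G y *v e1 y) = 1" "\<And>y. y \<in> W \<Longrightarrow> e1 y \<bullet> (G y *v e2 y) = 0"
      "\<And>y. y \<in> W \<Longrightarrow> e2 y \<bullet> (G y *v e2 y) = 1"
begin

definition gm :: "real ^ 2 \<Rightarrow> real ^ 2 \<Rightarrow> real ^ 2 \<Rightarrow> real" where
  "gm y u v = u \<bullet> (G y *v v)"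

definition Gam :: "real ^ 2 \<Rightarrow> real ^ 2 \<Rightarrow> real ^ 2 \<Rightarrow> real ^ 2" where
  "Gam y u v = (\<chi> k. \<Sum>i\<in>UNIV. \<Sum>j\<in>UNIV. chr G y k i j * u $ i * v $ j)"

definition nab :: "(real ^ 2 \<Rightarrow> real ^ 2) \<Rightarrow> real ^ 2 \<Rightarrow> real ^ 2 \<Rightarrow> real ^ 2" where
  "nab V y w = frechet_derivative V (at y) w + Gam y w (V y)"

definition om :: "real ^ 2 \<Rightarrow> real ^ 2 \<Rightarrow> real" where
  "om y w = gm y (nab e1 y w) (e2 y)"

section \<open>The Levi-Civita connection in an orthonormal frame\<close>

lemma gm_expand: "gm y u v = G y $ 1 $ 1 * u $ 1 * v $ 1 + G y $ 1 $ 2 * u $ 1 * v $ 2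
    + G y $ 2 $ 1 * u $ 2 * v $ 1 + G y $ 2 $ 2 * u $ 2 * v $ 2"
  by (simp add: gm_def inner_vec_def sum_2 matrix2_vector_nth algebra_simps)

lemma gm_sum: "gm y u v = (\<Sum>i\<in>UNIV. \<Sum>j\<in>UNIV. G y $ i $ j * u $ i * v $ j)"
  by (simp add: gm_expand sum_2)

lemma gm_add: "gm y (u + u') v = gm y u v + gm y u' v" "gm y u (v + v') = gm y u v + gm y u v'"
  "gm y (r *\<^sub>R u) v = r * gm y u v" "gm y u (r *\<^sub>R v) = r * gm y u v"
  by (simp_all add: gm_expand algebra_simps)

lemma gm_sym: "y \<in> W \<Longrightarrow> gm y u v = gm y v u"
  using G(2)[of y 1 2] by (simp add: gm_expand algebra_simps)

lemma gm_on: "y \<in> W \<Longrightarrow> gm y (e1 y) (e1 y) = 1" "y \<in> W \<Longrightarrow> gm y (e1 y) (e2 y) = 0"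
  "y \<in> W \<Longrightarrow> gm y (e2 y) (e1 y) = 0" "y \<in> W \<Longrightarrow> gm y (e2 y) (e2 y) = 1"
  using on[of y] gm_sym[of y "e2 y" "e1 y"] by (simp_all add: gm_def)

text \<open>If \<open>E\<close> has columns \<open>e1\<close> and \<open>e2\<close>, orthonormality
  says \<open>transpose E ** G y ** E = mat 1\<close>, so \<open>E ** transpose E\<close> inverts
  \<open>G y\<close>. This evaluates \<open>matrix_inv\<close> and expresses its entries as
  polynomials in the frame.\<close>

lemma frame_inverse:
  assumes y: "y \<in> W"
  shows "(\<chi> j k. e1 y $ j * e1 y $ k + e2 y $ j * e2 y $ k) ** G y = mat 1"
    "G y ** (\<chi> j k. e1 y $ j * e1 y $ k + e2 y $ j * e2 y $ k) = mat 1"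
    "matrix_inv (G y) = (\<chi> j k. e1 y $ j * e1 y $ k + e2 y $ j * e2 y $ k)"
proof -
  define E :: "real ^ 2 ^ 2" where "E = (\<chi> j a. if a = 1 then e1 y $ j else e2 y $ j)"
  have "(transpose E ** G y) ** E = mat 1"
    using gm_on[OF y] unfolding gm_expand
    by (simp add: matrix2_eq_iff matrix2_mult_nth E_def transpose_def mat_def algebra_simps)
  then have "E ** (transpose E ** G y) = mat 1" using matrix_left_right_inverse by blast
  moreover have "E ** transpose E = (\<chi> j k. e1 y $ j * e1 y $ k + e2 y $ j * e2 y $ k)"
    by (simp add: matrix2_eq_iff matrix2_mult_nth E_def transpose_def)
  ultimately show 1: "(\<chi> j k. e1 y $ j * e1 y $ k + e2 y $ j * e2 y $ k) ** G y = mat 1"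
    by (simp add: matrix_mul_assoc)
  then show 2: "G y ** (\<chi> j k. e1 y $ j * e1 y $ k + e2 y $ j * e2 y $ k) = mat 1"
    using matrix_left_right_inverse by blast
  show "matrix_inv (G y) = (\<chi> j k. e1 y $ j * e1 y $ k + e2 y $ j * e2 y $ k)"
    by (rule matrix_inv_eqI[OF 2 1])
qed

lemma frame_expand:
  assumes y: "y \<in> W"
  shows "v = gm y v (e1 y) *\<^sub>R e1 y + gm y v (e2 y) *\<^sub>R e2 y"
proof -
  have "v = ((\<chi> j k. e1 y $ j * e1 y $ k + e2 y $ j * e2 y $ k) ** G y) *v v"
    unfolding frame_inverse(1)[OF y] by simp
  also have "\<dots> = gm y v (e1 y) *\<^sub>R e1 y + gm y v (e2 y) *\<^sub>R e2 y"
    using G(2)[OF y, of 1 2]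
    by (simp add: vec2_eq_iff matrix2_vector_nth matrix2_mult_nth gm_expand algebra_simps)
  finally show ?thesis .
qed

lemma G_diff: "y \<in> W \<Longrightarrow> (\<lambda>z. G z $ i $ j) differentiable (at y)"
  using smooth_on_differentiable[OF smooth_on_vec_nth[OF W smooth_on_vec_nth[OF W G(1)]]] .

lemma e_diff: "y \<in> W \<Longrightarrow> e1 differentiable (at y)" "y \<in> W \<Longrightarrow> e2 differentiable (at y)"
  using smooth_on_differentiable e by blast+

lemma G_sym_pdiff: "y \<in> W \<Longrightarrow> pdiff i (\<lambda>z. G z $ j $ l) y = pdiff i (\<lambda>z. G z $ l $ j) y"
  using differentiable_cong_open(2)[OF W, of y "\<lambda>z. G z $ j $ l" "\<lambda>z. G z $ l $ j"] G(2) by simp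

lemma chr_sym:
  assumes y: "y \<in> W"
  shows "chr G y k i j = chr G y k j i"
proof -
  have "pdiff l (\<lambda>z. G z $ i $ j) y = pdiff l (\<lambda>z. G z $ j $ i) y" for l by (rule G_sym_pdiff[OF y])
  then show ?thesis unfolding chr_def by (simp add: add.commute)
qed

lemma Gam_sym: "y \<in> W \<Longrightarrow> Gam y u v = Gam y v u"
  using chr_sym[of y _ 1 2] by (simp add: Gam_def vec2_eq_iff sum_2 algebra_simps)

text \<open>Lowering the upper index cancels the inverse metric and leaves the Christoffel symbols
  of the first kind.\<close>

lemma chr_first_kind:
  assumes y: "y \<in> W"
  shows "G y $ l $ 1 * chr G y 1 i j + G y $ l $ 2 * chr G y 2 i j =
    (pdiff i (\<lambda>z. G z $ j $ l) y + pdiff j (\<lambda>z. G z $ i $ l) y - pdiff l (\<lambda>z. G z $ i $ j) y) / 2"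
proof -
  have "G y ** matrix_inv (G y) = mat 1" using frame_inverse[OF y] by simp
  then have H: "G y $ l $ 1 * matrix_inv (G y) $ 1 $ m + G y $ l $ 2 * matrix_inv (G y) $ 2 $ m = (if l = m then 1 else 0)" for l m
    unfolding matrix2_mult_nth[symmetric] by (simp add: mat_def)
  define a where "a l = pdiff i (\<lambda>z. G z $ j $ l) y + pdiff j (\<lambda>z. G z $ i $ l) y - pdiff l (\<lambda>z. G z $ i $ j) y" for l
  have "G y $ l $ 1 * chr G y 1 i j + G y $ l $ 2 * chr G y 2 i j =
    1 / 2 * ((G y $ l $ 1 * matrix_inv (G y) $ 1 $ 1 + G y $ l $ 2 * matrix_inv (G y) $ 2 $ 1) * a 1
      + (G y $ l $ 1 * matrix_inv (G y) $ 1 $ 2 + G y $ l $ 2 * matrix_inv (G y) $ 2 $ 2) * a 2)"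
    unfolding chr_def a_def[symmetric] by (simp add: sum_2 algebra_simps)
  also have "\<dots> = a l / 2" unfolding H using exhaust_2[of l] by auto
  finally show ?thesis unfolding a_def .
qed

text \<open>With lowered symbols \<open>C\<close> and derivatives \<open>P\<close> of the metric one
  has \<open>C l i j + C j i l = P i j l\<close>. So the two Christoffel contributions add up to the
  term in which the product rule differentiates the metric.\<close>

lemma metric_compatible:
  assumes y: "y \<in> W" and V: "V differentiable (at y)" and U: "U differentiable (at y)"
  shows "frechet_derivative (\<lambda>z. gm z (V z) (U z)) (at y) w = gm y (nab V y w) (U y) + gm y (V y) (nab U y w)"
proof -
  have g: "((\<lambda>z. G z $ i $ j) has_derivative frechet_derivative (\<lambda>z. G z $ i $ j) (at y)) (at y)" for i j
    by (rule differentiable_has_derivative[OF G_diff[OF y]])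
  note v = frechet_derivative_vec_nth(3)[OF V] and u = frechet_derivative_vec_nth(3)[OF U]
  let ?DV = "frechet_derivative V (at y)" and ?DU = "frechet_derivative U (at y)"
  let ?DG = "\<lambda>i j. frechet_derivative (\<lambda>z. G z $ i $ j) (at y)"
  have t: "((\<lambda>z. G z $ i $ j * V z $ i * U z $ j) has_derivative
      (\<lambda>w. ?DG i j w * V y $ i * U y $ j + G y $ i $ j * ?DV w $ i * U y $ j + G y $ i $ j * V y $ i * ?DU w $ j)) (at y)" for i j
    by (rule has_derivative_eq_rhs[OF has_derivative_mult[OF has_derivative_mult[OF g v] u]]) (simp add: algebra_simps)
  have "((\<lambda>z. gm z (V z) (U z)) has_derivative
     (\<lambda>w. (\<Sum>i\<in>UNIV. \<Sum>j\<in>UNIV. ?DG i j w * V y $ i * U y $ j + G y $ i $ j * ?DV w $ i * U y $ j + G y $ i $ j * V y $ i * ?DU w $ j))) (at y)"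
  proof -
    have "(\<lambda>z. gm z (V z) (U z)) = (\<lambda>z. \<Sum>i\<in>UNIV. \<Sum>j\<in>UNIV. G z $ i $ j * V z $ i * U z $ j)"
      by (simp only: gm_sum)
    then show ?thesis by (auto intro!: has_derivative_sum t)
  qed
  note D0 = frechet_derivative_eqI[OF this]
  have D: "frechet_derivative (\<lambda>z. gm z (V z) (U z)) (at y) w =
     (\<Sum>i\<in>UNIV. \<Sum>j\<in>UNIV. ?DG i j w * V y $ i * U y $ j) + gm y (?DV w) (U y) + gm y (V y) (?DU w)"
    unfolding D0 by (simp only: sum.distrib gm_sum)
  have DG: "?DG i j w = w $ 1 * pdiff 1 (\<lambda>z. G z $ i $ j) y + w $ 2 * pdiff 2 (\<lambda>z. G z $ i $ j) y" for i j
    by (subst frechet_derivative_real2[OF G_diff[OF y]]) (simp only: real_scaleR_def)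
  define P where "P i j l = pdiff i (\<lambda>z. G z $ j $ l) y" for i j l
  define C where "C l i j = G y $ l $ 1 * chr G y 1 i j + G y $ l $ 2 * chr G y 2 i j" for l i j
  have C: "C l i j = (P i j l + P j i l - P l i j) / 2" for l i j
    unfolding C_def P_def by (rule chr_first_kind[OF y])
  have P: "P i 2 1 = P i 1 2" for i unfolding P_def by (rule G_sym_pdiff[OF y])
  have 1: "gm y (Gam y w a) b = (\<Sum>i\<in>UNIV. \<Sum>j\<in>UNIV. \<Sum>l\<in>UNIV. C l i j * w $ i * a $ j * b $ l)" for a b
    using G(2)[OF y, of 2 1] by (simp add: gm_expand Gam_def C_def sum_2 algebra_simps)
  have "gm y (Gam y w (V y)) (U y) + gm y (V y) (Gam y w (U y)) =
    (\<Sum>i\<in>UNIV. \<Sum>j\<in>UNIV. \<Sum>l\<in>UNIV. (C l i j + C j i l) * w $ i * V y $ j * U y $ l)"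
    unfolding gm_sym[OF y, of "V y"] 1 by (simp add: sum_2 algebra_simps)
  also have "\<dots> = (\<Sum>i\<in>UNIV. \<Sum>j\<in>UNIV. \<Sum>l\<in>UNIV. P i j l * w $ i * V y $ j * U y $ l)"
  proof -
    have "C l i j + C j i l = P i j l" for l i j
      unfolding C using P exhaust_2[of i] exhaust_2[of j] exhaust_2[of l] by (auto simp: field_simps)
    then show ?thesis by simp
  qed
  also have "\<dots> = (\<Sum>i\<in>UNIV. \<Sum>j\<in>UNIV. ?DG i j w * V y $ i * U y $ j)"
    unfolding DG P_def[symmetric] by (simp add: sum_2 algebra_simps)
  finally show ?thesis unfolding D nab_def gm_add by simp
qed

text \<open>The inner products of the frame fields are constant, so by metric compatibility the
  connection matrix is skew-symmetric; in dimension 2 the single entry \<open>om\<close>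
  remains.\<close>

lemma nab_frame:
  assumes y: "y \<in> W"
  shows "nab e1 y w = om y w *\<^sub>R e2 y" "nab e2 y w = - om y w *\<^sub>R e1 y"
proof -
  have "frechet_derivative (\<lambda>z. gm z (e1 z) (e1 z)) (at y) w = frechet_derivative (\<lambda>z. 1::real) (at y) w"
    by (subst differentiable_cong_open(2)[OF W y, of _ "\<lambda>z. 1"]) (auto simp: gm_on)
  then have 11: "gm y (nab e1 y w) (e1 y) = 0"
    using metric_compatible[OF y e_diff(1)[OF y] e_diff(1)[OF y], of w] gm_sym[OF y, of "e1 y"] by simp
  have "frechet_derivative (\<lambda>z. gm z (e2 z) (e2 z)) (at y) w = frechet_derivative (\<lambda>z. 1::real) (at y) w"
    by (subst differentiable_cong_open(2)[OF W y, of _ "\<lambda>z. 1"]) (auto simp: gm_on)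
  then have 22: "gm y (nab e2 y w) (e2 y) = 0"
    using metric_compatible[OF y e_diff(2)[OF y] e_diff(2)[OF y], of w] gm_sym[OF y, of "e2 y"] by simp
  have "frechet_derivative (\<lambda>z. gm z (e1 z) (e2 z)) (at y) w = frechet_derivative (\<lambda>z. 0::real) (at y) w"
    by (subst differentiable_cong_open(2)[OF W y, of _ "\<lambda>z. 0"]) (auto simp: gm_on)
  then have 12: "gm y (nab e2 y w) (e1 y) = - om y w"
    using metric_compatible[OF y e_diff(1)[OF y] e_diff(2)[OF y], of w] gm_sym[OF y, of "e1 y"]
    by (simp add: om_def)
  show "nab e1 y w = om y w *\<^sub>R e2 y"
    using frame_expand[OF y, of "nab e1 y w"] 11 by (simp add: om_def)
  show "nab e2 y w = - om y w *\<^sub>R e1 y"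
    using frame_expand[OF y, of "nab e2 y w"] 22 12 by simp
qed

text \<open>Absence of torsion: the Christoffel terms are symmetric and cancel in the difference of
  the two covariant derivatives, which \<open>nab_frame\<close> evaluates. No Christoffel symbol
  occurs on the left, which makes \<open>om\<close> comparable between charts.\<close>

lemma frame_bracket:
  assumes y: "y \<in> W"
  shows "frechet_derivative e2 (at y) (e1 y) - frechet_derivative e1 (at y) (e2 y) =
    - om y (e1 y) *\<^sub>R e1 y - om y (e2 y) *\<^sub>R e2 y"
proof -
  have "frechet_derivative e2 (at y) (e1 y) = - om y (e1 y) *\<^sub>R e1 y - Gam y (e1 y) (e2 y)"
    using nab_frame(2)[OF y, of "e1 y"] unfolding nab_def by (simp only: eq_diff_eq)
  moreover have "frechet_derivative e1 (at y) (e2 y) = om y (e2 y) *\<^sub>R e2 y - Gam y (e1 y) (e2 y)"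
    using nab_frame(1)[OF y, of "e2 y"] unfolding nab_def Gam_sym[OF y, of "e2 y"] by (simp only: eq_diff_eq)
  ultimately show ?thesis by simp
qed

text \<open>The divergence is defined by a trace in the coordinate basis; this moves it to the
  orthonormal frame. The matrix in \<open>frame_inverse\<close> being inverse to the metric is all
  that the change of basis amounts to.\<close>

lemma trace_frame:
  assumes y: "y \<in> W" and L: "linear L"
  shows "(\<Sum>i\<in>UNIV. L (axis i 1) $ i) = gm y (L (e1 y)) (e1 y) + gm y (L (e2 y)) (e2 y)"
proof -
  have x: "L v = v $ 1 *\<^sub>R L (axis 1 1) + v $ 2 *\<^sub>R L (axis 2 1)" for v
  proof -
    have "v = v $ 1 *\<^sub>R axis 1 1 + v $ 2 *\<^sub>R axis 2 1" by (simp add: vec2_eq_iff axis_def)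
    then have "L v = L (v $ 1 *\<^sub>R axis 1 1 + v $ 2 *\<^sub>R axis 2 1)" by simp
    then show ?thesis by (simp add: linear_add[OF L] linear_scale[OF L])
  qed
  have "(G y ** (\<chi> j k. e1 y $ j * e1 y $ k + e2 y $ j * e2 y $ k)) $ i $ j = (if i = j then 1 else 0)" for i j
    unfolding frame_inverse(2)[OF y] by (simp add: mat_def)
  note h = this[unfolded matrix2_mult_nth vec_lambda_beta]
  define M where "M i j = L (axis i 1) $ j" for i j
  have "gm y (L (e1 y)) (e1 y) + gm y (L (e2 y)) (e2 y) =
    (\<Sum>i\<in>UNIV. \<Sum>k\<in>UNIV. M i k * (G y $ k $ 1 * (e1 y $ 1 * e1 y $ i + e2 y $ 1 * e2 y $ i) + G y $ k $ 2 * (e1 y $ 2 * e1 y $ i + e2 y $ 2 * e2 y $ i)))"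
    unfolding gm_expand x[of "e1 y"] x[of "e2 y"] M_def by (simp add: sum_2 algebra_simps)
  also have "\<dots> = (\<Sum>i\<in>UNIV. \<Sum>k\<in>UNIV. M i k * (if k = i then 1 else 0))"
    by (simp only: h)
  finally show ?thesis by (simp add: M_def sum_2)
qed

end

lemma smooth_on_mult: "open W \<Longrightarrow> smooth_on W F \<Longrightarrow> smooth_on W G \<Longrightarrow> smooth_on W (\<lambda>y. F y * G y :: real)"
  by (rule smooth_on_bounded_bilinear[OF _ bounded_bilinear_mult])

lemma frechet_derivative_mult:
  fixes F G :: "'e::real_normed_vector \<Rightarrow> real"
  assumes "F differentiable (at y)" "G differentiable (at y)"
  shows "frechet_derivative (\<lambda>z. F z * G z) (at y) w = F y * frechet_derivative G (at y) w + frechet_derivative F (at y) w * G y"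
    "(\<lambda>z. F z * G z) differentiable (at y)"
proof -
  have d: "((\<lambda>z. F z * G z) has_derivative (\<lambda>w. F y * frechet_derivative G (at y) w + frechet_derivative F (at y) w * G y)) (at y)"
    by (rule has_derivative_mult[OF assms[unfolded frechet_derivative_works]])
  show "frechet_derivative (\<lambda>z. F z * G z) (at y) w = F y * frechet_derivative G (at y) w + frechet_derivative F (at y) w * G y"
    using frechet_derivative_eqI[OF d] by simp
  show "(\<lambda>z. F z * G z) differentiable (at y)" using d by (rule differentiableI)
qed

lemma frechet_derivative_add:
  assumes "F differentiable (at y)" "G differentiable (at y)"
  shows "frechet_derivative (\<lambda>z. F z + G z) (at y) w = frechet_derivative F (at y) w + frechet_derivative G (at y) w"
    "(\<lambda>z. F z + G z) differentiable (at y)"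
proof -
  have d: "((\<lambda>z. F z + G z) has_derivative (\<lambda>w. frechet_derivative F (at y) w + frechet_derivative G (at y) w)) (at y)"
    by (rule has_derivative_add[OF assms[unfolded frechet_derivative_works]])
  show "frechet_derivative (\<lambda>z. F z + G z) (at y) w = frechet_derivative F (at y) w + frechet_derivative G (at y) w"
    using frechet_derivative_eqI[OF d] by simp
  show "(\<lambda>z. F z + G z) differentiable (at y)" using d by (rule differentiableI)
qed

lemma axis_sum2: "v $ 1 *\<^sub>R axis 1 1 + v $ 2 *\<^sub>R axis 2 1 = v" for v :: "real ^ 2"
  by (simp add: vec2_eq_iff axis_def)

text \<open>Product rule for a form applied to a moving vector: it isolates the derivative of the
  form on a frozen vector, the shape in which exterior derivatives are expressed. Expansion of the
  vector in the basis reduces it to products with scalar functions.\<close>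

lemma frechet_derivative_linear_form:
  fixes \<beta> :: "'e::euclidean_space \<Rightarrow> 'f::euclidean_space \<Rightarrow> 'b::real_normed_vector"
  assumes W: "open W" "y \<in> W" and lin: "\<And>z. z \<in> W \<Longrightarrow> linear (\<beta> z)"
    and d: "\<And>v. (\<lambda>z. \<beta> z v) differentiable (at y)" and V: "V differentiable (at y)"
  shows "frechet_derivative (\<lambda>z. \<beta> z (V z)) (at y) w = frechet_derivative (\<lambda>z. \<beta> z (V y)) (at y) w + \<beta> y (frechet_derivative V (at y) w)"
    "(\<lambda>z. \<beta> z (V z)) differentiable (at y)"
proof -
  let ?D = "\<lambda>b. frechet_derivative (\<lambda>z. \<beta> z b) (at y)"
  have ex: "\<beta> z v = (\<Sum>b\<in>Basis. (v \<bullet> b) *\<^sub>R \<beta> z b)" if "z \<in> W" for z v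
  proof -
    have "\<beta> z v = \<beta> z (\<Sum>b\<in>Basis. (v \<bullet> b) *\<^sub>R b)" by (simp only: euclidean_representation)
    also have "\<dots> = (\<Sum>b\<in>Basis. (v \<bullet> b) *\<^sub>R \<beta> z b)"
      by (simp only: linear_sum[OF lin[OF that]] linear_scale[OF lin[OF that]] o_def)
    finally show ?thesis .
  qed
  have h: "((\<lambda>z. \<beta> z (v z)) has_derivative
    (\<lambda>w. \<Sum>b\<in>Basis. (v y \<bullet> b) *\<^sub>R ?D b w + (frechet_derivative v (at y) w \<bullet> b) *\<^sub>R \<beta> y b)) (at y)"
    if v: "v differentiable (at y)" for v
  proof (rule has_derivative_transform_within_open[OF _ W])
    have vb: "((\<lambda>z. v z \<bullet> b) has_derivative (\<lambda>w. frechet_derivative v (at y) w \<bullet> b)) (at y)" for b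
      by (rule bounded_linear.has_derivative[OF bounded_linear_inner_left differentiable_has_derivative[OF v]])
    show "((\<lambda>z. \<Sum>b\<in>Basis. (v z \<bullet> b) *\<^sub>R \<beta> z b) has_derivative
      (\<lambda>w. \<Sum>b\<in>Basis. (v y \<bullet> b) *\<^sub>R ?D b w + (frechet_derivative v (at y) w \<bullet> b) *\<^sub>R \<beta> y b)) (at y)"
      by (intro has_derivative_sum has_derivative_scaleR vb differentiable_has_derivative[OF d])
  qed (rule ex[symmetric])
  have "frechet_derivative (\<lambda>z. \<beta> z (V y)) (at y) w = (\<Sum>b\<in>Basis. (V y \<bullet> b) *\<^sub>R ?D b w)"
    using frechet_derivative_eqI[OF h, of "\<lambda>_. V y"] by simp
  moreover have "\<beta> y (frechet_derivative V (at y) w) = (\<Sum>b\<in>Basis. (frechet_derivative V (at y) w \<bullet> b) *\<^sub>R \<beta> y b)"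
    by (rule ex[OF W(2)])
  ultimately show "frechet_derivative (\<lambda>z. \<beta> z (V z)) (at y) w = frechet_derivative (\<lambda>z. \<beta> z (V y)) (at y) w + \<beta> y (frechet_derivative V (at y) w)"
    using frechet_derivative_eqI[OF h[OF V]] by (simp add: sum.distrib)
  show "(\<lambda>z. \<beta> z (V z)) differentiable (at y)" using h[OF V] by (rule differentiableI)
qed

section \<open>Curvature in an orthonormal frame\<close>

context frame2
begin

text \<open>The inverse metric is replaced by its expression in the frame, so that only sums and
  products of smooth functions remain.\<close>

lemma chr_smooth: "smooth_on W (\<lambda>y. chr G y k i j)"
proof -
  have g: "smooth_on W (\<lambda>y. pdiff a (\<lambda>z. G z $ p $ q) y)" for a p q
    by (rule smooth_on_frechet_derivative[OF smooth_on_vec_nth[OF W smooth_on_vec_nth[OF W G(1)]]])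
  have gm: "smooth_on W (\<lambda>y. -1 * pdiff a (\<lambda>z. G z $ p $ q) y)" for a p q
    by (rule smooth_on_mult[OF W smooth_on_const g])
  note ve = smooth_on_vec_nth[OF W e(1)] smooth_on_vec_nth[OF W e(2)]
  have "smooth_on W (\<lambda>y. 1 / 2 * (\<Sum>l\<in>UNIV. (e1 y $ k * e1 y $ l + e2 y $ k * e2 y $ l) *
       (pdiff i (\<lambda>z. G z $ j $ l) y + pdiff j (\<lambda>z. G z $ i $ l) y + -1 * pdiff l (\<lambda>z. G z $ i $ j) y)))"
    by (intro smooth_on_mult[OF W] smooth_on_sum[OF W] smooth_on_add[OF W] ve g gm smooth_on_const)
  then show ?thesis
    by (subst smooth_on_cong[OF W]) (simp_all add: chr_def frame_inverse(3))
qed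

lemma Gam_axis: "Gam y (axis i 1) v $ l = chr G y l i 1 * v $ 1 + chr G y l i 2 * v $ 2"
  using exhaust_2[of i] by (auto simp: Gam_def sum_2 axis_def)

lemma Gam_linear: "Gam y (a *\<^sub>R u + b *\<^sub>R u') v = a *\<^sub>R Gam y u v + b *\<^sub>R Gam y u' v"
  by (simp add: vec2_eq_iff Gam_def sum_2 algebra_simps)

lemma nab_linear:
  assumes "y \<in> W" "V differentiable (at y)"
  shows "nab V y (a *\<^sub>R u + b *\<^sub>R v) = a *\<^sub>R nab V y u + b *\<^sub>R nab V y v"
  using linear_frechet_derivative[OF assms(2)]
  by (simp add: nab_def Gam_linear linear_add linear_scale scaleR_add_right)

lemma om_linear: "y \<in> W \<Longrightarrow> om y (a *\<^sub>R u + b *\<^sub>R v) = a * om y u + b * om y v"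
  unfolding om_def using nab_linear[OF _ e_diff(1)] by (simp add: gm_add)

lemma om_axis: "y \<in> W \<Longrightarrow> om y v = v $ 1 *\<^sub>R om y (axis 1 1) + v $ 2 *\<^sub>R om y (axis 2 1)"
proof -
  assume "y \<in> W"
  from om_linear[OF this, of "v $ 1" "axis 1 1" "v $ 2" "axis 2 1"] show ?thesis
    unfolding axis_sum2 real_scaleR_def .
qed

lemma om_smooth: "smooth_on W (\<lambda>y. om y v)"
proof -
  note ve = smooth_on_vec_nth[OF W e(1)] smooth_on_vec_nth[OF W e(2)]
  have n: "smooth_on W (\<lambda>y. nab e1 y v $ k)" for k
    unfolding nab_def Gam_def vector_add_component vec_lambda_beta
    by (intro smooth_on_add[OF W] smooth_on_sum[OF W] smooth_on_mult[OF W] chr_smooth smooth_on_const ve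
        smooth_on_vec_nth[OF W smooth_on_frechet_derivative[OF e(1)]])
  show ?thesis unfolding om_def gm_sum
    by (intro smooth_on_sum[OF W] smooth_on_mult[OF W] n ve smooth_on_vec_nth[OF W smooth_on_vec_nth[OF W G(1)]])
qed

lemma om_diff: "y \<in> W \<Longrightarrow> (\<lambda>z. om z v) differentiable (at y)"
  by (rule smooth_on_differentiable[OF om_smooth])

definition riem :: "real ^ 2 \<Rightarrow> 2 \<Rightarrow> 2 \<Rightarrow> 2 \<Rightarrow> 2 \<Rightarrow> real" where
  "riem y l k i j =
     pdiff i (\<lambda>z. chr G z l j k) y - pdiff j (\<lambda>z. chr G z l i k) y +
     (\<Sum>m\<in>UNIV. chr G y l i m * chr G y m j k - chr G y l j m * chr G y m i k)"

text \<open>The exterior derivative of \<open>om\<close>, evaluated with constant coordinate vectors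
  so that no bracket term appears.\<close>

definition dom :: "real ^ 2 \<Rightarrow> real ^ 2 \<Rightarrow> real ^ 2 \<Rightarrow> real" where
  "dom y u v = frechet_derivative (\<lambda>z. om z v) (at y) u - frechet_derivative (\<lambda>z. om z u) (at y) v"

lemma nab_second:
  assumes y: "y \<in> W" and V: "smooth_on W V"
  shows "pdiff i (\<lambda>z. nab V z (axis j 1) $ l) y =
      frechet_derivative (\<lambda>z. frechet_derivative V (at z) (axis j 1)) (at y) (axis i 1) $ l +
      (\<Sum>m\<in>UNIV. chr G y l j m * frechet_derivative V (at y) (axis i 1) $ m + pdiff i (\<lambda>z. chr G z l j m) y * V y $ m)"
proof -
  note v = frechet_derivative_vec_nth(1,2)[OF smooth_on_differentiable[OF V y]]
  note v2 = frechet_derivative_vec_nth(1,2)[OF smooth_on_differentiable[OF smooth_on_frechet_derivative[OF V] y]]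
  note c = smooth_on_differentiable[OF chr_smooth y]
  note m = frechet_derivative_mult[OF c v(2)]
  have e: "(\<lambda>z. nab V z (axis j 1) $ l) =
      (\<lambda>z. frechet_derivative V (at z) (axis j 1) $ l + (chr G z l j 1 * V z $ 1 + chr G z l j 2 * V z $ 2))"
    by (simp add: fun_eq_iff nab_def Gam_axis)
  show ?thesis
    unfolding e frechet_derivative_add(1)[OF v2(2) frechet_derivative_add(2)[OF m(2) m(2)]]
      frechet_derivative_add(1)[OF m(2) m(2)] m(1) v(1) v2(1) sum_2 by simp
qed

text \<open>The curvature of the coordinate fields applied to \<open>V\<close> is the
  antisymmetrized second covariant derivative of \<open>V\<close>. The second partial derivatives of
  \<open>V\<close> cancel by symmetry, and so do the products of two values of
  \<open>\<theta>\<close>, leaving the exterior derivative of \<open>\<theta>\<close> times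
  \<open>U\<close>. Both \<open>(e1, e2, om)\<close> and \<open>(e2, e1, - om)\<close> are
  instances.\<close>

lemma curvature_rotation:
  assumes y: "y \<in> W" and V: "smooth_on W V" and U: "smooth_on W U" and \<theta>: "\<And>v. smooth_on W (\<lambda>z. \<theta> z v)"
    and nV: "\<And>z w. z \<in> W \<Longrightarrow> nab V z w = \<theta> z w *\<^sub>R U z" and nU: "\<And>z w. z \<in> W \<Longrightarrow> nab U z w = - \<theta> z w *\<^sub>R V z"
  shows "riem y l 1 1 2 * V y $ 1 + riem y l 2 1 2 * V y $ 2 =
    (pdiff 1 (\<lambda>z. \<theta> z (axis 2 1)) y - pdiff 2 (\<lambda>z. \<theta> z (axis 1 1)) y) * U y $ l"
proof -
  define DV where "DV i = frechet_derivative V (at y) (axis i 1)" for i :: 2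
  define c where "c k i j = chr G y k i j" for k i j
  define dc where "dc a k i j = pdiff a (\<lambda>z. chr G z k i j) y" for a k i j
  define V2 where "V2 j i = frechet_derivative (\<lambda>z. frechet_derivative V (at z) (axis j 1)) (at y) (axis i 1)" for i j :: 2
  have V2: "V2 1 2 = V2 2 1" unfolding V2_def by (rule frechet_derivative_symmetric[OF W y V])
  \<comment> \<open>The second covariant derivative, first in direction \<open>j\<close> and then in
    direction \<open>i\<close>: on the left from the rotation law, on the right from the definition
    of \<open>nab\<close>. The claim is the difference of the two orders.\<close>
  have s: "pdiff i (\<lambda>z. \<theta> z (axis j 1)) y * U y $ l - \<theta> y (axis j 1) * \<theta> y (axis i 1) * V y $ l =
    V2 j i $ l + (c l j 1 * DV i $ 1 + dc i l j 1 * V y $ 1) + (c l j 2 * DV i $ 2 + dc i l j 2 * V y $ 2)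
    + (c l i 1 * (DV j $ 1 + (c 1 j 1 * V y $ 1 + c 1 j 2 * V y $ 2)) + c l i 2 * (DV j $ 2 + (c 2 j 1 * V y $ 1 + c 2 j 2 * V y $ 2)))"
    (is "?L = ?R") for i j
  proof -
    have "pdiff i (\<lambda>z. nab V z (axis j 1) $ l) y = pdiff i (\<lambda>z. \<theta> z (axis j 1) * U z $ l) y"
      by (subst differentiable_cong_open(2)[OF W y, of _ "\<lambda>z. \<theta> z (axis j 1) * U z $ l"]) (simp_all add: nV)
    also have "\<dots> = \<theta> y (axis j 1) * frechet_derivative U (at y) (axis i 1) $ l + pdiff i (\<lambda>z. \<theta> z (axis j 1)) y * U y $ l"
      using frechet_derivative_mult(1)[OF smooth_on_differentiable[OF \<theta> y] frechet_derivative_vec_nth(2)[OF smooth_on_differentiable[OF U y]]]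
        frechet_derivative_vec_nth(1)[OF smooth_on_differentiable[OF U y]] by simp
    finally have 1: "\<theta> y (axis j 1) * frechet_derivative U (at y) (axis i 1) $ l + pdiff i (\<lambda>z. \<theta> z (axis j 1)) y * U y $ l =
      V2 j i $ l + (c l j 1 * DV i $ 1 + dc i l j 1 * V y $ 1) + (c l j 2 * DV i $ 2 + dc i l j 2 * V y $ 2)"
      unfolding nab_second[OF y V] V2_def DV_def c_def dc_def by (simp add: sum_2)
    have 2: "\<theta> y (axis j 1) * (frechet_derivative U (at y) (axis i 1) $ l + (c l i 1 * U y $ 1 + c l i 2 * U y $ 2)) =
      - (\<theta> y (axis j 1) * \<theta> y (axis i 1) * V y $ l)"
      using arg_cong[OF nU[OF y, of "axis i 1"], of "\<lambda>v. \<theta> y (axis j 1) * v $ l"] by (simp add: nab_def Gam_axis c_def)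
    have 3: "\<theta> y (axis j 1) * U y $ k = DV j $ k + (c k j 1 * V y $ 1 + c k j 2 * V y $ 2)" for k
      using arg_cong[OF nV[OF y, of "axis j 1"], of "\<lambda>v. v $ k"] by (simp add: nab_def Gam_axis c_def DV_def)
    have "?L = (\<theta> y (axis j 1) * frechet_derivative U (at y) (axis i 1) $ l + pdiff i (\<lambda>z. \<theta> z (axis j 1)) y * U y $ l)
      + (c l i 1 * (\<theta> y (axis j 1) * U y $ 1) + c l i 2 * (\<theta> y (axis j 1) * U y $ 2))"
      using 2 by (simp add: algebra_simps)
    also have "\<dots> = ?R" unfolding 1 3 ..
    finally show ?thesis .
  qed
  have "riem y l 1 1 2 * V y $ 1 + riem y l 2 1 2 * V y $ 2 =
    (dc 1 l 2 1 - dc 2 l 1 1 + (c l 1 1 * c 1 2 1 - c l 2 1 * c 1 1 1) + (c l 1 2 * c 2 2 1 - c l 2 2 * c 2 1 1)) * V y $ 1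
    + (dc 1 l 2 2 - dc 2 l 1 2 + (c l 1 1 * c 1 2 2 - c l 2 1 * c 1 1 2) + (c l 1 2 * c 2 2 2 - c l 2 2 * c 2 1 2)) * V y $ 2"
    unfolding riem_def c_def dc_def by (simp add: sum_2 add.assoc)
  then show ?thesis using s[of 1 2] s[of 2 1] unfolding V2 by (simp add: algebra_simps)
qed

text \<open>\<open>dom\<close> is bilinear and alternating, so in the plane it only sees the
  determinant of its arguments.\<close>

lemma dom_linear:
  assumes y: "y \<in> W"
  shows "dom y u v = dom y (axis 1 1) (axis 2 1) * (u $ 1 * v $ 2 - u $ 2 * v $ 1)"
proof -
  have 1: "frechet_derivative (\<lambda>z. om z v) (at y) u =
    v $ 1 * (u $ 1 * pdiff 1 (\<lambda>z. om z (axis 1 1)) y + u $ 2 * pdiff 2 (\<lambda>z. om z (axis 1 1)) y)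
    + v $ 2 * (u $ 1 * pdiff 1 (\<lambda>z. om z (axis 2 1)) y + u $ 2 * pdiff 2 (\<lambda>z. om z (axis 2 1)) y)" for u v
  proof -
    note k = differentiable_const
    have "frechet_derivative (\<lambda>z. om z v) (at y) u =
      frechet_derivative (\<lambda>z. v $ 1 * om z (axis 1 1) + v $ 2 * om z (axis 2 1)) (at y) u"
      by (subst differentiable_cong_open(2)[OF W y, of _ "\<lambda>z. v $ 1 * om z (axis 1 1) + v $ 2 * om z (axis 2 1)"])
        (rule om_axis[unfolded real_scaleR_def], assumption, rule refl)
    also have "\<dots> = v $ 1 * frechet_derivative (\<lambda>z. om z (axis 1 1)) (at y) u + v $ 2 * frechet_derivative (\<lambda>z. om z (axis 2 1)) (at y) u"
      unfolding frechet_derivative_add(1)[OF frechet_derivative_mult(2)[OF k om_diff[OF y]] frechet_derivative_mult(2)[OF k om_diff[OF y]]]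
        frechet_derivative_mult(1)[OF k om_diff[OF y]] by simp
    also have r: "frechet_derivative (\<lambda>z. om z (axis 1 1)) (at y) u =
        u $ 1 * pdiff 1 (\<lambda>z. om z (axis 1 1)) y + u $ 2 * pdiff 2 (\<lambda>z. om z (axis 1 1)) y"
      using frechet_derivative_real2[OF om_diff[OF y, of "axis 1 1"], of u] unfolding real_scaleR_def .
    also have "frechet_derivative (\<lambda>z. om z (axis 2 1)) (at y) u =
        u $ 1 * pdiff 1 (\<lambda>z. om z (axis 2 1)) y + u $ 2 * pdiff 2 (\<lambda>z. om z (axis 2 1)) y"
      using frechet_derivative_real2[OF om_diff[OF y, of "axis 2 1"], of u] unfolding real_scaleR_def .
    finally show ?thesis .
  qed
  show ?thesis unfolding dom_def 1[where u = u and v = v] 1[where u = v and v = u] by (simp add: axis_def algebra_simps)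
qed

text \<open>With the inverse metric written in the frame, the contraction needs the curvature on
  \<open>e1\<close> and on \<open>e2\<close> only. Each of them contributes the same multiple of the
  determinant of the frame, hence the factor 2.\<close>

lemma scalar_curvature_frame:
  assumes y: "y \<in> W"
  shows "(\<Sum>j\<in>UNIV. \<Sum>k\<in>UNIV. matrix_inv (G y) $ j $ k * (\<Sum>i\<in>UNIV. riem y i k i j)) = - 2 * dom y (e1 y) (e2 y)"
proof -
  define d where "d = dom y (axis 1 1) (axis 2 1)"
  have 1: "riem y l 1 1 2 * e1 y $ 1 + riem y l 2 1 2 * e1 y $ 2 = d * e2 y $ l" for l
    unfolding d_def dom_def
    by (rule curvature_rotation[OF y e(1,2), of om]) (simp_all add: nab_frame om_smooth)
  have ms: "smooth_on W (\<lambda>z. - om z v)" for v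
    using smooth_on_mult[OF W smooth_on_const[of W "-1"] om_smooth] by simp
  have mp: "frechet_derivative (\<lambda>z. - om z v) (at y) w = - frechet_derivative (\<lambda>z. om z v) (at y) w" for v w
    using frechet_derivative_mult(1)[OF differentiable_const[of "-1"] om_diff[OF y], of v w] by simp
  have "riem y l 1 1 2 * e2 y $ 1 + riem y l 2 1 2 * e2 y $ 2 =
    (pdiff 1 (\<lambda>z. - om z (axis 2 1)) y - pdiff 2 (\<lambda>z. - om z (axis 1 1)) y) * e1 y $ l" for l
    by (rule curvature_rotation[OF y e(2,1), of "\<lambda>z v. - om z v"]) (simp_all add: nab_frame ms)
  then have 2: "riem y l 1 1 2 * e2 y $ 1 + riem y l 2 1 2 * e2 y $ 2 = - d * e1 y $ l" for l
    unfolding mp d_def dom_def by simp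
  have a: "riem y l k 2 1 = - riem y l k 1 2" "riem y l k i i = 0" for l k i
    by (simp_all add: riem_def sum_2 algebra_simps)
  have "(\<Sum>j\<in>UNIV. \<Sum>k\<in>UNIV. matrix_inv (G y) $ j $ k * (\<Sum>i\<in>UNIV. riem y i k i j)) =
    e1 y $ 2 * (riem y 1 1 1 2 * e1 y $ 1 + riem y 1 2 1 2 * e1 y $ 2) - e1 y $ 1 * (riem y 2 1 1 2 * e1 y $ 1 + riem y 2 2 1 2 * e1 y $ 2)
    + e2 y $ 2 * (riem y 1 1 1 2 * e2 y $ 1 + riem y 1 2 1 2 * e2 y $ 2) - e2 y $ 1 * (riem y 2 1 1 2 * e2 y $ 1 + riem y 2 2 1 2 * e2 y $ 2)"
    unfolding frame_inverse(3)[OF y] by (simp add: sum_2 a algebra_simps)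
  also have "\<dots> = - 2 * (d * (e1 y $ 1 * e2 y $ 2 - e1 y $ 2 * e2 y $ 1))"
    unfolding 1 2 by (simp add: algebra_simps)
  finally show ?thesis unfolding dom_linear[OF y, of "e1 y" "e2 y"] d_def .
qed

end

section \<open>Horizontal lifts\<close>

text \<open>The connection form is determined by the bracket of the frame fields, which is natural under
  changes of charts. This replaces the transformation law of the Christoffel symbols.\<close>

lemma om_invariant:
  assumes fr: "frame2 W G e1 e2" and fr': "frame2 W' G' f1 f2"
    and V: "open V" "V \<subseteq> W" "y \<in> V" and \<phi>: "smooth_on V \<phi>" "\<phi> ` V \<subseteq> W'"
    and f: "\<And>z. z \<in> V \<Longrightarrow> f1 (\<phi> z) = frechet_derivative \<phi> (at z) (e1 z)"
      "\<And>z. z \<in> V \<Longrightarrow> f2 (\<phi> z) = frechet_derivative \<phi> (at z) (e2 z)"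
  shows "frame2.om G' f1 f2 (\<phi> y) (frechet_derivative \<phi> (at y) w) = frame2.om G e1 e2 y w"
proof -
  interpret E: frame2 W G e1 e2 by (rule fr)
  interpret F: frame2 W' G' f1 f2 by (rule fr')
  have yW: "y \<in> W" and yW': "\<phi> y \<in> W'" using V \<phi> by auto
  let ?L = "frechet_derivative \<phi> (at y)"
  have d\<phi>: "\<phi> differentiable (at z)" if "z \<in> V" for z using smooth_on_differentiable[OF \<phi>(1) that] .
  have L: "linear ?L" using linear_frechet_derivative[OF d\<phi>[OF V(3)]] .
  have D: "frechet_derivative f (at (\<phi> y)) (?L v) =
      frechet_derivative (\<lambda>z. frechet_derivative \<phi> (at z) (e y)) (at y) v + ?L (frechet_derivative e (at y) v)"
    if f: "f differentiable (at (\<phi> y))" and e: "e differentiable (at y)"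
      and fe: "\<And>z. z \<in> V \<Longrightarrow> f (\<phi> z) = frechet_derivative \<phi> (at z) (e z)" for f e v
  proof -
    have "frechet_derivative f (at (\<phi> y)) (?L v) = frechet_derivative (\<lambda>z. f (\<phi> z)) (at y) v"
      using frechet_derivative_comp(2)[OF d\<phi>[OF V(3)] f] by simp
    also have "\<dots> = frechet_derivative (\<lambda>z. frechet_derivative \<phi> (at z) (e z)) (at y) v"
      by (subst differentiable_cong_open(2)[OF V(1,3), of _ "\<lambda>z. frechet_derivative \<phi> (at z) (e z)"])
        (rule fe, assumption, rule refl)
    also have "\<dots> = frechet_derivative (\<lambda>z. frechet_derivative \<phi> (at z) (e y)) (at y) v + ?L (frechet_derivative e (at y) v)"
      by (rule frechet_derivative_linear_form(1)[OF V(1,3) linear_frechet_derivative[OF d\<phi>] smooth_on_differentiable[OF smooth_on_frechet_derivative[OF \<phi>(1)] V(3)] e])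
    finally show ?thesis .
  qed
  have D1: "frechet_derivative f1 (at (\<phi> y)) (?L v) =
      frechet_derivative (\<lambda>z. frechet_derivative \<phi> (at z) (e1 y)) (at y) v + ?L (frechet_derivative e1 (at y) v)" for v
    by (rule D[OF F.e_diff(1)[OF yW'] E.e_diff(1)[OF yW]]) (rule f(1))
  have D2: "frechet_derivative f2 (at (\<phi> y)) (?L v) =
      frechet_derivative (\<lambda>z. frechet_derivative \<phi> (at z) (e2 y)) (at y) v + ?L (frechet_derivative e2 (at y) v)" for v
    by (rule D[OF F.e_diff(2)[OF yW'] E.e_diff(2)[OF yW]]) (rule f(2))
  \<comment> \<open>Push-forward respects the bracket: the second derivatives of
    \<open>\<phi>\<close> occur once in each order and cancel by symmetry.\<close>
  have "frechet_derivative f2 (at (\<phi> y)) (f1 (\<phi> y)) - frechet_derivative f1 (at (\<phi> y)) (f2 (\<phi> y)) =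
    ?L (frechet_derivative e2 (at y) (e1 y)) - ?L (frechet_derivative e1 (at y) (e2 y))"
    unfolding f(1)[OF V(3)] f(2)[OF V(3)] D1 D2
    using frechet_derivative_symmetric[OF V(1,3) \<phi>(1), of "e1 y" "e2 y"] by simp
  also have "\<dots> = ?L (- E.om y (e1 y) *\<^sub>R e1 y - E.om y (e2 y) *\<^sub>R e2 y)"
    unfolding E.frame_bracket[OF yW, symmetric] linear_diff[OF L] ..
  also have "\<dots> = - E.om y (e1 y) *\<^sub>R f1 (\<phi> y) - E.om y (e2 y) *\<^sub>R f2 (\<phi> y)"
    unfolding f(1)[OF V(3)] f(2)[OF V(3)] linear_diff[OF L] linear_scale[OF L] ..
  finally have eq: "- F.om (\<phi> y) (f1 (\<phi> y)) *\<^sub>R f1 (\<phi> y) - F.om (\<phi> y) (f2 (\<phi> y)) *\<^sub>R f2 (\<phi> y) =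
    - E.om y (e1 y) *\<^sub>R f1 (\<phi> y) - E.om y (e2 y) *\<^sub>R f2 (\<phi> y)"
    unfolding F.frame_bracket[OF yW'] .
  have g: "F.gm (\<phi> y) (- a *\<^sub>R f1 (\<phi> y) - b *\<^sub>R f2 (\<phi> y)) (f1 (\<phi> y)) = - a"
    "F.gm (\<phi> y) (- a *\<^sub>R f1 (\<phi> y) - b *\<^sub>R f2 (\<phi> y)) (f2 (\<phi> y)) = - b" for a b
  proof -
    have x: "- a *\<^sub>R f1 (\<phi> y) - b *\<^sub>R f2 (\<phi> y) = (- a) *\<^sub>R f1 (\<phi> y) + (- b) *\<^sub>R f2 (\<phi> y)" by simp
    show "F.gm (\<phi> y) (- a *\<^sub>R f1 (\<phi> y) - b *\<^sub>R f2 (\<phi> y)) (f1 (\<phi> y)) = - a"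
      "F.gm (\<phi> y) (- a *\<^sub>R f1 (\<phi> y) - b *\<^sub>R f2 (\<phi> y)) (f2 (\<phi> y)) = - b"
      unfolding x F.gm_add F.gm_on[OF yW'] by simp_all
  qed
  have om: "F.om (\<phi> y) (f1 (\<phi> y)) = E.om y (e1 y)" "F.om (\<phi> y) (f2 (\<phi> y)) = E.om y (e2 y)"
    using arg_cong[OF eq, of "\<lambda>v. F.gm (\<phi> y) v (f1 (\<phi> y))"] arg_cong[OF eq, of "\<lambda>v. F.gm (\<phi> y) v (f2 (\<phi> y))"]
    unfolding g by simp_all
  define p q where "p = E.gm y w (e1 y)" and "q = E.gm y w (e2 y)"
  have w: "w = p *\<^sub>R e1 y + q *\<^sub>R e2 y" unfolding p_def q_def by (rule E.frame_expand[OF yW])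
  have "?L w = p *\<^sub>R f1 (\<phi> y) + q *\<^sub>R f2 (\<phi> y)"
    unfolding w linear_add[OF L] linear_scale[OF L] f(1)[OF V(3)] f(2)[OF V(3)] ..
  then show ?thesis
    using F.om_linear[OF yW', of p "f1 (\<phi> y)" q "f2 (\<phi> y)"] E.om_linear[OF yW, of p "e1 y" q "e2 y"]
    unfolding om w[symmetric] by simp
qed

section \<open>Coordinate frames from sections of the Spin-c bundle\<close>

context spinc
begin

lemma metric_coordinates:
  assumes d: "d \<in> M_atlas S" and y: "y \<in> snd d ` fst d"
    and u: "u \<in> tangent_space (M_atlas S) (chart_inv d y)" and v: "v \<in> tangent_space (M_atlas S) (chart_inv d y)"
  shows "metric S (chart_inv d y) u v = u d \<bullet> (metric_matrix (M_atlas S) (metric S) d y *v v d)"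
proof -
  note MA = atlases(1)
  let ?x = "chart_inv d y"
  define E where "E i = coord_vec (M_atlas S) d ?x (axis i 1)" for i
  have dx: "d \<in> charts_at (M_atlas S) ?x" using d chart_inv_in(1)[OF y] by (simp add: charts_at_def)
  note dp = dif_par_chart_inv(1)[OF MA d y]
  have Ev: "E i = vel (M_atlas S) (chart_inv d) y (axis i 1)" for i
    unfolding E_def by (rule dif_par_chart_inv(4)[OF MA d y])
  have Et: "E i \<in> tangent_space (M_atlas S) ?x" for i unfolding Ev by (rule vel_in_tangent_space[OF MA dp])
  have ex: "a = (\<lambda>c. a d $ 1 *\<^sub>R E 1 c + a d $ 2 *\<^sub>R E 2 c)" if a: "a \<in> tangent_space (M_atlas S) ?x" for a
  proof -
    have "a = vel (M_atlas S) (chart_inv d) y (a d)"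
      using tangent_vector_eq_vel[OF MA a dx] unfolding chart_inv_in(2)[OF y] .
    also have "a d = a d $ 1 *\<^sub>R axis 1 1 + a d $ 2 *\<^sub>R axis 2 1" by (rule axis_sum2[symmetric])
    finally show ?thesis unfolding vel_linear[OF MA dp] Ev .
  qed
  have m: "metric S ?x (E i) (E j) = metric_matrix (M_atlas S) (metric S) d y $ i $ j" for i j
    by (simp add: metric_matrix_def E_def)
  have "metric S ?x u v = u d $ 1 * metric S ?x (E 1) v + u d $ 2 * metric S ?x (E 2) v"
    using metric_linear[OF Et[of 1] Et[of 2] v, of "u d $ 1" "u d $ 2"] unfolding ex[OF u, symmetric] .
  moreover have "metric S ?x (E i) v = v d $ 1 * metric S ?x (E i) (E 1) + v d $ 2 * metric S ?x (E i) (E 2)" for i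
  proof -
    have "metric S ?x (E i) v = metric S ?x v (E i)" by (rule metric_sym[OF Et v])
    also have "\<dots> = v d $ 1 * metric S ?x (E 1) (E i) + v d $ 2 * metric S ?x (E 2) (E i)"
      using metric_linear[OF Et[of 1] Et[of 2] Et[of i], of "v d $ 1" "v d $ 2"] unfolding ex[OF v, symmetric] .
    finally show ?thesis using metric_sym[OF Et[of i] Et] by simp
  qed
  ultimately show ?thesis
    unfolding m by (simp add: inner_vec_def sum_2 matrix2_vector_nth algebra_simps)
qed

lemma metric_matrix_smooth:
  "d \<in> M_atlas S \<Longrightarrow> smooth_on (snd d ` fst d) (metric_matrix (M_atlas S) (metric S) d)"
  using riemannian unfolding riemannian_metric_def by blast

lemma theta_frame_smooth:
  "d \<in> M_atlas S \<Longrightarrow> smooth_fun (P_atlas S) (P_proj S -` fst d) (\<lambda>p. theta_frame S p i d)"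
  using double_covering unfolding double_covering_def by blast

lemma theta_circle_smooth: "smooth_map (P_atlas S) (Q_atlas S) (theta_circle S)"
  and Q_proj_theta: "Q_proj S (theta_circle S p) = P_proj S p"
  using double_covering unfolding double_covering_def by blast+

text \<open>Stated for an arbitrary chart \<open>d\<close>, because the frame of one and the same
  section has to be read in every chart around a point, not only in the chart of the
  parametrization.\<close>

lemma frame2_section:
  assumes d: "d \<in> M_atlas S" and V: "open V" "V \<subseteq> snd d ` fst d"
    and s: "smooth_into (P_atlas S) V s" "\<And>y. y \<in> V \<Longrightarrow> P_proj S (s y) = chart_inv d y"
  shows "frame2 V (metric_matrix (M_atlas S) (metric S) d) (\<lambda>y. theta_frame S (s y) 1 d) (\<lambda>y. theta_frame S (s y) 2 d)"
proof
  note MA = atlases(1) and PA = atlases(2)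
  show "open V" by (rule V(1))
  show "smooth_on V (metric_matrix (M_atlas S) (metric S) d)"
    by (rule smooth_on_subset[OF metric_matrix_smooth[OF d] V(2)])
  have sV: "s ` V \<subseteq> P_proj S -` fst d"
    using s(2) V(2) by (auto intro!: inv_into_into)
  have "smooth_on V (\<lambda>y. theta_frame S (s y) i d)" for i
    by (rule smooth_fun_comp_into[OF PA open_vimage_smooth_map[OF PA MA P_proj_smooth smooth_atlasD(2)[OF MA d]] theta_frame_smooth[OF d] V(1) s(1) sV])
  then show "smooth_on V (\<lambda>y. theta_frame S (s y) 1 d)" "smooth_on V (\<lambda>y. theta_frame S (s y) 2 d)" by blast+
  fix y assume y: "y \<in> V"
  have yd: "y \<in> snd d ` fst d" using y V(2) by blast
  have t: "theta_frame S (s y) i \<in> tangent_space (M_atlas S) (chart_inv d y)" for i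
    using theta_frame_tangent[of "s y"] unfolding s(2)[OF y] .
  have "theta_frame S (s y) i d \<bullet> (metric_matrix (M_atlas S) (metric S) d y *v theta_frame S (s y) j d) = (if i = j then 1 else 0)" for i j
    using theta_frame_orthonormal[of "s y" i j] unfolding s(2)[OF y] metric_coordinates[OF d yd t t] .
  note o = this
  show "theta_frame S (s y) 1 d \<bullet> (metric_matrix (M_atlas S) (metric S) d y *v theta_frame S (s y) 1 d) = 1"
    "theta_frame S (s y) 1 d \<bullet> (metric_matrix (M_atlas S) (metric S) d y *v theta_frame S (s y) 2 d) = 0"
    "theta_frame S (s y) 2 d \<bullet> (metric_matrix (M_atlas S) (metric S) d y *v theta_frame S (s y) 2 d) = 1"
    using o[of 1 1] o[of 1 2] o[of 2 2] by simp_all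
  fix i j :: 2
  have "coord_vec (M_atlas S) d (chart_inv d y) w \<in> tangent_space (M_atlas S) (chart_inv d y)" for w
    unfolding dif_par_chart_inv(4)[OF MA d yd] by (rule vel_in_tangent_space[OF MA dif_par_chart_inv(1)[OF MA d yd]])
  from metric_sym[OF this this]
  show "metric_matrix (M_atlas S) (metric S) d y $ i $ j = metric_matrix (M_atlas S) (metric S) d y $ j $ i"
    by (simp add: metric_matrix_def)
qed

end

context spinc_local
begin

abbreviation "AM \<equiv> M_atlas S"
abbreviation "AP \<equiv> P_atlas S"
abbreviation "AQ \<equiv> Q_atlas S"

definition sec :: "real ^ 2 \<Rightarrow> 'p" where
  "sec y = Psi (y, 0, 0)"

lemma chart_W: "y \<in> W \<Longrightarrow> y \<in> snd c ` fst c" "y \<in> W \<Longrightarrow> chart_inv c y \<in> fst c"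
  "y \<in> W \<Longrightarrow> snd c (chart_inv c y) = y" "y \<in> W \<Longrightarrow> c \<in> charts_at AM (chart_inv c y)"
  using W(2) chart_inv_in[of y c] c by (auto simp: charts_at_def)

lemma sec_proj: "y \<in> W \<Longrightarrow> P_proj S (sec y) = chart_inv c y"
  unfolding sec_def by (rule Psi_proj)

lemma Psi_sec: "y \<in> W \<Longrightarrow> Psi (y, u, t) = P_act S (sec y) (tor u t)"
  unfolding sec_def by (rule Psi_act)

lemma open_WU: "open (W \<times> (UNIV :: (real \<times> real) set))"
  using W by (simp add: open_Times)

lemma Psi_slice_smooth: "smooth_into AP W (\<lambda>y. Psi (y, u, t))"
  by (rule smooth_into_compose[OF W(1) Psi_smooth smooth_on_Pair_const[OF W(1)]]) auto

lemma sec_smooth: "smooth_into AP W sec"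
  using Psi_slice_smooth[of 0 0] unfolding sec_def .

lemma Psi_dif: "y \<in> W \<Longrightarrow> dif_par AP Psi (y, u, t)"
  by (rule smooth_into_dif_par[OF atlases(2) open_WU Psi_smooth]) simp

abbreviation "fr1 \<equiv> \<lambda>y. theta_frame S (sec y) 1 c"
abbreviation "fr2 \<equiv> \<lambda>y. theta_frame S (sec y) 2 c"

end

sublocale spinc_local \<subseteq> frame2 W "metric_matrix (M_atlas S) (metric S) c" "\<lambda>y. theta_frame S (sec y) 1 c" "\<lambda>y. theta_frame S (sec y) 2 c"
  using frame2_section[OF c W(1,2) sec_smooth sec_proj] by simp

lemma tangent_vector_chart:
  assumes "v \<in> tangent_space A x" "c \<in> charts_at A x" "d \<in> charts_at A x"
  shows "v d = frechet_derivative (\<lambda>z. snd d (chart_inv c z)) (at (snd c x)) (v c)"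
  using assms unfolding tangent_space_def o_def by blast

lemma smooth_fun_chart:
  assumes A: "smooth_atlas A" and d: "d \<in> A"
  shows "smooth_fun A (fst d) (snd d)"
  unfolding smooth_fun_def o_def using smooth_atlasD(7)[OF A _ d] by blast

lemma eventually_nhds_open_vimage:
  assumes "open V" "y \<in> V" "\<And>z. z \<in> V \<Longrightarrow> P z"
  shows "\<forall>\<^sub>F z in nhds y. P z"
  using assms unfolding eventually_nhds by blast

section \<open>Action and connection on the circle bundle\<close>

context spinc
begin

lemma Q_proj_smooth: "smooth_map (Q_atlas S) (M_atlas S) (Q_proj S)"
  using Q_principal unfolding principal_bundle_def by blast

lemma Q_act_act: "cmod z = 1 \<Longrightarrow> cmod z' = 1 \<Longrightarrow> Q_act S (Q_act S q z) z' = Q_act S q (z * z')"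
  using Q_principal unfolding principal_bundle_def by blast

text \<open>In a local trivialization the action of \<open>z\<close> is multiplication of the circle
  coordinate by \<open>z\<close>. Differentiability thus comes from the smoothness of the
  trivialization and of its inverse.\<close>

lemma Q_act_dif_map:
  assumes z: "cmod z = 1"
  shows "dif_map (Q_atlas S) (Q_atlas S) (\<lambda>q. Q_act S q z) q"
proof -
  note MA = atlases(1) and QA = atlases(3)
  have "\<exists>U \<tau>. Q_proj S q \<in> U \<and> open U \<and>
        bij_betw (\<lambda>p. (Q_proj S p, \<tau> p)) (Q_proj S -` U) (U \<times> unit_circle) \<and>
        (\<forall>p\<in>Q_proj S -` U. \<forall>g\<in>unit_circle. \<tau> (Q_act S p g) = \<tau> p * g) \<and>
        smooth_fun (Q_atlas S) (Q_proj S -` U) \<tau> \<and>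
        (\<forall>c\<in>M_atlas S. smooth_into (Q_atlas S) ((snd c ` (fst c \<inter> U)) \<times> unit_circle)
           (\<lambda>(y, g). inv_into (Q_proj S -` U) (\<lambda>p. (Q_proj S p, \<tau> p)) (chart_inv c y, g)))"
    using Q_principal unfolding principal_bundle_def by blast
  then obtain U \<tau> where U: "Q_proj S q \<in> U" "open U"
        "bij_betw (\<lambda>p. (Q_proj S p, \<tau> p)) (Q_proj S -` U) (U \<times> unit_circle)"
        "\<forall>p\<in>Q_proj S -` U. \<forall>g\<in>unit_circle. \<tau> (Q_act S p g) = \<tau> p * g"
        "smooth_fun (Q_atlas S) (Q_proj S -` U) \<tau>"
        "\<forall>c\<in>M_atlas S. smooth_into (Q_atlas S) ((snd c ` (fst c \<inter> U)) \<times> unit_circle)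
           (\<lambda>(y, g). inv_into (Q_proj S -` U) (\<lambda>p. (Q_proj S p, \<tau> p)) (chart_inv c y, g))" by (elim exE conjE)
  define c where "c = chart_at (M_atlas S) (Q_proj S q)"
  have c: "c \<in> M_atlas S" "Q_proj S q \<in> fst c"
    using chart_at_in[OF MA, of "Q_proj S q"] by (simp_all add: c_def charts_at_def)
  define d where "d = chart_at (Q_atlas S) q"
  have dq: "d \<in> charts_at (Q_atlas S) q" unfolding d_def by (rule chart_at_in[OF QA])
  then have d: "d \<in> Q_atlas S" "q \<in> fst d" by (simp_all add: charts_at_def)
  let ?F = "\<lambda>p. (Q_proj S p, \<tau> p)" and ?k = "chart_inv d"
  define K where "K = inv_into (Q_proj S -` U) ?F"
  define V where "V = snd d ` fst d \<inter> ?k -` (Q_proj S -` (U \<inter> fst c))"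
  have oUc: "open (Q_proj S -` (U \<inter> fst c))" "open (Q_proj S -` U)"
    by (rule open_vimage_smooth_map[OF QA MA Q_proj_smooth], use U(2) smooth_atlasD(2)[OF MA c(1)] in blast)+
  have oV: "open V" unfolding V_def
    by (rule continuous_open_preimage[OF smooth_atlasD(6)[OF QA d(1)] smooth_atlasD(3)[OF QA d(1)] oUc(1)])
  have qV: "snd d q \<in> V" using d c(2) U(1) chart_inv_snd[OF QA d] by (simp add: V_def)
  have sk: "smooth_into (Q_atlas S) V ?k"
    by (rule smooth_into_subset[OF smooth_into_chart_inv[OF QA d(1)]]) (simp add: V_def)
  have sm1: "smooth_on V (\<lambda>\<zeta>. snd c (Q_proj S (?k \<zeta>)))"
    by (rule smooth_fun_comp_into[OF MA smooth_atlasD(2)[OF MA c(1)] smooth_fun_chart[OF MA c(1)] oV smooth_map_comp_into[OF QA MA Q_proj_smooth oV sk]])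
      (auto simp: V_def)
  have sm2: "smooth_on V (\<lambda>\<zeta>. \<tau> (?k \<zeta>))"
    by (rule smooth_fun_comp_into[OF QA oUc(2) U(5) oV sk]) (auto simp: V_def)
  define m where "m \<zeta> = (snd c (Q_proj S (?k \<zeta>)), \<tau> (?k \<zeta>) * z)" for \<zeta>
  have \<tau>1: "cmod (\<tau> p) = 1" if "Q_proj S p \<in> U" for p
    using bspec[OF bij_betwE[OF U(3)], of p] that by simp
  have mV: "m ` V \<subseteq> (snd c ` (fst c \<inter> U)) \<times> unit_circle"
    using \<tau>1 z by (auto simp: V_def m_def norm_mult)
  have sm: "smooth_on V m"
  proof -
    have "smooth_on V (\<lambda>\<zeta>. (snd c (Q_proj S (?k \<zeta>)), 0) + (0, \<tau> (?k \<zeta>) * z))"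
      by (intro smooth_on_add[OF oV] smooth_on_linear_compose[OF oV _ sm1] smooth_on_linear_compose[OF oV _ sm2]
          bounded_linear_Pair bounded_linear_ident bounded_linear_zero bounded_linear_mult_left)
    then show ?thesis unfolding m_def by simp
  qed
  have "smooth_into (Q_atlas S) V (\<lambda>\<zeta>. (\<lambda>(y, g). K (chart_inv c y, g)) (m \<zeta>))"
    by (rule smooth_into_compose[OF oV _ sm mV]) (use U(6) c(1) in \<open>simp add: K_def\<close>)
  from smooth_into_dif_par[OF QA oV this qV]
  have dp: "dif_par (Q_atlas S) (\<lambda>\<zeta>. (\<lambda>(y, g). K (chart_inv c y, g)) (m \<zeta>)) (snd d q)" .
  have e: "(\<lambda>(y, g). K (chart_inv c y, g)) (m \<zeta>) = Q_act S (?k \<zeta>) z" if "\<zeta> \<in> V" for \<zeta>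
  proof -
    have p: "Q_proj S (?k \<zeta>) \<in> U" "Q_proj S (?k \<zeta>) \<in> fst c" using that by (simp_all add: V_def)
    have a: "Q_proj S (Q_act S (?k \<zeta>) z) = Q_proj S (?k \<zeta>)"
      using Q_principal z unfolding principal_bundle_def by blast
    have "\<tau> (Q_act S (?k \<zeta>) z) = \<tau> (?k \<zeta>) * z"
      using bspec[OF bspec[OF U(4), of "?k \<zeta>"], of z] p(1) z by simp
    then have "?F (Q_act S (?k \<zeta>) z) = (chart_inv c (snd c (Q_proj S (?k \<zeta>))), \<tau> (?k \<zeta>) * z)"
      using a chart_inv_snd[OF MA c(1) p(2)] by simp
    then have "(\<lambda>(y, g). K (chart_inv c y, g)) (m \<zeta>) = K (?F (Q_act S (?k \<zeta>) z))" by (simp add: m_def)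
    also have "\<dots> = Q_act S (?k \<zeta>) z" unfolding K_def
      by (rule inv_into_f_f[OF bij_betw_imp_inj_on[OF U(3)]]) (use a p(1) in simp)
    finally show ?thesis .
  qed
  have "dif_par (Q_atlas S) (\<lambda>\<zeta>. Q_act S (?k \<zeta>) z) (snd d q)"
    using dp dif_par_cong(1)[OF eventually_nhds_open_vimage[OF oV qV e], where A = "Q_atlas S"] by simp
  then show ?thesis unfolding dif_map_def using dq by blast
qed

lemma connectionD:
  assumes "u \<in> tangent_space (Q_atlas S) q" "v \<in> tangent_space (Q_atlas S) q"
  shows "conn S q (\<lambda>c. a *\<^sub>R u c + b *\<^sub>R v c) = a *\<^sub>R conn S q u + b *\<^sub>R conn S q v"
    and "Re (conn S q v) = 0"
    and "cmod z = 1 \<Longrightarrow> conn S (Q_act S q z) (push (Q_atlas S) (Q_atlas S) (\<lambda>q'. Q_act S q' z) q v) = conn S q v"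
    and "conn S q (\<lambda>c. if c \<in> charts_at (Q_atlas S) q
                   then vector_derivative (\<lambda>t. snd c (Q_act S q (cis t))) (at 0) else 0) = \<i>"
  using connection assms unfolding connection_form_def mem_Collect_eq by blast+

end

context spinc_local
begin

text \<open>A horizontal lift requires a vanishing covariant derivative in every chart
  \<open>d\<close> around the point, whereas \<open>om\<close> is computed in \<open>c\<close>. The
  frame of the section is therefore read in \<open>d\<close>, near \<open>y\<close> where both
  charts are defined, and \<open>om_invariant\<close> identifies the two connection forms.\<close>

lemma transition_frame:
  assumes y: "y \<in> W" and d: "d \<in> charts_at AM (chart_inv c y)"
  shows "\<exists>W' f1 f2 V. frame2 W' (metric_matrix AM (metric S) d) f1 f2 \<and>
    open V \<and> y \<in> V \<and> V \<subseteq> W \<and> smooth_on V (\<lambda>z. snd d (chart_inv c z)) \<and> (\<lambda>z. snd d (chart_inv c z)) ` V \<subseteq> W' \<and>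
    (\<forall>z\<in>V. f1 (snd d (chart_inv c z)) = theta_frame S (sec z) 1 d) \<and>
    (\<forall>z\<in>V. f2 (snd d (chart_inv c z)) = theta_frame S (sec z) 2 d) \<and>
    (\<forall>w. frame2.om (metric_matrix AM (metric S) d) f1 f2 (snd d (chart_inv c y))
       (frechet_derivative (\<lambda>z. snd d (chart_inv c z)) (at y) w) = om y w)"
proof -
  note MA = atlases(1)
  have dA: "d \<in> AM" "chart_inv c y \<in> fst d" using d by (simp_all add: charts_at_def)
  define V where "V = W \<inter> snd c ` (fst c \<inter> fst d)"
  have oV: "open V" unfolding V_def using W(1) open_chart_image[OF MA c smooth_atlasD(2)[OF MA dA(1)]] by blast
  have Vd: "chart_inv c z \<in> fst d" "z \<in> W" if "z \<in> V" for z
    using that unfolding V_def chart_image_Int[OF MA c] by auto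
  have yV: "y \<in> V" using y dA(2) chart_W(1)[OF y] unfolding V_def chart_image_Int[OF MA c] by simp
  let ?\<phi> = "\<lambda>z. snd d (chart_inv c z)" and ?\<psi> = "\<lambda>z. snd c (chart_inv d z)"
  have s\<phi>: "smooth_on V ?\<phi>"
    by (rule smooth_on_subset[OF smooth_atlasD(7)[OF MA c dA(1)]]) (simp add: V_def)
  let ?T = "snd d ` (fst d \<inter> fst c)"
  have oT: "open ?T" using open_chart_image[OF MA dA(1) smooth_atlasD(2)[OF MA c]] .
  have s\<psi>: "smooth_on ?T ?\<psi>" by (rule smooth_atlasD(7)[OF MA dA(1) c])
  define W' where "W' = ?T \<inter> ?\<psi> -` W"
  have oW': "open W'" unfolding W'_def
    by (rule continuous_open_preimage[OF smooth_on_continuous_on[OF s\<psi>] oT W(1)])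
  have W'T: "chart_inv d z \<in> fst c" "z \<in> snd d ` fst d" "?\<psi> z \<in> W" if "z \<in> W'" for z
    using that unfolding W'_def chart_image_Int[OF MA dA(1)] by auto
  have sW: "smooth_into AP W' (\<lambda>z. sec (?\<psi> z))"
    by (rule smooth_into_compose[OF oW' sec_smooth smooth_on_subset[OF s\<psi>]]) (auto simp: W'_def)
  have pW: "P_proj S (sec (?\<psi> z)) = chart_inv d z" if "z \<in> W'" for z
    unfolding sec_proj[OF W'T(3)[OF that]] by (rule chart_inv_snd[OF MA c W'T(1)[OF that]])
  have sub: "W' \<subseteq> snd d ` fst d" using W'T(2) by blast
  define f where "f i z = theta_frame S (sec (?\<psi> z)) i d" for i z
  have fr: "frame2 W' (metric_matrix AM (metric S) d) (f 1) (f 2)"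
    unfolding f_def by (rule frame2_section[OF dA(1) oW' sub sW pW])
  have bk: "chart_inv d (?\<phi> z) = chart_inv c z" "?\<psi> (?\<phi> z) = z" if "z \<in> V" for z
    using chart_inv_snd[OF MA dA(1) Vd(1)[OF that]] chart_W(3)[OF Vd(2)[OF that]] by simp_all
  have \<phi>V: "?\<phi> ` V \<subseteq> W'"
  proof (rule image_subsetI)
    fix z assume z: "z \<in> V"
    have "?\<phi> z \<in> ?T" using Vd[OF z] chart_W(2) by blast
    then show "?\<phi> z \<in> W'" unfolding W'_def using bk(2)[OF z] Vd(2)[OF z] by simp
  qed
  have ff: "f i (?\<phi> z) = theta_frame S (sec z) i d" if "z \<in> V" for z i
    unfolding f_def bk(2)[OF that] ..
  have fD: "f i (?\<phi> z) = frechet_derivative ?\<phi> (at z) (theta_frame S (sec z) i c)" if z: "z \<in> V" for z i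
  proof -
    have "d \<in> charts_at AM (chart_inv c z)" using dA(1) Vd(1)[OF z] by (simp add: charts_at_def)
    from tangent_vector_chart[OF theta_frame_tangent[of "sec z" i, unfolded sec_proj[OF Vd(2)[OF z]]] chart_W(4)[OF Vd(2)[OF z]] this]
    show ?thesis unfolding ff[OF z] chart_W(3)[OF Vd(2)[OF z]] .
  qed
  have VW: "V \<subseteq> W" by (simp add: V_def)
  have om': "frame2.om (metric_matrix AM (metric S) d) (f 1) (f 2) (?\<phi> y) (frechet_derivative ?\<phi> (at y) w) = om y w" for w
    by (rule om_invariant[OF frame2_axioms fr oV VW yV s\<phi> \<phi>V fD fD])
  show ?thesis
    by (intro exI[of _ W'] exI[of _ "f 1"] exI[of _ "f 2"] exI[of _ V] conjI ballI allI fr oV yV VW s\<phi> \<phi>V ff om')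
qed

end

lemma (in frame2) Gam_right_linear: "Gam y u (a *\<^sub>R v + b *\<^sub>R v') = a *\<^sub>R Gam y u v + b *\<^sub>R Gam y u v'"
  by (simp add: vec2_eq_iff Gam_def sum_2 algebra_simps)

lemma frechet_derivative_rotation:
  fixes h1 h2 :: "real ^ 2 \<Rightarrow> real ^ 2"
  assumes h: "h1 differentiable (at y)" "h2 differentiable (at y)"
  shows "frechet_derivative (\<lambda>z :: (real ^ 2) \<times> real \<times> real. cos (fst (snd z) - snd (snd z)) *\<^sub>R h1 (fst z) + sin (fst (snd z) - snd (snd z)) *\<^sub>R h2 (fst z))
      (at (y, u, t)) (w, r, s) =
    cos (u - t) *\<^sub>R frechet_derivative h1 (at y) w + sin (u - t) *\<^sub>R frechet_derivative h2 (at y) w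
      + (r - s) *\<^sub>R (- sin (u - t) *\<^sub>R h1 y + cos (u - t) *\<^sub>R h2 y)"
proof -
  let ?z = "(y, u, t)"
  have f: "((\<lambda>z :: (real ^ 2) \<times> real \<times> real. h (fst z)) has_derivative (\<lambda>v. frechet_derivative h (at y) (fst v))) (at ?z)"
    if "h differentiable (at y)" for h :: "real ^ 2 \<Rightarrow> real ^ 2"
  proof -
    have "(h has_derivative frechet_derivative h (at y)) (at (fst ?z))" using differentiable_has_derivative[OF that] by simp
    from has_derivative_compose[OF has_derivative_fst[OF has_derivative_ident] this] show ?thesis by simp
  qed
  have d: "((\<lambda>z :: (real ^ 2) \<times> real \<times> real. fst (snd z) - snd (snd z)) has_derivative (\<lambda>v. fst (snd v) - snd (snd v))) (at ?z)"
    by (auto intro!: derivative_eq_intros)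
  have c: "((\<lambda>z :: (real ^ 2) \<times> real \<times> real. cos (fst (snd z) - snd (snd z))) has_derivative (\<lambda>v. - sin (u - t) * (fst (snd v) - snd (snd v)))) (at ?z)"
    by (rule has_derivative_eq_rhs[OF has_derivative_cos[OF d]]) auto
  have s: "((\<lambda>z :: (real ^ 2) \<times> real \<times> real. sin (fst (snd z) - snd (snd z))) has_derivative (\<lambda>v. cos (u - t) * (fst (snd v) - snd (snd v)))) (at ?z)"
    by (rule has_derivative_eq_rhs[OF has_derivative_sin[OF d]]) auto
  show ?thesis
    using frechet_derivative_eqI[OF has_derivative_add[OF has_derivative_scaleR[OF c f[OF h(1)]] has_derivative_scaleR[OF s f[OF h(2)]]]]
    by (simp add: algebra_simps)
qed

context spinc_local
begin

text \<open>Near the point, the inverse of a chart of the bundle factors through \<open>Psi\<close>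
  by means of the local inverse \<open>Th\<close>. So every tangent vector is a velocity of
  \<open>Psi\<close>, on which the uniqueness of horizontal lifts rests.\<close>

lemma Psi_surj:
  assumes y: "y \<in> W" and v: "v \<in> tangent_space AP (Psi (y, u, t))"
  shows "\<exists>w. v = vel AP Psi (y, u, t) w"
proof -
  note PA = atlases(2)
  let ?p = "Psi (y, u, t)"
  obtain d Th where d: "d \<in> charts_at AP ?p" and dif: "(\<lambda>z. Th (chart_inv d z)) differentiable (at (snd d ?p))"
    and Th: "Th ?p = (y, u, t)" and ev: "\<forall>\<^sub>F z in nhds (snd d ?p). Psi (Th (chart_inv d z)) = chart_inv d z"
    using Psi_inv[OF y, of u t] by (elim bexE exE conjE)
  have p: "chart_inv d (snd d ?p) = ?p" using chart_inv_snd[OF PA] d by (simp add: charts_at_def)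
  have dPsi: "dif_par AP Psi (Th (chart_inv d (snd d ?p)))" unfolding p Th by (rule Psi_dif[OF y])
  have "v = vel AP (chart_inv d) (snd d ?p) (v d)" by (rule tangent_vector_eq_vel[OF PA v d])
  also have "\<dots> = vel AP (\<lambda>z. Psi (Th (chart_inv d z))) (snd d ?p) (v d)"
    by (rule dif_par_cong(2)[OF ev, symmetric])
  also have "\<dots> = vel AP Psi (Th (chart_inv d (snd d ?p))) (frechet_derivative (\<lambda>z. Th (chart_inv d z)) (at (snd d ?p)) (v d))"
    by (rule vel_comp[OF PA dPsi dif])
  finally show ?thesis unfolding p Th by blast
qed

text \<open>The same factorization carries differentiability from the parameter space, where the
  components of a spinor field have an explicit formula, to the bundle.\<close>

lemma dif_fun_Psi:
  assumes y: "y \<in> W" and F: "(\<lambda>z. F (Psi z)) differentiable (at (y, u, t))"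
  shows "dif_fun AP F (Psi (y, u, t))"
proof -
  note PA = atlases(2)
  let ?p = "Psi (y, u, t)"
  obtain d Th where d: "d \<in> charts_at AP ?p" and dif: "(\<lambda>z. Th (chart_inv d z)) differentiable (at (snd d ?p))"
    and Th: "Th ?p = (y, u, t)" and ev: "\<forall>\<^sub>F z in nhds (snd d ?p). Psi (Th (chart_inv d z)) = chart_inv d z"
    using Psi_inv[OF y, of u t] by (elim bexE exE conjE)
  have p: "chart_inv d (snd d ?p) = ?p" using chart_inv_snd[OF PA] d by (simp add: charts_at_def)
  have "(\<lambda>z. F (Psi (Th (chart_inv d z)))) differentiable (at (snd d ?p))"
    by (rule frechet_derivative_comp(1)[OF dif, of "\<lambda>z. F (Psi z)"]) (use F p Th in simp)
  moreover have e: "\<forall>\<^sub>F z in nhds (snd d ?p). F (Psi (Th (chart_inv d z))) = F (chart_inv d z)"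
    using ev by eventually_elim (rule arg_cong)
  ultimately have "(\<lambda>z. F (chart_inv d z)) differentiable (at (snd d ?p))"
    unfolding eventually_cong_derivative(1)[OF e] by blast
  then show ?thesis unfolding dif_fun_def using d by blast
qed

lemma Psi_near:
  fixes P :: "(real ^ 2) \<times> real \<times> real \<Rightarrow> bool"
  assumes "y \<in> W" "\<And>z. fst z \<in> W \<Longrightarrow> P z"
  shows "\<forall>\<^sub>F z in nhds (y, u, t). P z"
  by (rule eventually_nhds_open_vimage[OF open_WU]) (use assms in auto)

text \<open>Over \<open>(y, u, t)\<close> the frame is that of the section turned by
  \<open>u - t\<close>. It moves by the turning speed \<open>r - s\<close> and by the rotation
  \<open>om y w\<close> of the underlying frame; rotations of the plane commute, so the two rates
  add.\<close>

lemma cov_frame: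
  assumes y: "y \<in> W" and d: "d \<in> charts_at AM (chart_inv c y)"
  shows "cov_along AP AM (metric S) (P_proj S) (\<lambda>p'. theta_frame S p' 1) (Psi (y, u, t)) (vel AP Psi (y, u, t) (w, r, s)) d
      = (om y w + r - s) *\<^sub>R theta_frame S (Psi (y, u, t)) 2 d"
    and "cov_along AP AM (metric S) (P_proj S) (\<lambda>p'. theta_frame S p' 2) (Psi (y, u, t)) (vel AP Psi (y, u, t) (w, r, s)) d
      = - (om y w + r - s) *\<^sub>R theta_frame S (Psi (y, u, t)) 1 d"
proof -
  note MA = atlases(1) and PA = atlases(2)
  let ?z = "(y, u, t)" and ?\<phi> = "\<lambda>z. snd d (chart_inv c z)"
  have dA: "d \<in> AM" "chart_inv c y \<in> fst d" using d by (simp_all add: charts_at_def)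
  have pz: "P_proj S (Psi ?z) = chart_inv c y" by (rule Psi_proj[OF y])
  obtain f1 f2 W' V where F: "frame2 W' (metric_matrix AM (metric S) d) f1 f2"
    and V: "open V" "y \<in> V" "V \<subseteq> W" and \<phi>: "smooth_on V ?\<phi>" "?\<phi> ` V \<subseteq> W'"
    and ff: "\<forall>z\<in>V. f1 (?\<phi> z) = theta_frame S (sec z) 1 d" "\<forall>z\<in>V. f2 (?\<phi> z) = theta_frame S (sec z) 2 d"
    and om: "\<forall>w. frame2.om (metric_matrix AM (metric S) d) f1 f2 (?\<phi> y) (frechet_derivative ?\<phi> (at y) w) = om y w"
    using transition_frame[OF y d] by (elim exE conjE)
  note ff1 = bspec[OF ff(1)] and ff2 = bspec[OF ff(2)] and om' = spec[OF om]
  interpret F: frame2 W' "metric_matrix AM (metric S) d" f1 f2 by (rule F)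
  have \<phi>y: "?\<phi> y \<in> W'" using \<phi>(2) V(2) by blast
  have d\<phi>: "?\<phi> differentiable (at y)" by (rule smooth_on_differentiable[OF \<phi>(1) V(2)])
  let ?L = "frechet_derivative ?\<phi> (at y)"
  note cf1 = frechet_derivative_comp[OF d\<phi> F.e_diff(1)[OF \<phi>y]] and cf2 = frechet_derivative_comp[OF d\<phi> F.e_diff(2)[OF \<phi>y]]
  have VU: "open (V \<times> (UNIV :: (real \<times> real) set))" "?z \<in> V \<times> UNIV" using V by (auto simp: open_Times)
  have th: "theta_frame S (Psi z) 1 d = cos (fst (snd z) - snd (snd z)) *\<^sub>R f1 (?\<phi> (fst z)) + sin (fst (snd z) - snd (snd z)) *\<^sub>R f2 (?\<phi> (fst z))"
    "theta_frame S (Psi z) 2 d = cos (fst (snd z) - snd (snd z)) *\<^sub>R f2 (?\<phi> (fst z)) + sin (fst (snd z) - snd (snd z)) *\<^sub>R (- f1 (?\<phi> (fst z)))"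
    if "z \<in> V \<times> UNIV" for z
  proof -
    have "fst z \<in> V" "fst z \<in> W" using that V(3) by auto
    then show "theta_frame S (Psi z) 1 d = cos (fst (snd z) - snd (snd z)) *\<^sub>R f1 (?\<phi> (fst z)) + sin (fst (snd z) - snd (snd z)) *\<^sub>R f2 (?\<phi> (fst z))"
      "theta_frame S (Psi z) 2 d = cos (fst (snd z) - snd (snd z)) *\<^sub>R f2 (?\<phi> (fst z)) + sin (fst (snd z) - snd (snd z)) *\<^sub>R (- f1 (?\<phi> (fst z)))"
      using Psi_sec[of "fst z" "fst (snd z)" "snd (snd z)"] ff1[of "fst z"] ff2[of "fst z"] by (simp_all add: theta_act)
  qed
  have m1: "(\<lambda>z. - f1 (?\<phi> z)) differentiable (at y)" "frechet_derivative (\<lambda>z. - f1 (?\<phi> z)) (at y) v = - frechet_derivative (\<lambda>z. f1 (?\<phi> z)) (at y) v" for v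
    using frechet_derivative_linear_compose[OF bounded_linear_minus[OF bounded_linear_ident] cf1(1)] by simp_all
  have e1: "frechet_derivative (\<lambda>z. theta_frame S (Psi z) 1 d) (at ?z) = frechet_derivative (\<lambda>z. cos (fst (snd z) - snd (snd z)) *\<^sub>R f1 (?\<phi> (fst z)) + sin (fst (snd z) - snd (snd z)) *\<^sub>R f2 (?\<phi> (fst z))) (at ?z)"
    by (rule differentiable_cong_open(2)[OF VU]) (rule th(1))
  have e2: "frechet_derivative (\<lambda>z. theta_frame S (Psi z) 2 d) (at ?z) = frechet_derivative (\<lambda>z. cos (fst (snd z) - snd (snd z)) *\<^sub>R f2 (?\<phi> (fst z)) + sin (fst (snd z) - snd (snd z)) *\<^sub>R (- f1 (?\<phi> (fst z)))) (at ?z)"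
    by (rule differentiable_cong_open(2)[OF VU]) (rule th(2))
  have D1: "frechet_derivative (\<lambda>z. theta_frame S (Psi z) 1 d) (at ?z) (w, r, s) =
    cos (u - t) *\<^sub>R frechet_derivative f1 (at (?\<phi> y)) (?L w) + sin (u - t) *\<^sub>R frechet_derivative f2 (at (?\<phi> y)) (?L w)
      + (r - s) *\<^sub>R (- sin (u - t) *\<^sub>R f1 (?\<phi> y) + cos (u - t) *\<^sub>R f2 (?\<phi> y))"
    unfolding e1 frechet_derivative_rotation[OF cf1(1) cf2(1)] cf1(2) cf2(2) by simp
  have D2: "frechet_derivative (\<lambda>z. theta_frame S (Psi z) 2 d) (at ?z) (w, r, s) =
    cos (u - t) *\<^sub>R frechet_derivative f2 (at (?\<phi> y)) (?L w) - sin (u - t) *\<^sub>R frechet_derivative f1 (at (?\<phi> y)) (?L w)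
      + (r - s) *\<^sub>R (- sin (u - t) *\<^sub>R f2 (?\<phi> y) - cos (u - t) *\<^sub>R f1 (?\<phi> y))"
    unfolding e2 frechet_derivative_rotation[OF cf2(1) m1(1)] m1(2) cf1(2) cf2(2) by simp
  have Dp: "frechet_derivative (\<lambda>z. snd d (P_proj S (Psi z))) (at ?z) (w, r, s) = ?L w"
  proof -
    have e: "snd d (P_proj S (Psi z)) = ?\<phi> (fst z)" if "z \<in> V \<times> UNIV" for z
      using Psi_proj[of "fst z" "fst (snd z)" "snd (snd z)"] that V(3) by auto
    have e3: "frechet_derivative (\<lambda>z. snd d (P_proj S (Psi z))) (at ?z) = frechet_derivative (\<lambda>z. ?\<phi> (fst z)) (at ?z)"
      by (rule differentiable_cong_open(2)[OF VU]) (rule e)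
    have f: "(fst has_derivative fst) (at ?z)" by (rule has_derivative_fst[OF has_derivative_ident])
    have "frechet_derivative (\<lambda>z. ?\<phi> (fst z)) (at ?z) (w, r, s) = frechet_derivative ?\<phi> (at (fst ?z)) (frechet_derivative fst (at ?z) (w, r, s))"
      by (rule frechet_derivative_comp(2)[OF differentiableI[OF f]]) (use d\<phi> in simp)
    then show ?thesis
      unfolding e3 frechet_derivative_eqI[OF f] by simp
  qed
  have E: "dif_fun AP (\<lambda>p. theta_frame S p i d) (Psi ?z)" for i
    by (rule smooth_fun_dif_fun[OF PA theta_frame_smooth[OF dA(1)]]) (use pz dA(2) in simp)
  have dd: "d \<in> charts_at AM (P_proj S (Psi ?z))" using d unfolding pz .
  have cov: "cov_along AP AM (metric S) (P_proj S) (\<lambda>p'. theta_frame S p' i) (Psi ?z) (vel AP Psi ?z (w, r, s)) d =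
    frechet_derivative (\<lambda>z. theta_frame S (Psi z) i d) (at ?z) (w, r, s) + F.Gam (?\<phi> y) (?L w) (theta_frame S (Psi ?z) i d)" for i
    unfolding cov_along_vel[where E = "\<lambda>p'. theta_frame S p' i" and h = Psi and y = ?z and F = "P_proj S" and c = d,
        OF PA MA smooth_map_dif_map[OF PA MA P_proj_smooth] Psi_dif[OF y] E dd] christoffel_chr Dp pz F.Gam_def ..
  note n = F.nab_frame[OF \<phi>y, of "?L w", unfolded om', unfolded F.nab_def]
  have n1: "frechet_derivative f1 (at (?\<phi> y)) (?L w) = om y w *\<^sub>R f2 (?\<phi> y) - F.Gam (?\<phi> y) (?L w) (f1 (?\<phi> y))"
    using n(1) by (simp only: eq_diff_eq)
  have n2: "frechet_derivative f2 (at (?\<phi> y)) (?L w) = - om y w *\<^sub>R f1 (?\<phi> y) - F.Gam (?\<phi> y) (?L w) (f2 (?\<phi> y))"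
    using n(2) by (simp only: eq_diff_eq)
  have t1: "theta_frame S (Psi ?z) 1 d = cos (u - t) *\<^sub>R f1 (?\<phi> y) + sin (u - t) *\<^sub>R f2 (?\<phi> y)"
    using th(1)[OF VU(2)] by simp
  have t2: "theta_frame S (Psi ?z) 2 d = cos (u - t) *\<^sub>R f2 (?\<phi> y) + (- sin (u - t)) *\<^sub>R f1 (?\<phi> y)"
    using th(2)[OF VU(2)] by simp
  show "cov_along AP AM (metric S) (P_proj S) (\<lambda>p'. theta_frame S p' 1) (Psi ?z) (vel AP Psi ?z (w, r, s)) d
      = (om y w + r - s) *\<^sub>R theta_frame S (Psi ?z) 2 d"
    unfolding cov D1 n1 n2 t1 t2 F.Gam_right_linear by (simp add: algebra_simps)
  show "cov_along AP AM (metric S) (P_proj S) (\<lambda>p'. theta_frame S p' 2) (Psi ?z) (vel AP Psi ?z (w, r, s)) d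
      = - (om y w + r - s) *\<^sub>R theta_frame S (Psi ?z) 1 d"
    unfolding cov D2 n1 n2 t1 t2 F.Gam_right_linear by (simp add: algebra_simps)
qed

section \<open>The circle bundle along the section\<close>

definition circ :: "(real ^ 2) \<times> real \<Rightarrow> 'q" where
  "circ z = theta_circle S (Psi (fst z, snd z, 0))"

text \<open>The form \<open>a\<close> of the overview, made real by taking the imaginary
  part.\<close>

definition con :: "real ^ 2 \<Rightarrow> real ^ 2 \<Rightarrow> real" where
  "con y w = Im (conn S (theta_circle S (sec y)) (vel AQ (\<lambda>y. theta_circle S (sec y)) y w))"

lemma theta_sec_smooth: "smooth_into AQ W (\<lambda>y. theta_circle S (sec y))"
  by (rule smooth_map_comp_into[OF atlases(2,3) theta_circle_smooth W(1) sec_smooth])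

lemma circ_sec: "y \<in> W \<Longrightarrow> circ (y, \<tau>) = Q_act S (theta_circle S (sec y)) (cis \<tau>)"
  by (simp add: circ_def Psi_sec theta_act)

lemma theta_Psi: "y \<in> W \<Longrightarrow> theta_circle S (Psi (y, u, t)) = circ (y, u + t)"
  by (simp add: circ_def Psi_sec theta_act)

text \<open>\<open>circ\<close> is written with \<open>Psi\<close> instead of \<open>Q_act\<close>
  so that joint differentiability in the point and the angle follows from that of \<open>Psi\<close>
  and \<open>theta_circle\<close>.\<close>

lemma circ_dif: "y \<in> W \<Longrightarrow> dif_par AQ circ (y, \<tau>)"
proof -
  assume y: "y \<in> W"
  have "bounded_linear (\<lambda>z :: (real ^ 2) \<times> real. (fst z, snd z, 0 :: real))"
    by (intro bounded_linear_Pair bounded_linear_fst bounded_linear_snd bounded_linear_zero)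
  then have "(\<lambda>z :: (real ^ 2) \<times> real. (fst z, snd z, 0 :: real)) differentiable (at (y, \<tau>))"
    by (rule bounded_linear_imp_differentiable)
  from dif_par_comp[OF _ this, of AP Psi] Psi_dif[OF y]
  have "dif_par AP (\<lambda>z. Psi (fst z, snd z, 0)) (y, \<tau>)" by simp
  from dif_map_comp[OF atlases(2,3) smooth_map_dif_map[OF atlases(2,3) theta_circle_smooth] this]
  show ?thesis unfolding circ_def .
qed

text \<open>For a fixed angle, \<open>circ\<close> is the translate of the section by one element of
  the circle, and the connection form is invariant under translation.\<close>

lemma circ_horizontal:
  assumes y: "y \<in> W"
  shows "conn S (circ (y, \<tau>)) (vel AQ circ (y, \<tau>) (w, 0)) = \<i> * of_real (con y w)"
proof -
  note QA = atlases(3)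
  let ?h = "\<lambda>y. theta_circle S (sec y)"
  have hd: "dif_par AQ ?h y" by (rule smooth_into_dif_par[OF QA W(1) theta_sec_smooth y])
  have d: "((\<lambda>y. (y, \<tau>)) has_derivative (\<lambda>w. (w, 0))) (at y)" by (auto intro!: derivative_eq_intros)
  have "vel AQ (\<lambda>y. circ (y, \<tau>)) y w = vel AQ circ (y, \<tau>) (frechet_derivative (\<lambda>y. (y, \<tau>)) (at y) w)"
    by (rule vel_comp[OF QA circ_dif[OF y] differentiableI[OF d]])
  then have 1: "vel AQ circ (y, \<tau>) (w, 0) = vel AQ (\<lambda>y. circ (y, \<tau>)) y w"
    unfolding frechet_derivative_eqI[OF d] by simp
  have ev: "\<forall>\<^sub>F y' in nhds y. circ (y', \<tau>) = Q_act S (?h y') (cis \<tau>)"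
    by (rule eventually_nhds_open_vimage[OF W(1) y circ_sec])
  have 2: "vel AQ (\<lambda>y. circ (y, \<tau>)) y w = push AQ AQ (\<lambda>q. Q_act S q (cis \<tau>)) (?h y) (vel AQ ?h y w)"
    unfolding dif_par_cong(2)[OF ev] by (rule push_vel[symmetric, OF QA QA Q_act_dif_map hd]) simp
  have vt: "vel AQ ?h y w \<in> tangent_space AQ (?h y)" by (rule vel_in_tangent_space[OF QA hd])
  have "conn S (circ (y, \<tau>)) (vel AQ circ (y, \<tau>) (w, 0)) = conn S (?h y) (vel AQ ?h y w)"
    unfolding 1 2 circ_sec[OF y] by (rule connectionD(3)[OF vt vt]) simp
  moreover have "Re (conn S (?h y) (vel AQ ?h y w)) = 0" by (rule connectionD(2)[OF vt vt])
  ultimately show ?thesis by (simp add: complex_eq_iff con_def)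
qed

text \<open>The velocity in the angle is the fundamental vector field, on which a connection form is
  normalized.\<close>

lemma circ_vertical:
  assumes y: "y \<in> W"
  shows "conn S (circ (y, \<tau>)) (vel AQ circ (y, \<tau>) (0, 1)) = \<i>"
proof -
  note QA = atlases(3)
  let ?q = "circ (y, \<tau>)"
  have e: "Q_act S ?q (cis t) = circ (y, \<tau> + t)" for t
    unfolding circ_sec[OF y] by (simp add: Q_act_act cis_mult)
  have "vector_derivative (\<lambda>t. snd d (Q_act S ?q (cis t))) (at 0) = frechet_derivative (\<lambda>z. snd d (circ z)) (at (y, \<tau>)) (0, 1)"
    if d: "d \<in> charts_at AQ ?q" for d
  proof -
    have D: "((\<lambda>z. snd d (circ z)) has_derivative frechet_derivative (\<lambda>z. snd d (circ z)) (at (y, \<tau>))) (at (y, \<tau> + 0))"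
      using differentiable_has_derivative[OF dif_par_chart(2)[OF QA circ_dif[OF y] d]] by simp
    have g: "((\<lambda>t. (y, \<tau> + t)) has_derivative (\<lambda>t. (0, t))) (at 0)" by (auto intro!: derivative_eq_intros)
    have "((\<lambda>t. snd d (circ (y, \<tau> + t))) has_derivative (\<lambda>t. frechet_derivative (\<lambda>z. snd d (circ z)) (at (y, \<tau>)) (0, t))) (at 0)"
      by (rule has_derivative_compose[OF g D])
    moreover have "(\<lambda>t. frechet_derivative (\<lambda>z. snd d (circ z)) (at (y, \<tau>)) (0, t)) =
        (\<lambda>t. t *\<^sub>R frechet_derivative (\<lambda>z. snd d (circ z)) (at (y, \<tau>)) (0, 1))"
    proof
      fix t :: real
      have "(0, t) = t *\<^sub>R (0 :: real ^ 2, 1 :: real)" by simp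
      then show "frechet_derivative (\<lambda>z. snd d (circ z)) (at (y, \<tau>)) (0, t) =
          t *\<^sub>R frechet_derivative (\<lambda>z. snd d (circ z)) (at (y, \<tau>)) (0, 1)"
        by (simp only: linear_scale[OF linear_frechet_derivative[OF dif_par_chart(2)[OF QA circ_dif[OF y] d]]])
    qed
    ultimately have "((\<lambda>t. snd d (circ (y, \<tau> + t))) has_vector_derivative frechet_derivative (\<lambda>z. snd d (circ z)) (at (y, \<tau>)) (0, 1)) (at 0)"
      unfolding has_vector_derivative_def by (simp only:)
    then show ?thesis unfolding e by (rule vector_derivative_at)
  qed
  note vd = this
  have "vel AQ circ (y, \<tau>) (0, 1) = (\<lambda>c. if c \<in> charts_at AQ ?q then vector_derivative (\<lambda>t. snd c (Q_act S ?q (cis t))) (at 0) else 0)"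
  proof
    fix d
    show "vel AQ circ (y, \<tau>) (0, 1) d = (if d \<in> charts_at AQ ?q then vector_derivative (\<lambda>t. snd d (Q_act S ?q (cis t))) (at 0) else 0)"
    proof (cases "d \<in> charts_at AQ ?q")
      case True
      then show ?thesis unfolding vel_def if_P[OF True] by (rule vd[symmetric])
    qed (simp add: vel_def)
  qed
  moreover have t: "vel AQ circ (y, \<tau>) (0, 1) \<in> tangent_space AQ ?q" by (rule vel_in_tangent_space[OF QA circ_dif[OF y]])
  ultimately show ?thesis using connectionD(4)[OF t t] by (simp only:)
qed

lemma conn_Psi:
  assumes y: "y \<in> W"
  shows "conn S (theta_circle S (Psi (y, u, t))) (push AP AQ (theta_circle S) (Psi (y, u, t)) (vel AP Psi (y, u, t) (w, r, s)))
    = \<i> * of_real (con y w + r + s)"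
proof -
  note PA = atlases(2) and QA = atlases(3)
  have "push AP AQ (theta_circle S) (Psi (y, u, t)) (vel AP Psi (y, u, t) (w, r, s)) = vel AQ (\<lambda>z. theta_circle S (Psi z)) (y, u, t) (w, r, s)"
    by (rule push_vel[OF PA QA smooth_map_dif_map[OF PA QA theta_circle_smooth] Psi_dif[OF y]])
  also have "\<dots> = vel AQ (\<lambda>z. circ (fst z, fst (snd z) + snd (snd z))) (y, u, t) (w, r, s)"
  proof (rule dif_par_cong(2), rule Psi_near[OF y])
    fix z :: "(real ^ 2) \<times> real \<times> real" assume "fst z \<in> W"
    then show "theta_circle S (Psi z) = circ (fst z, fst (snd z) + snd (snd z))"
      using theta_Psi[of "fst z" "fst (snd z)" "snd (snd z)"] by simp
  qed
  also have "\<dots> = vel AQ circ (y, u + t) (w, r + s)"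
  proof -
    have d: "((\<lambda>z :: (real ^ 2) \<times> real \<times> real. (fst z, fst (snd z) + snd (snd z))) has_derivative (\<lambda>z. (fst z, fst (snd z) + snd (snd z)))) (at (y, u, t))"
      by (auto intro!: derivative_eq_intros)
    have cd: "dif_par AQ circ ((\<lambda>z. (fst z, fst (snd z) + snd (snd z))) (y, u, t))" using circ_dif[OF y] by simp
    show ?thesis using vel_comp[OF QA cd differentiableI[OF d], of "(w, r, s)"] unfolding frechet_derivative_eqI[OF d] by simp
  qed
  also have "\<dots> = (\<lambda>c. 1 *\<^sub>R vel AQ circ (y, u + t) (w, 0) c + (r + s) *\<^sub>R vel AQ circ (y, u + t) (0, 1) c)"
    using vel_linear[OF QA circ_dif[OF y], of "u + t" 1 "(w, 0)" "r + s" "(0, 1)"] by simp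
  finally have p: "push AP AQ (theta_circle S) (Psi (y, u, t)) (vel AP Psi (y, u, t) (w, r, s)) =
    (\<lambda>c. 1 *\<^sub>R vel AQ circ (y, u + t) (w, 0) c + (r + s) *\<^sub>R vel AQ circ (y, u + t) (0, 1) c)" .
  note ct = vel_in_tangent_space[OF QA circ_dif[OF y], of "u + t"]
  show ?thesis
    unfolding p theta_Psi[OF y] connectionD(1)[OF ct ct] circ_horizontal[OF y] circ_vertical[OF y]
    by (simp add: complex_eq_iff)
qed

lemma push_proj_Psi:
  assumes y: "y \<in> W"
  shows "push AP AM (P_proj S) (Psi (y, u, t)) (vel AP Psi (y, u, t) (w, r, s)) = vel AM (chart_inv c) y w"
proof -
  note MA = atlases(1) and PA = atlases(2)
  have cd: "dif_par AM (chart_inv c) y" using dif_par_chart_inv(1)[OF MA c chart_W(1)[OF y]] .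
  have "push AP AM (P_proj S) (Psi (y, u, t)) (vel AP Psi (y, u, t) (w, r, s)) = vel AM (\<lambda>z. P_proj S (Psi z)) (y, u, t) (w, r, s)"
    by (rule push_vel[OF PA MA smooth_map_dif_map[OF PA MA P_proj_smooth] Psi_dif[OF y]])
  also have "\<dots> = vel AM (\<lambda>z. chart_inv c (fst z)) (y, u, t) (w, r, s)"
  proof (rule dif_par_cong(2), rule Psi_near[OF y])
    fix z :: "(real ^ 2) \<times> real \<times> real" assume "fst z \<in> W"
    then show "P_proj S (Psi z) = chart_inv c (fst z)"
      using Psi_proj[of "fst z" "fst (snd z)" "snd (snd z)"] by simp
  qed
  also have "\<dots> = vel AM (chart_inv c) y w"
  proof -
    have f: "(fst has_derivative fst) (at (y, u, t))" by (rule has_derivative_fst[OF has_derivative_ident])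
    have cd': "dif_par AM (chart_inv c) (fst (y, u, t))" using cd by simp
    show ?thesis using vel_comp[OF MA cd' differentiableI[OF f], of "(w, r, s)"] unfolding frechet_derivative_eqI[OF f] by simp
  qed
  finally show ?thesis .
qed

text \<open>A velocity with parameters \<open>(w, r, s)\<close> is the lift of \<open>X\<close>
  exactly when \<open>w = X c\<close>, \<open>om y w + r - s = 0\<close> and
  \<open>con y w + r + s = 0\<close>. This linear system has one solution, which gives both
  existence and uniqueness for the definite description.\<close>

lemma hor_lift_Psi:
  assumes y: "y \<in> W" and X: "X \<in> tangent_space AM (chart_inv c y)"
  shows "hor_lift S (Psi (y, u, t)) X = vel AP Psi (y, u, t) (X c, - (con y (X c) + om y (X c)) / 2, - (con y (X c) - om y (X c)) / 2)"
  unfolding hor_lift_def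
proof (rule the_equality)
  note MA = atlases(1) and PA = atlases(2)
  let ?w = "X c" and ?r = "- (con y (X c) + om y (X c)) / 2" and ?s = "- (con y (X c) - om y (X c)) / 2"
  let ?v = "vel AP Psi (y, u, t) (?w, ?r, ?s)"
  have pz: "P_proj S (Psi (y, u, t)) = chart_inv c y" by (rule Psi_proj[OF y])
  have Xv: "X = vel AM (chart_inv c) y (X c)"
    using tangent_vector_eq_vel[OF MA X chart_W(4)[OF y]] unfolding chart_W(3)[OF y] .
  have 1: "?v \<in> tangent_space AP (Psi (y, u, t))" by (rule vel_in_tangent_space[OF PA Psi_dif[OF y]])
  have 2: "push AP AM (P_proj S) (Psi (y, u, t)) ?v = X" unfolding push_proj_Psi[OF y] by (rule Xv[symmetric])
  have rs: "om y ?w + ?r - ?s = 0" "con y ?w + ?r + ?s = 0" by (simp_all add: field_simps)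
  have 3: "cov_along AP AM (metric S) (P_proj S) (\<lambda>p'. theta_frame S p' i) (Psi (y, u, t)) ?v = (\<lambda>_. 0)" for i
  proof
    fix d
    show "cov_along AP AM (metric S) (P_proj S) (\<lambda>p'. theta_frame S p' i) (Psi (y, u, t)) ?v d = 0"
    proof (cases "d \<in> charts_at AM (chart_inv c y)")
      case True
      show ?thesis using cov_frame[OF y True, of u t ?w ?r ?s] exhaust_2[of i] unfolding rs by auto
    next
      case False
      then show ?thesis by (simp add: cov_along_def pz)
    qed
  qed
  have 4: "conn S (theta_circle S (Psi (y, u, t))) (push AP AQ (theta_circle S) (Psi (y, u, t)) ?v) = 0"
    unfolding conn_Psi[OF y] rs by simp
  show "?v \<in> tangent_space AP (Psi (y, u, t)) \<and> push AP AM (P_proj S) (Psi (y, u, t)) ?v = X \<and>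
     (\<forall>i. cov_along AP AM (metric S) (P_proj S) (\<lambda>p'. theta_frame S p' i) (Psi (y, u, t)) ?v = (\<lambda>_. 0)) \<and>
     conn S (theta_circle S (Psi (y, u, t))) (push AP AQ (theta_circle S) (Psi (y, u, t)) ?v) = 0"
    using 1 2 3 4 by blast
  fix v
  assume "v \<in> tangent_space AP (Psi (y, u, t)) \<and> push AP AM (P_proj S) (Psi (y, u, t)) v = X \<and>
     (\<forall>i. cov_along AP AM (metric S) (P_proj S) (\<lambda>p'. theta_frame S p' i) (Psi (y, u, t)) v = (\<lambda>_. 0)) \<and>
     conn S (theta_circle S (Psi (y, u, t))) (push AP AQ (theta_circle S) (Psi (y, u, t)) v) = 0"
  then have v: "v \<in> tangent_space AP (Psi (y, u, t))" "push AP AM (P_proj S) (Psi (y, u, t)) v = X"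
     "\<And>i. cov_along AP AM (metric S) (P_proj S) (\<lambda>p'. theta_frame S p' i) (Psi (y, u, t)) v = (\<lambda>_. 0)"
     "conn S (theta_circle S (Psi (y, u, t))) (push AP AQ (theta_circle S) (Psi (y, u, t)) v) = 0" by blast+
  obtain w r s where vv: "v = vel AP Psi (y, u, t) (w, r, s)" using Psi_surj[OF y v(1)] by (metis prod_cases3)
  have w: "w = X c"
    using v(2) unfolding vv push_proj_Psi[OF y] using dif_par_chart_inv(3)[OF MA c chart_W(1)[OF y], of w] by simp
  have "(om y w + r - s) *\<^sub>R theta_frame S (Psi (y, u, t)) 2 c = 0"
    using fun_cong[OF v(3)[of 1], of c] unfolding vv cov_frame(1)[OF y chart_W(4)[OF y]] .
  \<comment> \<open>A frame vector has length one, so its coordinates in \<open>c\<close> do not all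
    vanish and its coefficient must be zero.\<close>
  moreover have "theta_frame S (Psi (y, u, t)) 2 c \<noteq> 0"
  proof
    assume "theta_frame S (Psi (y, u, t)) 2 c = 0"
    then show False
      using theta_frame_orthonormal[of "Psi (y, u, t)" 2 2]
        metric_coordinates[OF c chart_W(1)[OF y], of "theta_frame S (Psi (y, u, t)) 2" "theta_frame S (Psi (y, u, t)) 2"]
        theta_frame_tangent[of "Psi (y, u, t)" 2] unfolding pz by simp
  qed
  ultimately have a: "om y w + r - s = 0" by simp
  have b: "con y w + r + s = 0" using v(4) unfolding vv conn_Psi[OF y] by (simp del: of_real_add)
  have e: "r = ?r" "s = ?s" using a b unfolding w[symmetric] by (simp_all add: field_simps)
  have "(w, r, s) = (X c, ?r, ?s)" unfolding prod.inject using w e by blast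
  then show "v = ?v" unfolding vv by (rule arg_cong)
qed

end

lemma has_derivative_vector2:
  fixes a b :: "'e::real_normed_vector \<Rightarrow> complex"
  assumes "(a has_derivative a') (at z)" "(b has_derivative b') (at z)"
  shows "((\<lambda>z. vector [a z, b z] :: complex ^ 2) has_derivative (\<lambda>v. vector [a' v, b' v])) (at z)"
proof -
  have e: "(vector [x, y] :: complex ^ 2) = axis 1 x + axis 2 y" for x y :: complex
    by (simp add: vec2_eq_iff axis_def)
  show ?thesis unfolding e
    by (intro has_derivative_add bounded_linear.has_derivative[OF bounded_linear_axis] assms)
qed

context spinc_local
begin

section \<open>Covariant derivative and Dirac operator in a local section\<close>

text \<open>\<open>Dn \<phi> y w\<close> and \<open>Dop \<phi> y\<close> represent, with respect to the section, the covariant derivative in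
  the direction with coordinate vector \<open>w\<close> and the Dirac operator.\<close>

definition Dn :: "(real ^ 2 \<Rightarrow> complex ^ 2) \<Rightarrow> real ^ 2 \<Rightarrow> real ^ 2 \<Rightarrow> complex ^ 2" where
  "Dn \<phi> y w = frechet_derivative \<phi> (at y) w +
     vector [\<i> * of_real ((con y w + om y w) / 2) * \<phi> y $ 1, \<i> * of_real ((con y w - om y w) / 2) * \<phi> y $ 2]"

definition Dop :: "(real ^ 2 \<Rightarrow> complex ^ 2) \<Rightarrow> real ^ 2 \<Rightarrow> complex ^ 2" where
  "Dop \<phi> y = vector [\<i> * Dn \<phi> y (fr1 y) $ 2 - Dn \<phi> y (fr2 y) $ 2, \<i> * Dn \<phi> y (fr1 y) $ 1 + Dn \<phi> y (fr2 y) $ 1]"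

lemma equivariant_derivative:
  assumes \<phi>: "\<phi> differentiable (at y)"
  shows "((\<lambda>z :: (real ^ 2) \<times> real \<times> real. tor (- fst (snd z)) (- snd (snd z)) *v \<phi> (fst z)) has_derivative
    (\<lambda>v. tor (- u) (- t) *v (frechet_derivative \<phi> (at y) (fst v) +
      vector [- \<i> * of_real (fst (snd v)) * \<phi> y $ 1, - \<i> * of_real (snd (snd v)) * \<phi> y $ 2]))) (at (y, u, t))"
proof -
  let ?z = "(y, u, t)"
  have f: "((\<lambda>z :: (real ^ 2) \<times> real \<times> real. \<phi> (fst z) $ i) has_derivative (\<lambda>v. frechet_derivative \<phi> (at y) (fst v) $ i)) (at ?z)" for i
  proof -
    have "((\<lambda>z. \<phi> z $ i) has_derivative (\<lambda>v. frechet_derivative \<phi> (at y) v $ i)) (at (fst ?z))"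
      using frechet_derivative_vec_nth(3)[OF \<phi>] by simp
    from has_derivative_compose[OF has_derivative_fst[OF has_derivative_ident] this] show ?thesis by simp
  qed
  have cc: "((\<lambda>z. cis (- l z)) has_derivative (\<lambda>v. - l v *\<^sub>R (\<i> * cis (- l ?z)))) (at ?z)"
    if "bounded_linear l" for l :: "(real ^ 2) \<times> real \<times> real \<Rightarrow> real"
    by (rule has_derivative_compose[OF has_derivative_minus[OF bounded_linear_imp_has_derivative[OF that]] cis_has_derivative])
  have l: "bounded_linear (\<lambda>z :: (real ^ 2) \<times> real \<times> real. fst (snd z))" "bounded_linear (\<lambda>z :: (real ^ 2) \<times> real \<times> real. snd (snd z))"
    by (intro bounded_linear_compose[OF bounded_linear_fst bounded_linear_snd] bounded_linear_compose[OF bounded_linear_snd bounded_linear_snd])+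
  show ?thesis unfolding tor_vector
    by (rule has_derivative_eq_rhs[OF has_derivative_vector2[OF has_derivative_mult[OF cc[OF l(1)] f] has_derivative_mult[OF cc[OF l(2)] f]]])
      (simp add: fun_eq_iff vec2_eq_iff scaleR_conv_of_real algebra_simps)
qed

text \<open>Along the fibre the components change by \<open>tor (- u) (- t)\<close>, so the vertical
  part \<open>(r, s)\<close> of the lift contributes the factors \<open>- \<i> * r\<close> and
  \<open>- \<i> * s\<close>. The minus signs in \<open>hor_lift_Psi\<close> turn them into the
  positive connection terms of \<open>Dn\<close>.\<close>

lemma nabla_class:
  assumes rep: "\<And>y. y \<in> W \<Longrightarrow> \<xi> (chart_inv c y) = spinor_class S (sec y) (\<phi> y)"
    and y: "y \<in> W" and \<phi>: "\<phi> differentiable (at y)" and X: "X \<in> tangent_space AM (chart_inv c y)"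
  shows "nabla S \<xi> (chart_inv c y) X = spinor_class S (sec y) (Dn \<phi> y (X c))"
proof (rule spinor_class_eqI)
  note PA = atlases(2)
  show "P_proj S p' = P_proj S (sec y)" if "(p', \<sigma>') \<in> nabla S \<xi> (chart_inv c y) X" for p' \<sigma>'
    using that by (simp add: nabla_def sec_proj[OF y])
  fix u t :: real and \<sigma>' :: "complex ^ 2"
  let ?F = "\<lambda>p'. sp_comp p' (\<xi> (P_proj S p'))" and ?z = "(y, u, t)"
  let ?E = "\<lambda>z :: (real ^ 2) \<times> real \<times> real. tor (- fst (snd z)) (- snd (snd z)) *v \<phi> (fst z)"
  have e: "?F (Psi z) = ?E z" if z: "fst z \<in> W" for z
  proof -
    have "Psi z = P_act S (sec (fst z)) (tor (fst (snd z)) (snd (snd z)))"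
      using Psi_sec[OF z, of "fst (snd z)" "snd (snd z)"] by simp
    moreover have "P_proj S (Psi z) = chart_inv c (fst z)"
      using Psi_proj[OF z, of "fst (snd z)" "snd (snd z)"] by simp
    ultimately show ?thesis using rep[OF z] by (simp add: sp_comp_class)
  qed
  have ev: "\<forall>\<^sub>F z in nhds ?z. ?F (Psi z) = ?E z" by (rule Psi_near[OF y e])
  note D = equivariant_derivative[OF \<phi>, of u t]
  have dF: "(\<lambda>z. ?F (Psi z)) differentiable (at ?z)"
    unfolding eventually_cong_derivative(1)[OF ev] using D by (rule differentiableI)
  have T: "tdiff AP ?F (Psi ?z) (vel AP Psi ?z w) = frechet_derivative (\<lambda>z. ?F (Psi z)) (at ?z) w" for w
    by (rule tdiff_vel(1)[OF PA dif_fun_Psi[OF y dF] Psi_dif[OF y]])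
  have v: "vector [- \<i> * of_real (- (a + b) / 2) * x1, - \<i> * of_real (- (a - b) / 2) * x2] =
      (vector [\<i> * of_real ((a + b) / 2) * x1, \<i> * of_real ((a - b) / 2) * x2] :: complex ^ 2)" for a b x1 x2
    by (simp add: vec2_eq_iff complex_eq_iff field_simps)
  have t: "tdiff AP ?F (Psi ?z) (hor_lift S (Psi ?z) X) = tor (- u) (- t) *v Dn \<phi> y (X c)"
    unfolding hor_lift_Psi[OF y X] T eventually_cong_derivative(2)[OF ev] frechet_derivative_eqI[OF D] Dn_def
    by (simp only: fst_conv snd_conv v)
  have "(P_act S (sec y) (tor u t), \<sigma>') \<in> nabla S \<xi> (chart_inv c y) X \<longleftrightarrow>
      \<sigma>' = tdiff AP ?F (Psi ?z) (hor_lift S (Psi ?z) X)"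
    unfolding nabla_def Psi_sec[OF y, symmetric] using Psi_proj[OF y] by blast
  then show "(P_act S (sec y) (tor u t), \<sigma>') \<in> nabla S \<xi> (chart_inv c y) X \<longleftrightarrow> \<sigma>' = tor (- u) (- t) *v Dn \<phi> y (X c)"
    unfolding t .
qed

lemma con_linear:
  assumes y: "y \<in> W"
  shows "con y (a *\<^sub>R u + b *\<^sub>R v) = a * con y u + b * con y v"
proof -
  note QA = atlases(3)
  have hd: "dif_par AQ (\<lambda>y. theta_circle S (sec y)) y" by (rule smooth_into_dif_par[OF QA W(1) theta_sec_smooth y])
  note t = vel_in_tangent_space[OF QA hd]
  show ?thesis unfolding con_def vel_linear[OF QA hd] connectionD(1)[OF t t] by simp
qed

lemma Dn_linear:
  assumes y: "y \<in> W" and \<phi>: "\<phi> differentiable (at y)"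
  shows "Dn \<phi> y (a *\<^sub>R u + b *\<^sub>R v) = a *\<^sub>R Dn \<phi> y u + b *\<^sub>R Dn \<phi> y v"
proof -
  note l = linear_frechet_derivative[OF \<phi>]
  show ?thesis unfolding Dn_def con_linear[OF y] om_linear[OF y] linear_add[OF l] linear_scale[OF l]
    by (simp add: vec2_eq_iff complex_eq_iff field_simps)
qed

lemma coords_sec:
  assumes y: "y \<in> W" and X: "X \<in> tangent_space AM (chart_inv c y)"
  shows "coords (sec y) X $ i = gm y (X c) (theta_frame S (sec y) i c)"
  using metric_coordinates[OF c chart_W(1)[OF y] X theta_frame_tangent[of "sec y" i, unfolded sec_proj[OF y]]]
  by (simp add: coords_def sec_proj[OF y] gm_def)

lemma cliff_sec:
  assumes y: "y \<in> W" and X: "X \<in> tangent_space AM (chart_inv c y)"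
  shows "cliff S X (spinor_class S (sec y) \<sigma>) = spinor_class S (sec y) (cl (coords (sec y) X) *v \<sigma>)"
  by (rule cliff_class) (use X sec_proj[OF y] in simp)

lemma tangent_expand:
  assumes y: "y \<in> W" and X: "X \<in> tangent_space AM (chart_inv c y)"
  shows "X c = coords (sec y) X $ 1 *\<^sub>R fr1 y + coords (sec y) X $ 2 *\<^sub>R fr2 y"
  unfolding coords_sec[OF y X] by (rule frame_expand[OF y])

lemma on_frame_in:
  assumes y: "y \<in> W"
  shows "on_frame S (chart_inv c y) \<in> so_frames S (chart_inv c y)"
  using theta_frame_in[of "sec y"] unfolding sec_proj[OF y] on_frame_def by (rule someI[where P = "\<lambda>e. e \<in> so_frames S (chart_inv c y)"])

text \<open>The frame selected by \<open>on_frame\<close> is related to that of the section by an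
  orthogonal matrix \<open>R\<close>, under which the sum over the frame is invariant. The Dirac
  operator is thereby represented with the smooth frame of the section at every point of
  \<open>W\<close>, so that it can be applied a second time.\<close>

lemma dirac_class:
  assumes rep: "\<And>y. y \<in> W \<Longrightarrow> \<xi> (chart_inv c y) = spinor_class S (sec y) (\<phi> y)"
    and y: "y \<in> W" and \<phi>: "\<phi> differentiable (at y)"
  shows "dirac S \<xi> (chart_inv c y) = spinor_class S (sec y) (Dop \<phi> y)"
proof -
  define e where "e = on_frame S (chart_inv c y)"
  have e: "e i \<in> tangent_space AM (chart_inv c y)" "metric S (chart_inv c y) (e i) (e j) = (if i = j then 1 else 0)" for i j
    using on_frame_in[OF y] unfolding e_def oriented_frames_def by blast+
  define R :: "real ^ 2 ^ 2" where "R = (\<chi> i j. coords (sec y) (e i) $ j)"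
  have ex: "e i c = R $ i $ 1 *\<^sub>R fr1 y + R $ i $ 2 *\<^sub>R fr2 y" for i
    using tangent_expand[OF y e(1)] by (simp add: R_def)
  have g: "gm y (e i c) (e j c) = (if i = j then 1 else 0)" for i j
    using e(2)[of i j] unfolding metric_coordinates[OF c chart_W(1)[OF y] e(1) e(1)] gm_def .
  have "gm y (e i c) (e j c) = R $ i $ 1 * R $ j $ 1 + R $ i $ 2 * R $ j $ 2" for i j
    unfolding ex gm_add gm_on[OF y] by simp
  then have "R ** transpose R = mat 1"
    using g by (simp add: vec_eq_iff matrix2_mult_nth transpose_def mat_def)
  \<comment> \<open>Orthonormality of the frame gives orthonormal rows; the sum over the frame
    contracts the row index and needs orthonormal columns.\<close>
  then have "transpose R ** R = mat 1" using matrix_left_right_inverse by blast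
  then have "(transpose R ** R) $ i $ j = (if i = j then 1 else 0)" for i j by (simp add: mat_def)
  then have o: "R $ 1 $ i * R $ 1 $ j + R $ 2 $ i * R $ 2 $ j = (if i = j then 1 else 0)" for i j
    by (simp add: matrix2_mult_nth transpose_def)
  define N1 N2 where "N1 = Dn \<phi> y (fr1 y)" and "N2 = Dn \<phi> y (fr2 y)"
  have cl: "cliff S (e i) (nabla S \<xi> (chart_inv c y) (e i)) =
      spinor_class S (sec y) (cl (R $ i) *v (R $ i $ 1 *\<^sub>R N1 + R $ i $ 2 *\<^sub>R N2))" for i
  proof -
    have "coords (sec y) (e i) = R $ i" by (simp add: R_def vec_eq_iff)
    moreover have "nabla S \<xi> (chart_inv c y) (e i) = spinor_class S (sec y) (Dn \<phi> y (e i c))"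
      by (rule nabla_class[OF _ y \<phi> e(1)]) (rule rep)
    ultimately show ?thesis
      unfolding N1_def N2_def Dn_linear[OF y \<phi>, symmetric] ex[symmetric] by (simp only: cliff_sec[OF y e(1)])
  qed
  have "cl (R $ 1) *v (R $ 1 $ 1 *\<^sub>R N1 + R $ 1 $ 2 *\<^sub>R N2) + cl (R $ 2) *v (R $ 2 $ 1 *\<^sub>R N1 + R $ 2 $ 2 *\<^sub>R N2) =
    vector [\<i> * (of_real (R $ 1 $ 1 * R $ 1 $ 1 + R $ 2 $ 1 * R $ 2 $ 1) * N1 $ 2 + of_real (R $ 1 $ 1 * R $ 1 $ 2 + R $ 2 $ 1 * R $ 2 $ 2) * N2 $ 2)
        - (of_real (R $ 1 $ 2 * R $ 1 $ 1 + R $ 2 $ 2 * R $ 2 $ 1) * N1 $ 2 + of_real (R $ 1 $ 2 * R $ 1 $ 2 + R $ 2 $ 2 * R $ 2 $ 2) * N2 $ 2),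
      \<i> * (of_real (R $ 1 $ 1 * R $ 1 $ 1 + R $ 2 $ 1 * R $ 2 $ 1) * N1 $ 1 + of_real (R $ 1 $ 1 * R $ 1 $ 2 + R $ 2 $ 1 * R $ 2 $ 2) * N2 $ 1)
        + (of_real (R $ 1 $ 2 * R $ 1 $ 1 + R $ 2 $ 2 * R $ 2 $ 1) * N1 $ 1 + of_real (R $ 1 $ 2 * R $ 1 $ 2 + R $ 2 $ 2 * R $ 2 $ 2) * N2 $ 1)]"
    unfolding vec2_eq_iff vector_add_component matrix2_vector_nth cl_nth vector_2 vector_scaleR_component
    by (simp add: complex_eq_iff algebra_simps)
  also have "\<dots> = Dop \<phi> y" unfolding o Dop_def N1_def N2_def by simp
  finally show ?thesis
    unfolding dirac_def Let_def e_def[symmetric] cl sp_add_class by simp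
qed

text \<open>In a chart \<open>e\<close> of the circle bundle the connection becomes a form
  \<open>A\<close>, and \<open>con\<close> is its pull-back by the coordinate expression of the
  section. Pull-back commutes with the exterior derivative because second derivatives are symmetric.
  Smoothness is stated near one point, since a single chart need not contain the whole
  section.\<close>

lemma con_local:
  assumes y: "y \<in> W"
  shows "\<exists>N. open N \<and> y \<in> N \<and> N \<subseteq> W \<and> (\<forall>w. smooth_on N (\<lambda>y. con y w))"
    and "frechet_derivative (\<lambda>y. con y v) (at y) u - frechet_derivative (\<lambda>y. con y u) (at y) v =
      Im (ext_deriv AQ (conn S) (theta_circle S (sec y)) (vel AQ (\<lambda>y. theta_circle S (sec y)) y u) (vel AQ (\<lambda>y. theta_circle S (sec y)) y v))"
proof -
  note QA = atlases(3)
  let ?h = "\<lambda>y. theta_circle S (sec y)"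
  define e where "e = chart_at AQ (?h y)"
  have e: "e \<in> charts_at AQ (?h y)" unfolding e_def by (rule chart_at_in[OF QA])
  have eA: "e \<in> AQ" using e by (simp add: charts_at_def)
  let ?\<eta> = "\<lambda>y. snd e (?h y)"
  obtain N where N: "open N" "y \<in> N" "N \<subseteq> W" "?h ` N \<subseteq> fst e" "smooth_on N ?\<eta>"
    using smooth_into_local[OF QA W(1) theta_sec_smooth y e] by (elim exE conjE)
  define A where "A z w = conn S (chart_inv e z) (coord_vec AQ e (chart_inv e z) w)" for z w
  let ?V = "snd e ` fst e"
  note oV = smooth_atlasD(3)[OF QA eA]
  have \<eta>V: "?\<eta> ` N \<subseteq> ?V" using N(4) by blast
  have Alin: "linear (A z)" if z: "z \<in> ?V" for z
  proof -
    note dp = dif_par_chart_inv(1)[OF QA eA z]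
    note t = vel_in_tangent_space[OF QA dp]
    have l: "A z (a *\<^sub>R u + b *\<^sub>R v) = a *\<^sub>R A z u + b *\<^sub>R A z v" for a b u v
      unfolding A_def dif_par_chart_inv(4)[OF QA eA z] vel_linear[OF QA dp] connectionD(1)[OF t t] ..
    show ?thesis by (rule linearI) (use l[of 1 _ 1 _] l[of _ _ 0 0] in simp_all)
  qed
  have Asm: "smooth_on ?V (\<lambda>z. A z w)" for w
    using connection eA unfolding connection_form_def A_def by blast
  have con: "con y w = Im (A (?\<eta> y) (frechet_derivative ?\<eta> (at y) w))" if y: "y \<in> N" for y w
  proof -
    have z: "?\<eta> y \<in> ?V" using \<eta>V y by blast
    have h: "chart_inv e (?\<eta> y) = ?h y" if "y \<in> N" for y using chart_inv_snd[OF QA eA] N(4) that by blast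
    have ev: "\<forall>\<^sub>F y in nhds y. ?h y = chart_inv e (?\<eta> y)"
      by (rule eventually_nhds_open_vimage[OF N(1) y h[symmetric]])
    have "vel AQ ?h y w = vel AQ (\<lambda>y. chart_inv e (?\<eta> y)) y w" by (rule dif_par_cong(2)[OF ev])
    also have "\<dots> = vel AQ (chart_inv e) (?\<eta> y) (frechet_derivative ?\<eta> (at y) w)"
      by (rule vel_comp[OF QA dif_par_chart_inv(1)[OF QA eA z] smooth_on_differentiable[OF N(5) y]])
    also have "\<dots> = coord_vec AQ e (chart_inv e (?\<eta> y)) (frechet_derivative ?\<eta> (at y) w)"
      by (rule dif_par_chart_inv(4)[OF QA eA z, symmetric])
    finally show ?thesis unfolding con_def A_def h[OF y] by simp
  qed
  have sA: "smooth_on N (\<lambda>y. A (?\<eta> y) w)" for w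
    by (rule smooth_on_compose[OF N(1) oV Asm N(5) \<eta>V])
  have AN: "linear (A (?\<eta> y))" if "y \<in> N" for y using Alin \<eta>V that by blast
  have AS: "A (?\<eta> y) w = (\<Sum>b\<in>Basis. (w \<bullet> b) *\<^sub>R A (?\<eta> y) b)" if y: "y \<in> N" for y w
  proof -
    have "A (?\<eta> y) w = A (?\<eta> y) (\<Sum>b\<in>Basis. (w \<bullet> b) *\<^sub>R b)" by (simp only: euclidean_representation)
    also have "\<dots> = (\<Sum>b\<in>Basis. (w \<bullet> b) *\<^sub>R A (?\<eta> y) b)"
      by (simp only: linear_sum[OF AN[OF y]] linear_scale[OF AN[OF y]] o_def)
    finally show ?thesis .
  qed
  have "smooth_on N (\<lambda>y. con y w)" for w
  proof -
    have "smooth_on N (\<lambda>y. \<Sum>b\<in>Basis. (frechet_derivative ?\<eta> (at y) w \<bullet> b) *\<^sub>R A (?\<eta> y) b)"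
      by (intro smooth_on_sum[OF N(1)] smooth_on_bounded_bilinear[OF N(1) bounded_bilinear_scaleR] sA
          smooth_on_bounded_bilinear[OF N(1) bounded_bilinear_inner] smooth_on_frechet_derivative[OF N(5)] smooth_on_const)
    from smooth_on_linear_compose[OF N(1) bounded_linear_Im this]
    show ?thesis
    proof (subst smooth_on_cong[OF N(1)])
      fix y assume y: "y \<in> N"
      show "con y w = Im (\<Sum>b\<in>Basis. (frechet_derivative ?\<eta> (at y) w \<bullet> b) *\<^sub>R A (?\<eta> y) b)"
        unfolding con[OF y] by (rule arg_cong[OF AS[OF y]])
    qed
  qed
  then show "\<exists>N. open N \<and> y \<in> N \<and> N \<subseteq> W \<and> (\<forall>w. smooth_on N (\<lambda>y. con y w))"
    using N(1-3) by blast
  let ?D\<eta> = "frechet_derivative ?\<eta> (at y)"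
  have d\<eta>: "(\<lambda>y. frechet_derivative ?\<eta> (at y) w) differentiable (at y)" for w
    by (rule smooth_on_differentiable[OF smooth_on_frechet_derivative[OF N(5)] N(2)])
  have dA: "(\<lambda>y. A (?\<eta> y) w) differentiable (at y)" for w by (rule smooth_on_differentiable[OF sA N(2)])
  have D: "frechet_derivative (\<lambda>y. con y w) (at y) v =
    Im (frechet_derivative (\<lambda>z. A z (?D\<eta> w)) (at (?\<eta> y)) (?D\<eta> v) + A (?\<eta> y) (frechet_derivative (\<lambda>y. frechet_derivative ?\<eta> (at y) w) (at y) v))" for v w
  proof -
    let ?B = "\<lambda>y. A (?\<eta> y) (frechet_derivative ?\<eta> (at y) w)"
    have dB: "?B differentiable (at y)"
      by (rule frechet_derivative_linear_form(2)[OF N(1,2) AN dA d\<eta>])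
    have "frechet_derivative (\<lambda>y. con y w) (at y) v = frechet_derivative (\<lambda>y. Im (?B y)) (at y) v"
      by (rule fun_cong[OF differentiable_cong_open(2)[OF N(1,2)]]) (rule con)
    also have "\<dots> = Im (frechet_derivative ?B (at y) v)"
      by (rule frechet_derivative_linear_compose(1)[OF bounded_linear_Im dB])
    also have "frechet_derivative ?B (at y) v =
      frechet_derivative (\<lambda>y'. A (?\<eta> y') (?D\<eta> w)) (at y) v + A (?\<eta> y) (frechet_derivative (\<lambda>y. frechet_derivative ?\<eta> (at y) w) (at y) v)"
      by (rule frechet_derivative_linear_form(1)[OF N(1,2) AN dA d\<eta>])
    also have "frechet_derivative (\<lambda>y'. A (?\<eta> y') (?D\<eta> w)) (at y) v = frechet_derivative (\<lambda>z. A z (?D\<eta> w)) (at (?\<eta> y)) (?D\<eta> v)"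
      by (rule frechet_derivative_comp(2)[OF smooth_on_differentiable[OF N(5,2)] smooth_on_differentiable[OF Asm]])
        (use \<eta>V N(2) in blast)
    finally show ?thesis .
  qed
  have v: "vel AQ ?h y w e = ?D\<eta> w" for w unfolding vel_def if_P[OF e] ..
  show "frechet_derivative (\<lambda>y. con y v) (at y) u - frechet_derivative (\<lambda>y. con y u) (at y) v =
      Im (ext_deriv AQ (conn S) (?h y) (vel AQ ?h y u) (vel AQ ?h y v))"
    unfolding ext_deriv_def Let_def e_def[symmetric] v A_def[symmetric] D
    using frechet_derivative_symmetric[OF N(1,2,5), of u v] by simp
qed

end

section \<open>Commutator of the covariant derivatives\<close>

context frame2
begin

text \<open>One component of the spinor at a time: \<open>N e\<close> is the derivative along
  \<open>e\<close> for the connection form \<open>\<i> * b\<close>. The commutator consists of the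
  derivative along the bracket of the frame, given by \<open>frame_bracket\<close>, and of the
  curvature \<open>\<i> db\<close>, in which the frame vectors are frozen at
  \<open>y\<close>.\<close>

lemma commutator:
  fixes p :: "real ^ 2 \<Rightarrow> complex" and b :: "real ^ 2 \<Rightarrow> real ^ 2 \<Rightarrow> real"
  assumes y: "y \<in> W" and p: "smooth_on W p"
    and b: "\<And>z u v a a'. z \<in> W \<Longrightarrow> b z (a *\<^sub>R u + a' *\<^sub>R v) = a * b z u + a' * b z v"
    and bd: "\<And>v. (\<lambda>z. b z v) differentiable (at y)"
  defines "N \<equiv> \<lambda>e z. frechet_derivative p (at z) (e z) + \<i> * of_real (b z (e z)) * p z"
  shows "frechet_derivative (N e2) (at y) (e1 y) - frechet_derivative (N e1) (at y) (e2 y)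
      + \<i> * of_real (b y (e1 y)) * N e2 y - \<i> * of_real (b y (e2 y)) * N e1 y =
    - of_real (om y (e1 y)) * N e1 y - of_real (om y (e2 y)) * N e2 y
      + \<i> * of_real (frechet_derivative (\<lambda>z. b z (e2 y)) (at y) (e1 y) - frechet_derivative (\<lambda>z. b z (e1 y)) (at y) (e2 y)) * p y"
    and "N e1 differentiable (at y)" "N e2 differentiable (at y)"
proof -
  define \<beta> where "\<beta> z v = frechet_derivative p (at z) v + \<i> * of_real (b z v) * p z" for z v
  have lin: "\<beta> z (a *\<^sub>R u + a' *\<^sub>R v) = a *\<^sub>R \<beta> z u + a' *\<^sub>R \<beta> z v" if "z \<in> W" for z a u a' v
  proof -
    note l = linear_frechet_derivative[OF smooth_on_differentiable[OF p that]]
    show ?thesis unfolding \<beta>_def b[OF that] linear_add[OF l] linear_scale[OF l]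
      by (simp add: scaleR_conv_of_real algebra_simps)
  qed
  have lin2: "linear (\<beta> z)" if "z \<in> W" for z
    by (rule linearI) (use lin[OF that, of 1 _ 1] lin[OF that, of _ _ 0 0] in simp_all)
  have h: "((\<lambda>z. \<beta> z v) has_derivative (\<lambda>w. frechet_derivative (\<lambda>z. frechet_derivative p (at z) v) (at y) w
      + (\<i> * of_real (b y v) * frechet_derivative p (at y) w + \<i> * of_real (frechet_derivative (\<lambda>z. b z v) (at y) w) * p y))) (at y)" for v
    unfolding \<beta>_def
    by (intro has_derivative_add has_derivative_mult has_derivative_mult_right has_derivative_of_real
        differentiable_has_derivative[OF bd] differentiable_has_derivative[OF smooth_on_differentiable[OF p y]]
        differentiable_has_derivative[OF smooth_on_differentiable[OF smooth_on_frechet_derivative[OF p] y]])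
  have d\<beta>: "(\<lambda>z. \<beta> z v) differentiable (at y)" for v using h by (rule differentiableI)
  have f: "frechet_derivative (\<lambda>z. \<beta> z (V z)) (at y) w = frechet_derivative (\<lambda>z. \<beta> z (V y)) (at y) w + \<beta> y (frechet_derivative V (at y) w)"
    "(\<lambda>z. \<beta> z (V z)) differentiable (at y)" if V: "V differentiable (at y)" for V w
    by (rule frechet_derivative_linear_form(1)[OF W y _ d\<beta> V], erule lin2)
      (rule frechet_derivative_linear_form(2)[OF W y _ d\<beta> V], erule lin2)
  note f1 = f[OF e_diff(1)[OF y]] and f2 = f[OF e_diff(2)[OF y]]
  have N: "N e = (\<lambda>z. \<beta> z (e z))" for e by (simp add: N_def \<beta>_def)
  show "N e1 differentiable (at y)" "N e2 differentiable (at y)" unfolding N using f1(2) f2(2) by simp_all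
  have br: "\<beta> y (frechet_derivative e2 (at y) (e1 y)) - \<beta> y (frechet_derivative e1 (at y) (e2 y)) =
    - of_real (om y (e1 y)) * \<beta> y (e1 y) - of_real (om y (e2 y)) * \<beta> y (e2 y)"
  proof -
    have "\<beta> y (frechet_derivative e2 (at y) (e1 y)) - \<beta> y (frechet_derivative e1 (at y) (e2 y)) =
      \<beta> y (1 *\<^sub>R frechet_derivative e2 (at y) (e1 y) + (-1) *\<^sub>R frechet_derivative e1 (at y) (e2 y))"
      unfolding lin[OF y] by simp
    also have "1 *\<^sub>R frechet_derivative e2 (at y) (e1 y) + (-1) *\<^sub>R frechet_derivative e1 (at y) (e2 y) =
      (- om y (e1 y)) *\<^sub>R e1 y + (- om y (e2 y)) *\<^sub>R e2 y"
      using frame_bracket[OF y] by simp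
    finally show ?thesis unfolding lin[OF y] by (simp add: scaleR_conv_of_real)
  qed
  have D: "frechet_derivative (\<lambda>z. \<beta> z v) (at y) w = frechet_derivative (\<lambda>z. frechet_derivative p (at z) v) (at y) w
      + (\<i> * of_real (b y v) * frechet_derivative p (at y) w + \<i> * of_real (frechet_derivative (\<lambda>z. b z v) (at y) w) * p y)" for v w
    using frechet_derivative_eqI[OF h[of v]] by (rule fun_cong)
  note sym = frechet_derivative_symmetric[OF W y p, of "e1 y" "e2 y"]
  show "frechet_derivative (N e2) (at y) (e1 y) - frechet_derivative (N e1) (at y) (e2 y)
      + \<i> * of_real (b y (e1 y)) * N e2 y - \<i> * of_real (b y (e2 y)) * N e1 y =
    - of_real (om y (e1 y)) * N e1 y - of_real (om y (e2 y)) * N e2 y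
      + \<i> * of_real (frechet_derivative (\<lambda>z. b z (e2 y)) (at y) (e1 y) - frechet_derivative (\<lambda>z. b z (e1 y)) (at y) (e2 y)) * p y"
  proof -
    have 1: "frechet_derivative (N e2) (at y) (e1 y) - frechet_derivative (N e1) (at y) (e2 y) =
      (frechet_derivative (\<lambda>z. \<beta> z (e2 y)) (at y) (e1 y) - frechet_derivative (\<lambda>z. \<beta> z (e1 y)) (at y) (e2 y))
      + (\<beta> y (frechet_derivative e2 (at y) (e1 y)) - \<beta> y (frechet_derivative e1 (at y) (e2 y)))"
      unfolding N f1(1) f2(1) by simp
    have 2: "frechet_derivative (\<lambda>z. \<beta> z (e2 y)) (at y) (e1 y) - frechet_derivative (\<lambda>z. \<beta> z (e1 y)) (at y) (e2 y)
       + \<i> * of_real (b y (e1 y)) * \<beta> y (e2 y) - \<i> * of_real (b y (e2 y)) * \<beta> y (e1 y) =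
       \<i> * of_real (frechet_derivative (\<lambda>z. b z (e2 y)) (at y) (e1 y) - frechet_derivative (\<lambda>z. b z (e1 y)) (at y) (e2 y)) * p y"
      unfolding D sym unfolding \<beta>_def by (simp add: algebra_simps)
    show ?thesis unfolding 1 unfolding br 2[symmetric] N by (simp add: algebra_simps)
  qed
qed

end

section \<open>Gradient, Laplacian and curvatures in the local section\<close>

context spinc_local
begin

lemma tdiff_chart:
  assumes y: "y \<in> W" and X: "X \<in> tangent_space AM (chart_inv c y)"
    and F: "(\<lambda>z. F (chart_inv c z)) differentiable (at y)"
  shows "tdiff AM F (chart_inv c y) X = frechet_derivative (\<lambda>z. F (chart_inv c z)) (at y) (X c)"
proof -
  note MA = atlases(1)
  have "dif_fun AM F (chart_inv c y)"
    unfolding dif_fun_def using chart_W(4)[OF y] F chart_W(3)[OF y] by (intro bexI[of _ c]) simp_all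
  from tdiff_vel(1)[OF MA this dif_par_chart_inv(1)[OF MA c chart_W(1)[OF y]], of "X c"]
  show ?thesis
    using tangent_vector_eq_vel[OF MA X chart_W(4)[OF y]] unfolding chart_W(3)[OF y] by simp
qed

lemma fr_tangent: "y \<in> W \<Longrightarrow> theta_frame S (sec y) i \<in> tangent_space AM (chart_inv c y)"
  using theta_frame_tangent[of "sec y" i] by (simp add: sec_proj)

lemma grad_local:
  assumes y: "y \<in> W" and F: "(\<lambda>z. F (chart_inv c z)) differentiable (at y)"
  shows "grad AM (metric S) F (chart_inv c y) c =
    frechet_derivative (\<lambda>z. F (chart_inv c z)) (at y) (fr1 y) *\<^sub>R fr1 y + frechet_derivative (\<lambda>z. F (chart_inv c z)) (at y) (fr2 y) *\<^sub>R fr2 y"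
proof -
  note MA = atlases(1)
  let ?x = "chart_inv c y" and ?D = "frechet_derivative (\<lambda>z. F (chart_inv c z)) (at y)"
  define v0 where "v0 = vel AM (chart_inv c) y (?D (fr1 y) *\<^sub>R fr1 y + ?D (fr2 y) *\<^sub>R fr2 y)"
  have v0t: "v0 \<in> tangent_space AM ?x" unfolding v0_def
    by (rule vel_in_tangent_space[OF MA dif_par_chart_inv(1)[OF MA c chart_W(1)[OF y]]])
  have v0c: "v0 c = ?D (fr1 y) *\<^sub>R fr1 y + ?D (fr2 y) *\<^sub>R fr2 y"
    unfolding v0_def by (rule dif_par_chart_inv(3)[OF MA c chart_W(1)[OF y]])
  have m: "metric S ?x u v = gm y (u c) (v c)" if "u \<in> tangent_space AM ?x" "v \<in> tangent_space AM ?x" for u v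
    using metric_coordinates[OF c chart_W(1)[OF y] that] by (simp add: gm_def)
  have lD: "linear ?D" by (rule linear_frechet_derivative[OF F])
  have v0g: "metric S ?x v0 w = tdiff AM F ?x w" if w: "w \<in> tangent_space AM ?x" for w
  proof -
    have "?D (w c) = ?D (gm y (w c) (fr1 y) *\<^sub>R fr1 y + gm y (w c) (fr2 y) *\<^sub>R fr2 y)"
      using frame_expand[OF y, of "w c"] by simp
    also have "\<dots> = gm y (w c) (fr1 y) * ?D (fr1 y) + gm y (w c) (fr2 y) * ?D (fr2 y)"
      by (simp add: linear_add[OF lD] linear_scale[OF lD])
    finally show ?thesis
      unfolding m[OF v0t w] tdiff_chart[OF y w F] v0c gm_add gm_sym[OF y, of "w c"] by simp
  qed
  have "grad AM (metric S) F ?x = v0" unfolding grad_def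
  proof (rule the_equality)
    show "v0 \<in> tangent_space AM ?x \<and> (\<forall>w\<in>tangent_space AM ?x. metric S ?x v0 w = tdiff AM F ?x w)"
      using v0t v0g by blast
    fix v assume v: "v \<in> tangent_space AM ?x \<and> (\<forall>w\<in>tangent_space AM ?x. metric S ?x v w = tdiff AM F ?x w)"
    then have vt: "v \<in> tangent_space AM ?x" by blast
    have "gm y (v c) (theta_frame S (sec y) i c) = gm y (v0 c) (theta_frame S (sec y) i c)" for i
      using bspec[OF conjunct2[OF v] fr_tangent[OF y]] v0g[OF fr_tangent[OF y]] m[OF vt fr_tangent[OF y]] m[OF v0t fr_tangent[OF y]]
      by simp
    then have "v c = v0 c" using frame_expand[OF y, of "v c"] frame_expand[OF y, of "v0 c"] by simp
    then show "v = v0" by (rule tangent_space_eqI[OF MA vt v0t chart_W(4)[OF y]])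
  qed
  then show ?thesis using v0c by simp
qed

text \<open>The divergence is the trace of \<open>nab\<close> on the gradient field, taken in the
  frame; the terms with \<open>om\<close> arise where the frame fields are differentiated. The
  hypothesis \<open>cx\<close> selects the chart in which \<open>divergence\<close> is
  evaluated.\<close>

lemma laplacian_local:
  assumes V: "open V" "V \<subseteq> W" "y \<in> V" and cx: "c = chart_at AM (chart_inv c y)"
    and F: "\<And>z. z \<in> V \<Longrightarrow> (\<lambda>z. F (chart_inv c z)) differentiable (at z)"
    and f1: "\<And>z. z \<in> V \<Longrightarrow> frechet_derivative (\<lambda>z. F (chart_inv c z)) (at z) (fr1 z) = f1 z" "f1 differentiable (at y)"
    and f2: "\<And>z. z \<in> V \<Longrightarrow> frechet_derivative (\<lambda>z. F (chart_inv c z)) (at z) (fr2 z) = f2 z" "f2 differentiable (at y)"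
  shows "laplacian AM (metric S) F (chart_inv c y) =
    - (frechet_derivative f1 (at y) (fr1 y) + frechet_derivative f2 (at y) (fr2 y) + om y (fr2 y) * f1 y - om y (fr1 y) * f2 y)"
proof -
  note MA = atlases(1)
  let ?x = "chart_inv c y" and ?G = "grad AM (metric S) F"
  have y: "y \<in> W" using V by blast
  let ?X = "\<lambda>z. f1 z *\<^sub>R fr1 z + f2 z *\<^sub>R fr2 z"
  have G: "?G (chart_inv c z) c = ?X z" if "z \<in> V" for z
    using grad_local[OF subsetD[OF V(2) that] F[OF that]] f1(1)[OF that] f2(1)[OF that] by simp
  have ev: "\<forall>\<^sub>F z in nhds y. ?G (chart_inv c z) c = ?X z" by (rule eventually_nhds_open_vimage[OF V(1,3) G])
  note dX = has_derivative_add[OF has_derivative_scaleR[OF differentiable_has_derivative[OF f1(2)] differentiable_has_derivative[OF e_diff(1)[OF y]]]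
      has_derivative_scaleR[OF differentiable_has_derivative[OF f2(2)] differentiable_has_derivative[OF e_diff(2)[OF y]]]]
  have dG: "dif_fun AM (\<lambda>p. ?G p c) ?x"
    unfolding dif_fun_def
  proof (rule bexI[OF _ chart_W(4)[OF y]])
    show "(\<lambda>z. ?G (chart_inv c z) c) differentiable (at (snd c ?x))"
      unfolding chart_W(3)[OF y] eventually_cong_derivative(1)[OF ev] using dX by (rule differentiableI)
  qed
  have dp: "dif_par AM (chart_inv c) y" by (rule dif_par_chart_inv(1)[OF MA c chart_W(1)[OF y]])
  have did: "dif_map AM AM (\<lambda>x. x) ?x"
    unfolding dif_map_def using chart_W(3,4)[OF y] dp by (intro bexI[of _ c]) simp_all
  have cd: "frechet_derivative (\<lambda>z. snd c (chart_inv c z)) (at y) w = w" for w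
    using dif_par_chart_inv(3)[OF MA c chart_W(1)[OF y], of w] chart_W(4)[OF y] by (simp add: vel_def)
  have cov: "cov_along AM AM (metric S) (\<lambda>x. x) ?G ?x (coord_vec AM c ?x w) c = nab ?X y w" for w
  proof -
    have "cov_along AM AM (metric S) (\<lambda>x. x) ?G ?x (vel AM (chart_inv c) y w) c =
      frechet_derivative (\<lambda>z. ?G (chart_inv c z) c) (at y) w + (\<chi> k. \<Sum>i\<in>UNIV. \<Sum>j\<in>UNIV. christoffel AM (metric S) c (snd c ?x) k i j *
         frechet_derivative (\<lambda>z. snd c (chart_inv c z)) (at y) w $ i * ?G ?x c $ j)"
      by (rule cov_along_vel[where E = ?G and h = "chart_inv c" and F = "\<lambda>x. x", OF MA MA did dp dG chart_W(4)[OF y]])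
    then show ?thesis
      unfolding dif_par_chart_inv(4)[OF MA c chart_W(1)[OF y]] eventually_cong_derivative(2)[OF ev] cd chart_W(3)[OF y]
        G[OF V(3)] christoffel_chr nab_def Gam_def .
  qed
  have nX: "nab ?X y w = (frechet_derivative f1 (at y) w - f2 y * om y w) *\<^sub>R fr1 y + (frechet_derivative f2 (at y) w + f1 y * om y w) *\<^sub>R fr2 y" for w
  proof -
    have "nab ?X y w = frechet_derivative f1 (at y) w *\<^sub>R fr1 y + f1 y *\<^sub>R nab fr1 y w + frechet_derivative f2 (at y) w *\<^sub>R fr2 y + f2 y *\<^sub>R nab fr2 y w"
      unfolding nab_def frechet_derivative_eqI[OF dX] Gam_right_linear by (simp add: algebra_simps)
    then show ?thesis unfolding nab_frame[OF y] by (simp add: algebra_simps)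
  qed
  have "?X differentiable (at y)" using dX by (rule differentiableI)
  then have lin: "linear (nab ?X y)"
    by (intro linearI) (use nab_linear[OF y, of ?X 1 _ 1] nab_linear[OF y, of ?X _ _ 0 0] in simp_all)
  have "divergence AM (metric S) ?G ?x = (\<Sum>i\<in>UNIV. nab ?X y (axis i 1) $ i)"
    unfolding divergence_def Let_def cx[symmetric] cov ..
  also have "\<dots> = gm y (nab ?X y (fr1 y)) (fr1 y) + gm y (nab ?X y (fr2 y)) (fr2 y)"
    by (rule trace_frame[OF y lin])
  also have "\<dots> = frechet_derivative f1 (at y) (fr1 y) - f2 y * om y (fr1 y) + (frechet_derivative f2 (at y) (fr2 y) + f1 y * om y (fr2 y))"
    unfolding nX gm_add gm_on[OF y] by simp
  finally show ?thesis unfolding laplacian_def by simp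
qed

lemma scalar_curvature_local:
  assumes y: "y \<in> W" and cx: "c = chart_at AM (chart_inv c y)"
  shows "scalar_curvature AM (metric S) (chart_inv c y) = - 2 * dom y (fr1 y) (fr2 y)"
proof -
  have "riemann AM (metric S) c y l k i j = riem y l k i j" for l k i j
    unfolding riemann_def riem_def Let_def christoffel_chr ..
  then show ?thesis
    unfolding scalar_curvature_def Let_def cx[symmetric] chart_W(3)[OF y] using scalar_curvature_frame[OF y] by simp
qed

text \<open>The section of the circle bundle projects to the inverse chart, so its velocities are
  pushed down to \<open>u\<close> and \<open>v\<close>. Pulling the curvature equation back along
  the section therefore gives an equation on the surface.\<close>

lemma con_curvature:
  assumes y: "y \<in> W" and \<Omega>: "curvature_form S \<Omega>" and u: "u \<in> tangent_space AM (chart_inv c y)" and v: "v \<in> tangent_space AM (chart_inv c y)"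
  shows "frechet_derivative (\<lambda>y. con y (v c)) (at y) (u c) - frechet_derivative (\<lambda>y. con y (u c)) (at y) (v c) = \<Omega> (chart_inv c y) u v"
proof -
  note MA = atlases(1) and QA = atlases(3)
  let ?h = "\<lambda>y. theta_circle S (sec y)"
  have hd: "dif_par AQ ?h y" by (rule smooth_into_dif_par[OF QA W(1) theta_sec_smooth y])
  have q: "Q_proj S (?h z) = chart_inv c z" if "z \<in> W" for z by (simp add: Q_proj_theta sec_proj[OF that])
  have push: "push AQ AM (Q_proj S) (?h y) (vel AQ ?h y (u c)) = u" if u: "u \<in> tangent_space AM (chart_inv c y)" for u
  proof -
    have "push AQ AM (Q_proj S) (?h y) (vel AQ ?h y (u c)) = vel AM (\<lambda>z. Q_proj S (?h z)) y (u c)"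
      by (rule push_vel[OF QA MA smooth_map_dif_map[OF QA MA Q_proj_smooth] hd])
    also have "\<dots> = vel AM (chart_inv c) y (u c)"
      by (rule dif_par_cong(2)[OF eventually_nhds_open_vimage[OF W(1) y q]])
    also have "\<dots> = u" using tangent_vector_eq_vel[OF MA u chart_W(4)[OF y]] unfolding chart_W(3)[OF y] by simp
    finally show ?thesis .
  qed
  have t: "vel AQ ?h y w \<in> tangent_space AQ (?h y)" for w by (rule vel_in_tangent_space[OF QA hd])
  have "ext_deriv AQ (conn S) (?h y) (vel AQ ?h y (u c)) (vel AQ ?h y (v c)) = \<i> * of_real (\<Omega> (Q_proj S (?h y))
      (push AQ AM (Q_proj S) (?h y) (vel AQ ?h y (u c))) (push AQ AM (Q_proj S) (?h y) (vel AQ ?h y (v c))))"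
    using \<Omega> t unfolding curvature_form_def by blast
  then show ?thesis unfolding con_local(2)[OF y] push[OF u] push[OF v] q[OF y] by simp
qed

lemma con_diff: "y \<in> W \<Longrightarrow> (\<lambda>z. con z v) differentiable (at y)"
proof -
  assume y: "y \<in> W"
  obtain N where "open N" "y \<in> N" "\<forall>w. smooth_on N (\<lambda>y. con y w)" using con_local(1)[OF y] by blast
  then show ?thesis using smooth_on_differentiable by blast
qed

end

section \<open>The Bochner formula\<close>

text \<open>Here \<open>n\<^sub>k\<close> and \<open>K\<^sub>k\<^sub>j\<close> are the two components of \<open>\<nabla>\<^sub>k \<phi>\<close> and of \<open>e\<^sub>k(\<nabla>\<^sub>j \<phi>)\<close>, \<open>E1\<close> and \<open>E2\<close> are the
  components of \<open>D\<^sup>2 \<phi> = L \<phi>\<close>, and \<open>C1\<close> and \<open>C2\<close> the commutators of the covariant derivatives.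
  The large sum in the conclusion is \<open>e\<^sub>1(Re (\<nabla>\<^sub>1 \<phi>, \<phi>)) + e\<^sub>2(Re (\<nabla>\<^sub>2 \<phi>, \<phi>))\<close>.\<close>

lemma dirac_sq_identity:
  fixes p m n1p n2p n1m n2m K11p K12p K21p K22p K11m K12m K21m K22m :: complex and L a1 a2 o1 o2 dp dm :: real
  assumes E1: "of_real L * p = \<i> * ((\<i> * K11p + K12p) + \<i> * of_real ((a1 - o1) / 2) * (\<i> * n1p + n2p))
      - ((\<i> * K21p + K22p) + \<i> * of_real ((a2 - o2) / 2) * (\<i> * n1p + n2p))"
    and E2: "of_real L * m = \<i> * ((\<i> * K11m - K12m) + \<i> * of_real ((a1 + o1) / 2) * (\<i> * n1m - n2m))
      + ((\<i> * K21m - K22m) + \<i> * of_real ((a2 + o2) / 2) * (\<i> * n1m - n2m))"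
    and C1: "K12p - K21p + \<i> * of_real ((a1 + o1) / 2) * n2p - \<i> * of_real ((a2 + o2) / 2) * n1p =
      - of_real o1 * n1p - of_real o2 * n2p + \<i> * of_real dp * p"
    and C2: "K12m - K21m + \<i> * of_real ((a1 - o1) / 2) * n2m - \<i> * of_real ((a2 - o2) / 2) * n1m =
      - of_real o1 * n1m - of_real o2 * n2m + \<i> * of_real dm * m"
  shows "L * (p \<bullet> p + m \<bullet> m) =
    - ((n1p \<bullet> (n1p - \<i> * of_real ((a1 + o1) / 2) * p) + K11p \<bullet> p + (n1m \<bullet> (n1m - \<i> * of_real ((a1 - o1) / 2) * m) + K11m \<bullet> m))
      + (n2p \<bullet> (n2p - \<i> * of_real ((a2 + o2) / 2) * p) + K22p \<bullet> p + (n2m \<bullet> (n2m - \<i> * of_real ((a2 - o2) / 2) * m) + K22m \<bullet> m)))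
    + (n1p \<bullet> n1p + n1m \<bullet> n1m + n2p \<bullet> n2p + n2m \<bullet> n2m)
    + o1 * (n2p \<bullet> p + n2m \<bullet> m) - o2 * (n1p \<bullet> p + n1m \<bullet> m) - dp * (p \<bullet> p) + dm * (m \<bullet> m)"
proof -
  have b: "of_real ((a + o') / 2) = (of_real ((a - o') / 2) + of_real o' :: complex)" for a o' :: real
    by (simp add: complex_eq_iff field_simps)
  define B1 B2 C1' C2' where "B1 = (a1 + o1) / 2" and "B2 = (a2 + o2) / 2" and "C1' = (a1 - o1) / 2" and "C2' = (a2 - o2) / 2"
  \<comment> \<open>Clifford multiplication swaps the two components, so the second derivative of
    each component carries the weight of the other one; the weights differ by
    \<open>\<omega>\<close>.\<close>
  have BC: "C1' = B1 - o1" "C2' = B2 - o2" by (simp_all add: B1_def B2_def C1'_def C2'_def field_simps)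
  note d = B1_def[symmetric] B2_def[symmetric] C1'_def[symmetric] C2'_def[symmetric]
  \<comment> \<open>The mixed derivatives enter only through their difference, which the commutator
    eliminates. The bracket terms and the shift of weight then combine to
    \<open>o1 * n2p - o2 * n1p\<close>, the connection term of the divergence.\<close>
  have k1: "K12p = K21p - \<i> * of_real B1 * n2p + \<i> * of_real B2 * n1p - of_real o1 * n1p - of_real o2 * n2p + \<i> * of_real dp * p"
    using C1 unfolding d by (simp add: algebra_simps)
  have k2: "K12m = K21m - \<i> * of_real C1' * n2m + \<i> * of_real C2' * n1m - of_real o1 * n1m - of_real o2 * n2m + \<i> * of_real dm * m"
    using C2 unfolding d by (simp add: algebra_simps)
  have A1: "of_real L * p = - (K11p + \<i> * of_real B1 * n1p + K22p + \<i> * of_real B2 * n2p) + of_real o1 * n2p - of_real o2 * n1p - of_real dp * p"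
    unfolding E1 d k1 BC by (simp add: algebra_simps)
  have A2: "of_real L * m = - (K11m + \<i> * of_real C1' * n1m + K22m + \<i> * of_real C2' * n2m) + of_real o1 * n2m - of_real o2 * n1m + of_real dm * m"
    unfolding E2 d k2 unfolding BC by (simp add: algebra_simps)
  have "L * (p \<bullet> p + m \<bullet> m) = (of_real L * p) \<bullet> p + (of_real L * m) \<bullet> m"
    by (simp add: inner_complex_def algebra_simps)
  also have "\<dots> = - ((n1p \<bullet> (n1p - \<i> * of_real B1 * p) + K11p \<bullet> p + (n1m \<bullet> (n1m - \<i> * of_real C1' * m) + K11m \<bullet> m))
      + (n2p \<bullet> (n2p - \<i> * of_real B2 * p) + K22p \<bullet> p + (n2m \<bullet> (n2m - \<i> * of_real C2' * m) + K22m \<bullet> m)))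
    + (n1p \<bullet> n1p + n1m \<bullet> n1m + n2p \<bullet> n2p + n2m \<bullet> n2m)
    + o1 * (n2p \<bullet> p + n2m \<bullet> m) - o2 * (n1p \<bullet> p + n1m \<bullet> m) - dp * (p \<bullet> p) + dm * (m \<bullet> m)"
    unfolding A1 A2 by (simp add: inner_complex_def algebra_simps)
  finally show ?thesis unfolding d .
qed

text \<open>Parseval's identity for the real orthogonal basis \<open>\<phi>, e\<^sub>1 \<cdot> \<phi>, e\<^sub>2 \<cdot> \<phi>, e\<^sub>1 \<cdot> e\<^sub>2 \<cdot> \<phi>\<close> of \<open>\<complex>\<^sup>2\<close>.\<close>

lemma clifford_frame_norm:
  fixes p m np nm :: complex
  shows "(p \<bullet> p + m \<bullet> m) * (np \<bullet> np + nm \<bullet> nm) =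
    (np \<bullet> p + nm \<bullet> m)\<^sup>2 + ((\<i> * nm) \<bullet> p + (\<i> * np) \<bullet> m)\<^sup>2 + (- nm \<bullet> p + np \<bullet> m)\<^sup>2 + (np \<bullet> (\<i> * p) - nm \<bullet> (\<i> * m))\<^sup>2"
  by (simp add: inner_complex_def power2_eq_square algebra_simps)

text \<open>The symmetric and skew parts of \<open>B\<close> have norms adding up to that of
  \<open>B\<close>. The quotient rule in the Laplacian yields \<open>2 |df|^2\<close>, and
  completing the square, \<open>|Y|^2 - 2 Y(f) = |Y - df|^2 - |df|^2\<close>, takes one of these
  away; the other is the component along the spinor in Parseval's identity.\<close>

lemma energy_momentum_identity:
  fixes p m n1p n2p n1m n2m :: complex and \<rho> :: real
  assumes \<rho>: "\<rho> = p \<bullet> p + m \<bullet> m" "\<rho> \<noteq> 0"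
    and g: "g1 = n1p \<bullet> p + n1m \<bullet> m" "g2 = n2p \<bullet> p + n2m \<bullet> m"
    and B: "B11 = (\<i> * n1m) \<bullet> p + (\<i> * n1p) \<bullet> m" "B12 = (\<i> * n2m) \<bullet> p + (\<i> * n2p) \<bullet> m"
      "B21 = - n1m \<bullet> p + n1p \<bullet> m" "B22 = - n2m \<bullet> p + n2p \<bullet> m"
    and Y: "Y1 = (\<i> * n1m - n2m) \<bullet> (\<i> * m) + (\<i> * n1p + n2p) \<bullet> (\<i> * p)"
      "Y2 = (\<i> * n1m - n2m) \<bullet> (- m) + (\<i> * n1p + n2p) \<bullet> p"
    and L: "L * \<rho> = - (G11 + G22) + (n1p \<bullet> n1p + n1m \<bullet> n1m + n2p \<bullet> n2p + n2m \<bullet> n2m)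
      + o1 * g2 - o2 * g1 - (dc + do') / 2 * (p \<bullet> p) + (dc - do') / 2 * (m \<bullet> m)"
  shows "L = - 2 * do' / 4
    + (((B11 + B11) / (2 * \<rho>))\<^sup>2 + ((B12 + B21) / (2 * \<rho>))\<^sup>2 + (((B21 + B12) / (2 * \<rho>))\<^sup>2 + ((B22 + B22) / (2 * \<rho>))\<^sup>2))
    + (((B11 - B11) / (2 * \<rho>))\<^sup>2 + ((B12 - B21) / (2 * \<rho>))\<^sup>2 + (((B21 - B12) / (2 * \<rho>))\<^sup>2 + ((B22 - B22) / (2 * \<rho>))\<^sup>2))
    + - ((G11 * \<rho> - g1 * (2 * g1)) / \<rho>\<^sup>2 + (G22 * \<rho> - g2 * (2 * g2)) / \<rho>\<^sup>2 + o2 * (g1 / \<rho>) - o1 * (g2 / \<rho>))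
    + ((Y1 / \<rho>)\<^sup>2 + (Y2 / \<rho>)\<^sup>2) - 2 * (Y1 / \<rho> * (g1 / \<rho>) + Y2 / \<rho> * (g2 / \<rho>))
    - dc / 2 * (p \<bullet> p - m \<bullet> m) / \<rho>" (is "L = ?R")
proof -
  define n where "n = n1p \<bullet> n1p + n1m \<bullet> n1m + n2p \<bullet> n2p + n2m \<bullet> n2m"
  define b1 b2 where "b1 = n1p \<bullet> (\<i> * p) - n1m \<bullet> (\<i> * m)" and "b2 = n2p \<bullet> (\<i> * p) - n2m \<bullet> (\<i> * m)"
  \<comment> \<open>In the product of \<open>D\<psi>\<close> with
    \<open>e\<^sub>j \<cdot> \<psi>\<close>, the term of the Dirac sum with index \<open>j\<close>
    gives the derivative of the norm, the other term a component along
    \<open>e\<^sub>1 \<cdot> e\<^sub>2 \<cdot> \<psi>\<close>.\<close>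
  have Y': "Y1 = g1 + b2" "Y2 = g2 - b1"
    unfolding Y g b1_def b2_def by (simp_all add: inner_complex_def algebra_simps)
  have n: "\<rho> * n = g1\<^sup>2 + B11\<^sup>2 + B21\<^sup>2 + b1\<^sup>2 + (g2\<^sup>2 + B12\<^sup>2 + B22\<^sup>2 + b2\<^sup>2)"
    using clifford_frame_norm[of p m n1p n1m] clifford_frame_norm[of p m n2p n2m]
    unfolding n_def \<rho>(1) g B b1_def b2_def by (simp add: algebra_simps)
  have pm: "- (dc + do') / 2 * (p \<bullet> p) + (dc - do') / 2 * (m \<bullet> m) = - do' / 2 * \<rho> - dc / 2 * (p \<bullet> p - m \<bullet> m)"
    unfolding \<rho>(1) by (simp add: field_simps)
  have "?R * \<rho>\<^sup>2 = - do' / 2 * \<rho>\<^sup>2 + (B11\<^sup>2 + B12\<^sup>2 + B21\<^sup>2 + B22\<^sup>2)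
     - (G11 * \<rho> - g1 * (2 * g1)) - (G22 * \<rho> - g2 * (2 * g2)) - o2 * g1 * \<rho> + o1 * g2 * \<rho>
     + Y1\<^sup>2 + Y2\<^sup>2 - 2 * (Y1 * g1 + Y2 * g2) - dc / 2 * (p \<bullet> p - m \<bullet> m) * \<rho>"
    using \<rho>(2) by (simp add: power2_eq_square field_simps)
  also have "\<dots> = \<rho> * (- (G11 + G22) + n + o1 * g2 - o2 * g1 + (- do' / 2 * \<rho> - dc / 2 * (p \<bullet> p - m \<bullet> m)))"
    unfolding Y' using n by (simp add: power2_eq_square algebra_simps)
  also have "\<dots> = \<rho> * (L * \<rho>)" unfolding L pm[symmetric] n_def by (simp add: field_simps)
  finally have "?R * \<rho>\<^sup>2 = L * \<rho>\<^sup>2" by (simp add: power2_eq_square algebra_simps)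
  then show ?thesis using \<rho>(2) by simp
qed

lemma Re_hermitian: "Re (hermitian \<sigma> \<tau>) = \<sigma> $ 1 \<bullet> \<tau> $ 1 + \<sigma> $ 2 \<bullet> \<tau> $ 2"
  by (simp add: hermitian_sum inner_complex_def)

lemma hermitian_linear:
  "hermitian (\<sigma> + \<sigma>') \<tau> = hermitian \<sigma> \<tau> + hermitian \<sigma>' \<tau>"
  "hermitian (a *s \<sigma>) \<tau> = a * hermitian \<sigma> \<tau>"
  "hermitian \<sigma> (a *s \<tau>) = cnj a * hermitian \<sigma> \<tau>"
  by (simp_all add: hermitian_sum algebra_simps)

lemma cl_axis:
  "cl (axis 1 1) *v \<sigma> = vector [\<i> * \<sigma> $ 2, \<i> * \<sigma> $ 1]" "cl (axis 2 1) *v \<sigma> = vector [- \<sigma> $ 2, \<sigma> $ 1]"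
  by (simp_all add: vec2_eq_iff matrix2_vector_nth axis_def complex_eq_iff)

context spinc
begin

text \<open>The frame at \<open>x\<close> chosen by \<open>on_frame\<close> is the one of some point of the \<open>Spin\<^sup>c\<close> bundle because the
  fibres of the double covering have two points.\<close>

lemma on_frame_lift:
  obtains p where "P_proj S p = x" "theta_frame S p = on_frame S x"
proof -
  obtain U \<tau> where U: "x \<in> U" "P_triv U \<tau>" using P_trivialization by blast
  have "(x, mat 1) \<in> U \<times> spinc2" using U(1) tor_in_spinc2[of 0 0] by (simp add: tor_zero)
  then have "(x, mat 1) \<in> (\<lambda>p. (P_proj S p, \<tau> p)) ` (P_proj S -` U)"
    using bij_betw_imp_surj_on[OF P_trivD(2)[OF U(2)]] by simp
  then obtain p' where p': "P_proj S p' = x" by auto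
  have e: "on_frame S x \<in> so_frames S x"
    unfolding on_frame_def using theta_frame_in[of p'] unfolding p'
    by (rule someI[where P = "\<lambda>e. e \<in> so_frames S x"])
  have q: "Q_proj S (theta_circle S p') = x" unfolding Q_proj_theta p' ..
  have "\<forall>q. \<forall>e\<in>so_frames S (Q_proj S q). card {p. theta_frame S p = e \<and> theta_circle S p = q} = 2"
    using double_covering unfolding double_covering_def by blast
  then have "card {p. theta_frame S p = on_frame S x \<and> theta_circle S p = theta_circle S p'} = 2"
    using e q by simp
  then have "{p. theta_frame S p = on_frame S x \<and> theta_circle S p = theta_circle S p'} \<noteq> {}" by (intro notI) simp
  then obtain p where p: "theta_frame S p = on_frame S x" "theta_circle S p = theta_circle S p'" by blast
  have "P_proj S p = x" using Q_proj_theta[of p] Q_proj_theta[of p'] p(2) p' by simp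
  then show thesis using p(1) by (rule that)
qed

end

lemma ln_inner_derivative:
  fixes \<rho> :: "'e::real_normed_vector \<Rightarrow> real"
  assumes "(\<rho> has_derivative \<rho>') (at z)" "\<rho> z > 0"
  shows "((\<lambda>z. 1 / 2 * ln (\<rho> z)) has_derivative (\<lambda>w. \<rho>' w / (2 * \<rho> z))) (at z)"
proof -
  have "(ln has_derivative (\<lambda>h. inverse (\<rho> z) * h)) (at (\<rho> z))"
    using DERIV_ln[OF assms(2)] by (simp add: has_field_derivative_def)
  from has_derivative_mult_right[OF has_derivative_compose[OF assms(1) this], of "1 / 2"]
  show ?thesis by (rule has_derivative_eq_rhs) (use assms(2) in \<open>simp add: fun_eq_iff field_simps\<close>)
qed

section \<open>The formula at one point\<close>

context spinc_local
begin

text \<open>The hypotheses \<open>cx\<close> and \<open>frame\<close> align the parametrization with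
  the chart and the frame that the definitions select at the point. They are arranged for each point
  separately.\<close>

lemma bochner_at:
  assumes y: "y \<in> W" and cx: "c = chart_at AM (chart_inv c y)"
    and frame: "theta_frame S (sec y) = on_frame S (chart_inv c y)"
    and \<Omega>: "curvature_form S \<Omega>" and eig: "eigenspinor_dirac_sq S \<psi> L"
    and f: "\<And>x. sp_norm2 (\<psi> x) \<noteq> 0 \<Longrightarrow> f x = 1 / 2 * ln (sp_norm2 (\<psi> x))"
    and Yt: "Y (chart_inv c y) \<in> tangent_space AM (chart_inv c y)"
    and Y: "\<And>Z. Z \<in> tangent_space AM (chart_inv c y) \<Longrightarrow> metric S (chart_inv c y) (Y (chart_inv c y)) Z =
       1 / sp_norm2 (\<psi> (chart_inv c y)) * Re (sp_herm (dirac S \<psi> (chart_inv c y)) (cliff S Z (\<psi> (chart_inv c y))))"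
    and nz: "sp_norm2 (\<psi> (chart_inv c y)) \<noteq> 0"
  shows "complex_of_real L =
      of_real (scalar_curvature AM (metric S) (chart_inv c y) / 4
        + tensor_norm2 S (T_tensor S \<psi>) (chart_inv c y) + tensor_norm2 S (Q_tensor S \<psi>) (chart_inv c y)
        + laplacian AM (metric S) f (chart_inv c y)
        + metric S (chart_inv c y) (Y (chart_inv c y)) (Y (chart_inv c y)) - 2 * tdiff AM f (chart_inv c y) (Y (chart_inv c y)))
      + sp_herm (sp_scale (\<i> / 2) (cliff_form2 S \<Omega> (chart_inv c y) (\<psi> (chart_inv c y)))) (sp_div_norm2 (\<psi> (chart_inv c y)))"
proof -
  let ?x = "chart_inv c y"
  define \<phi> where "\<phi> z = sp_comp (sec z) (\<psi> (chart_inv c z))" for z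
  have fib: "\<psi> x \<in> spinor_fibre S x" for x
    using eig unfolding eigenspinor_dirac_sq_def smooth_spinor_field_def by blast
  have rep: "\<psi> (chart_inv c z) = spinor_class S (sec z) (\<phi> z)" if z: "z \<in> W" for z
    unfolding \<phi>_def by (rule spinor_fibre_class) (use fib[of "chart_inv c z"] sec_proj[OF z] in simp)
  have s\<phi>: "smooth_on W \<phi>"
  proof -
    have "smooth_fun AP UNIV (\<lambda>p. sp_comp p (\<psi> (P_proj S p)))"
      using eig unfolding eigenspinor_dirac_sq_def smooth_spinor_field_def by blast
    from smooth_fun_comp_into[OF atlases(2) open_UNIV this W(1) sec_smooth]
    have "smooth_on W (\<lambda>z. sp_comp (sec z) (\<psi> (P_proj S (sec z))))" by simp
    then show ?thesis by (subst smooth_on_cong[OF W(1)]) (simp_all add: \<phi>_def sec_proj)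
  qed
  have d\<phi>: "\<phi> differentiable (at z)" if "z \<in> W" for z by (rule smooth_on_differentiable[OF s\<phi> that])
  define P M where "P z = \<phi> z $ 1" and "M z = \<phi> z $ 2" for z
  have sP: "smooth_on W P" and sM: "smooth_on W M"
    unfolding P_def M_def by (rule smooth_on_vec_nth[OF W(1) s\<phi>])+
  define bp bm where "bp z v = (con z v + om z v) / 2" and "bm z v = (con z v - om z v) / 2" for z v
  have blin: "bp z (a *\<^sub>R u + a' *\<^sub>R v) = a * bp z u + a' * bp z v" "bm z (a *\<^sub>R u + a' *\<^sub>R v) = a * bm z u + a' * bm z v"
    if "z \<in> W" for z a u a' v
    unfolding bp_def bm_def con_linear[OF that] om_linear[OF that] by (simp_all add: field_simps)
  have cd: "((\<lambda>z. con z v) has_derivative frechet_derivative (\<lambda>z. con z v) (at y)) (at y)"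
    "((\<lambda>z. om z v) has_derivative frechet_derivative (\<lambda>z. om z v) (at y)) (at y)" for v
    by (intro differentiable_has_derivative con_diff[OF y] om_diff[OF y])+
  have bD: "((\<lambda>z. bp z v) has_derivative (\<lambda>w. (frechet_derivative (\<lambda>z. con z v) (at y) w + frechet_derivative (\<lambda>z. om z v) (at y) w) / 2)) (at y)"
    "((\<lambda>z. bm z v) has_derivative (\<lambda>w. (frechet_derivative (\<lambda>z. con z v) (at y) w - frechet_derivative (\<lambda>z. om z v) (at y) w) / 2)) (at y)" for v
    unfolding bp_def bm_def divide_inverse
    by (intro has_derivative_mult_left has_derivative_add has_derivative_diff cd)+
  have bd: "(\<lambda>z. bp z v) differentiable (at y)" "(\<lambda>z. bm z v) differentiable (at y)" for v
    using bD by (blast intro: differentiableI)+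
  define NP where "NP e z = frechet_derivative P (at z) (e z) + \<i> * of_real (bp z (e z)) * P z" for e z
  define NM where "NM e z = frechet_derivative M (at z) (e z) + \<i> * of_real (bm z (e z)) * M z" for e z
  have NPe: "NP = (\<lambda>e z. frechet_derivative P (at z) (e z) + \<i> * of_real (bp z (e z)) * P z)"
    and NMe: "NM = (\<lambda>e z. frechet_derivative M (at z) (e z) + \<i> * of_real (bm z (e z)) * M z)"
    by (simp_all only: NP_def NM_def fun_eq_iff) simp_all
  have CP: "frechet_derivative (NP fr2) (at y) (fr1 y) - frechet_derivative (NP fr1) (at y) (fr2 y)
      + \<i> * of_real (bp y (fr1 y)) * NP fr2 y - \<i> * of_real (bp y (fr2 y)) * NP fr1 y =
    - of_real (om y (fr1 y)) * NP fr1 y - of_real (om y (fr2 y)) * NP fr2 y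
      + \<i> * of_real (frechet_derivative (\<lambda>z. bp z (fr2 y)) (at y) (fr1 y) - frechet_derivative (\<lambda>z. bp z (fr1 y)) (at y) (fr2 y)) * P y"
    "NP fr1 differentiable (at y)" "NP fr2 differentiable (at y)"
    unfolding NPe by (rule commutator[where b = bp and p = P, OF y sP blin(1) bd(1)], assumption)+
  have CM: "frechet_derivative (NM fr2) (at y) (fr1 y) - frechet_derivative (NM fr1) (at y) (fr2 y)
      + \<i> * of_real (bm y (fr1 y)) * NM fr2 y - \<i> * of_real (bm y (fr2 y)) * NM fr1 y =
    - of_real (om y (fr1 y)) * NM fr1 y - of_real (om y (fr2 y)) * NM fr2 y
      + \<i> * of_real (frechet_derivative (\<lambda>z. bm z (fr2 y)) (at y) (fr1 y) - frechet_derivative (\<lambda>z. bm z (fr1 y)) (at y) (fr2 y)) * M y"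
    "NM fr1 differentiable (at y)" "NM fr2 differentiable (at y)"
    unfolding NMe by (rule commutator[where b = bm and p = M, OF y sM blin(2) bd(2)], assumption)+
  have Dn1: "Dn \<phi> z (e z) $ 1 = NP e z" "Dn \<phi> z (e z) $ 2 = NM e z" if z: "z \<in> W" for z e
    using frechet_derivative_vec_nth(1)[OF d\<phi>[OF z]]
    unfolding Dn_def NP_def NM_def P_def M_def bp_def bm_def by simp_all
  define \<eta> where "\<eta> z = (vector [\<i> * NM fr1 z - NM fr2 z, \<i> * NP fr1 z + NP fr2 z] :: complex ^ 2)" for z
  have \<eta>: "Dop \<phi> z = \<eta> z" if "z \<in> W" for z
    unfolding Dop_def \<eta>_def Dn1[OF that, of fr1] Dn1[OF that, of fr2] ..
  have rep\<eta>: "dirac S \<psi> (chart_inv c z) = spinor_class S (sec z) (\<eta> z)" if z: "z \<in> W" for z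
    unfolding \<eta>[OF z, symmetric] by (rule dirac_class[OF rep z d\<phi>[OF z]])
  let ?e1 = "fr1 y" and ?e2 = "fr2 y"
  let ?D = "\<lambda>F. frechet_derivative F (at y)"
  have dNP: "NP fr1 differentiable (at y)" "NP fr2 differentiable (at y)" using CP(2,3) by simp_all
  have dNM: "NM fr1 differentiable (at y)" "NM fr2 differentiable (at y)" using CM(2,3) by simp_all
  have D\<eta>: "(\<eta> has_derivative (\<lambda>w. vector [\<i> * ?D (NM fr1) w - ?D (NM fr2) w, \<i> * ?D (NP fr1) w + ?D (NP fr2) w])) (at y)"
    unfolding \<eta>_def
    by (intro has_derivative_vector2 has_derivative_add has_derivative_diff has_derivative_mult_right
        differentiable_has_derivative dNP dNM)
  have "dirac S (dirac S \<psi>) ?x = spinor_class S (sec y) (Dop \<eta> y)"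
    by (rule dirac_class[OF rep\<eta> y differentiableI[OF D\<eta>]])
  moreover have "dirac S (dirac S \<psi>) ?x = spinor_class S (sec y) (of_real L *s \<phi> y)"
    using eig unfolding eigenspinor_dirac_sq_def by (simp add: rep[OF y] sp_scale_class)
  ultimately have eq: "of_real L *s \<phi> y = Dop \<eta> y" by (simp add: spinor_class_inject)
  have Dn\<eta>: "Dn \<eta> y w $ 1 = (\<i> * ?D (NM fr1) w - ?D (NM fr2) w) + \<i> * of_real (bp y w) * (\<i> * NM fr1 y - NM fr2 y)"
    "Dn \<eta> y w $ 2 = (\<i> * ?D (NP fr1) w + ?D (NP fr2) w) + \<i> * of_real (bm y w) * (\<i> * NP fr1 y + NP fr2 y)" for w
    unfolding Dn_def frechet_derivative_eqI[OF D\<eta>] bp_def bm_def by (simp_all add: \<eta>_def)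
  have E1: "of_real L * P y = \<i> * ((\<i> * ?D (NP fr1) ?e1 + ?D (NP fr2) ?e1) + \<i> * of_real (bm y ?e1) * (\<i> * NP fr1 y + NP fr2 y))
      - ((\<i> * ?D (NP fr1) ?e2 + ?D (NP fr2) ?e2) + \<i> * of_real (bm y ?e2) * (\<i> * NP fr1 y + NP fr2 y))"
    using arg_cong[OF eq, of "\<lambda>v. v $ 1"] unfolding Dop_def vector_2 Dn\<eta> by (simp add: P_def)
  have E2: "of_real L * M y = \<i> * ((\<i> * ?D (NM fr1) ?e1 - ?D (NM fr2) ?e1) + \<i> * of_real (bp y ?e1) * (\<i> * NM fr1 y - NM fr2 y))
      + ((\<i> * ?D (NM fr1) ?e2 - ?D (NM fr2) ?e2) + \<i> * of_real (bp y ?e2) * (\<i> * NM fr1 y - NM fr2 y))"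
    using arg_cong[OF eq, of "\<lambda>v. v $ 2"] unfolding Dop_def vector_2 Dn\<eta> by (simp add: M_def)
  have t: "theta_frame S (sec y) i \<in> tangent_space AM ?x" for i by (rule fr_tangent[OF y])
  define dc where "dc = \<Omega> ?x (theta_frame S (sec y) 1) (theta_frame S (sec y) 2)"
  define do' where "do' = dom y ?e1 ?e2"
  have dcon: "frechet_derivative (\<lambda>z. con z ?e2) (at y) ?e1 - frechet_derivative (\<lambda>z. con z ?e1) (at y) ?e2 = dc"
    unfolding dc_def by (rule con_curvature[OF y \<Omega> t t])
  have dbp: "?D (\<lambda>z. bp z ?e2) ?e1 - ?D (\<lambda>z. bp z ?e1) ?e2 = (dc + do') / 2"
    and dbm: "?D (\<lambda>z. bm z ?e2) ?e1 - ?D (\<lambda>z. bm z ?e1) ?e2 = (dc - do') / 2"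
    unfolding frechet_derivative_eqI[OF bD(1)] frechet_derivative_eqI[OF bD(2)] dcon[symmetric] do'_def dom_def
    by (simp_all add: field_simps)
  note main = dirac_sq_identity[OF E1[unfolded bm_def] E2[unfolded bp_def] CP(1)[unfolded dbp, unfolded bp_def] CM(1)[unfolded dbm, unfolded bm_def],
      folded bp_def bm_def]
  define \<rho> where "\<rho> z = P z \<bullet> P z + M z \<bullet> M z" for z
  have norm: "sp_norm2 (\<psi> (chart_inv c z)) = \<rho> z" if "z \<in> W" for z
    unfolding sp_norm2_def rep[OF that] sp_herm_class Re_hermitian \<rho>_def P_def M_def ..
  have \<rho>0: "\<rho> z \<ge> 0" for z unfolding \<rho>_def by simp
  have \<rho>y: "\<rho> y \<noteq> 0" using nz norm[OF y] by simp
  \<comment> \<open>\<open>f\<close> is prescribed only where the spinor does not vanish, so it is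
    differentiated on this open neighbourhood of \<open>y\<close>.\<close>
  define V where "V = W \<inter> \<rho> -` {0<..}"
  have dP: "(P has_derivative frechet_derivative P (at z)) (at z)" and dM: "(M has_derivative frechet_derivative M (at z)) (at z)" if "z \<in> W" for z
    by (intro differentiable_has_derivative smooth_on_differentiable[OF sP that] smooth_on_differentiable[OF sM that])+
  define g where "g e z = NP e z \<bullet> P z + NM e z \<bullet> M z" for e z
  have D\<rho>: "(\<rho> has_derivative (\<lambda>w. 2 * (frechet_derivative P (at z) w \<bullet> P z + frechet_derivative M (at z) w \<bullet> M z))) (at z)" if z: "z \<in> W" for z
    unfolding \<rho>_def
    by (rule has_derivative_eq_rhs[OF has_derivative_add[OF has_derivative_inner[OF dP[OF z] dP[OF z]] has_derivative_inner[OF dM[OF z] dM[OF z]]]])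
      (simp add: fun_eq_iff inner_commute)
  \<comment> \<open>The connection terms multiply the components by imaginary numbers and so vanish
    in the real inner product: the covariant derivative is metric.\<close>
  have g\<rho>: "frechet_derivative P (at z) (e z) \<bullet> P z + frechet_derivative M (at z) (e z) \<bullet> M z = g e z" for e z
    unfolding g_def NP_def NM_def by (simp add: inner_complex_def algebra_simps)
  have oV: "open V" unfolding V_def
    by (rule continuous_open_preimage[OF continuous_at_imp_continuous_on W(1) open_greaterThan])
      (use has_derivative_continuous[OF D\<rho>] in blast)
  have V: "V \<subseteq> W" "y \<in> V" "\<And>z. z \<in> V \<Longrightarrow> \<rho> z > 0"
    using y \<rho>y \<rho>0[of y] by (auto simp: V_def)
  have fV: "f (chart_inv c z) = 1 / 2 * ln (\<rho> z)" if "z \<in> V" for z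
    using f[of "chart_inv c z"] norm[of z] V(3)[OF that] V(1) that by auto
  have Df: "((\<lambda>z. f (chart_inv c z)) has_derivative (\<lambda>w. (frechet_derivative P (at z) w \<bullet> P z + frechet_derivative M (at z) w \<bullet> M z) / \<rho> z)) (at z)" if z: "z \<in> V" for z
  proof (rule has_derivative_transform_within_open[OF _ oV z])
    show "((\<lambda>z. 1 / 2 * ln (\<rho> z)) has_derivative (\<lambda>w. (frechet_derivative P (at z) w \<bullet> P z + frechet_derivative M (at z) w \<bullet> M z) / \<rho> z)) (at z)"
      by (rule has_derivative_eq_rhs[OF ln_inner_derivative[OF D\<rho>[OF subsetD[OF V(1) z]] V(3)[OF z]]]) (simp add: fun_eq_iff add_divide_distrib)
  qed (rule fV[symmetric])
  have Dfe: "frechet_derivative (\<lambda>z. f (chart_inv c z)) (at z) (e z) = g e z / \<rho> z" if z: "z \<in> V" for z e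
    unfolding frechet_derivative_eqI[OF Df[OF z]] g\<rho> ..
  have Dg: "((\<lambda>z. g e z) has_derivative (\<lambda>w. NP e y \<bullet> frechet_derivative P (at y) w + ?D (NP e) w \<bullet> P y
      + (NM e y \<bullet> frechet_derivative M (at y) w + ?D (NM e) w \<bullet> M y))) (at y)"
    if "NP e differentiable (at y)" "NM e differentiable (at y)" for e
    unfolding g_def
    by (intro has_derivative_add has_derivative_inner differentiable_has_derivative that dP[OF y] dM[OF y])
  have Dgr: "((\<lambda>z. g e z / \<rho> z) has_derivative (\<lambda>w. ((NP e y \<bullet> frechet_derivative P (at y) w + ?D (NP e) w \<bullet> P y
      + (NM e y \<bullet> frechet_derivative M (at y) w + ?D (NM e) w \<bullet> M y)) * \<rho> y
      - g e y * (2 * (frechet_derivative P (at y) w \<bullet> P y + frechet_derivative M (at y) w \<bullet> M y))) / (\<rho> y)\<^sup>2)) (at y)"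
    if "NP e differentiable (at y)" "NM e differentiable (at y)" for e
    by (rule has_derivative_eq_rhs[OF has_derivative_divide'[OF Dg[OF that] D\<rho>[OF y] \<rho>y]]) (simp add: fun_eq_iff power2_eq_square)
  define G11 where "G11 = NP fr1 y \<bullet> (NP fr1 y - \<i> * of_real (bp y ?e1) * P y) + ?D (NP fr1) ?e1 \<bullet> P y
      + (NM fr1 y \<bullet> (NM fr1 y - \<i> * of_real (bm y ?e1) * M y) + ?D (NM fr1) ?e1 \<bullet> M y)"
  define G22 where "G22 = NP fr2 y \<bullet> (NP fr2 y - \<i> * of_real (bp y ?e2) * P y) + ?D (NP fr2) ?e2 \<bullet> P y
      + (NM fr2 y \<bullet> (NM fr2 y - \<i> * of_real (bm y ?e2) * M y) + ?D (NM fr2) ?e2 \<bullet> M y)"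
  have DPe: "frechet_derivative P (at y) (e y) = NP e y - \<i> * of_real (bp y (e y)) * P y"
    "frechet_derivative M (at y) (e y) = NM e y - \<i> * of_real (bm y (e y)) * M y" for e
    unfolding NP_def NM_def by simp_all
  have Dgr1: "?D (\<lambda>z. g fr1 z / \<rho> z) ?e1 = (G11 * \<rho> y - g fr1 y * (2 * g fr1 y)) / (\<rho> y)\<^sup>2"
    unfolding frechet_derivative_eqI[OF Dgr[OF dNP(1) dNM(1)]] g\<rho>[of y fr1] unfolding G11_def DPe(1)[of fr1] DPe(2)[of fr1] ..
  have Dgr2: "?D (\<lambda>z. g fr2 z / \<rho> z) ?e2 = (G22 * \<rho> y - g fr2 y * (2 * g fr2 y)) / (\<rho> y)\<^sup>2"
    unfolding frechet_derivative_eqI[OF Dgr[OF dNP(2) dNM(2)]] g\<rho>[of y fr2] unfolding G22_def DPe(1)[of fr2] DPe(2)[of fr2] ..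
  have lap: "laplacian AM (metric S) f ?x = - ((G11 * \<rho> y - g fr1 y * (2 * g fr1 y)) / (\<rho> y)\<^sup>2 + (G22 * \<rho> y - g fr2 y * (2 * g fr2 y)) / (\<rho> y)\<^sup>2
      + om y ?e2 * (g fr1 y / \<rho> y) - om y ?e1 * (g fr2 y / \<rho> y))"
    unfolding Dgr1[symmetric] Dgr2[symmetric]
    by (rule laplacian_local[OF oV V(1,2) cx differentiableI[OF Df] Dfe differentiableI[OF Dgr[OF dNP(1) dNM(1)]]
        Dfe differentiableI[OF Dgr[OF dNP(2) dNM(2)]]])
  have scal: "scalar_curvature AM (metric S) ?x = - 2 * do'"
    unfolding do'_def by (rule scalar_curvature_local[OF y cx])
  have co: "coords (sec y) (theta_frame S (sec y) i) = axis i 1" for i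
    unfolding coords_def by (simp add: vec_eq_iff theta_frame_orthonormal axis_def)
  have nab: "nabla S \<psi> ?x (theta_frame S (sec y) i) = spinor_class S (sec y) (Dn \<phi> y (theta_frame S (sec y) i c))" for i
    by (rule nabla_class[OF _ y d\<phi>[OF y] t]) (rule rep)
  have cl: "cliff S (theta_frame S (sec y) i) (spinor_class S (sec y) \<sigma>) = spinor_class S (sec y) (cl (axis i 1) *v \<sigma>)" for i \<sigma>
    unfolding cliff_sec[OF y t] co ..
  have nrm: "sp_norm2 (\<psi> ?x) = \<rho> y" by (rule norm[OF y])
  define N where "N i = Dn \<phi> y (theta_frame S (sec y) i c)" for i
  define B where "B i j = Re (hermitian (cl (axis i 1) *v N j) (\<phi> y))" for i j
  have dn: "sp_div_norm2 (\<psi> ?x) = spinor_class S (sec y) (of_real (1 / \<rho> y) *s \<phi> y)"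
    unfolding sp_div_norm2_def nrm unfolding rep[OF y] sp_scale_class ..
  have TT: "T_tensor S \<psi> ?x (theta_frame S (sec y) i) (theta_frame S (sec y) j) = (B i j + B j i) / (2 * \<rho> y)" for i j
    unfolding T_tensor_def dn nab cl sp_add_class sp_scale_class sp_herm_class B_def N_def[symmetric] hermitian_linear
    by (simp add: add_divide_distrib)
  have QQ: "Q_tensor S \<psi> ?x (theta_frame S (sec y) i) (theta_frame S (sec y) j) = (B i j - B j i) / (2 * \<rho> y)" for i j
    unfolding Q_tensor_def dn nab cl sp_add_class sp_scale_class sp_herm_class B_def N_def[symmetric] hermitian_linear
    by (simp add: diff_divide_distrib)
  have N12: "N 1 $ 1 = NP fr1 y" "N 1 $ 2 = NM fr1 y" "N 2 $ 1 = NP fr2 y" "N 2 $ 2 = NM fr2 y"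
    unfolding N_def using Dn1[OF y, of fr1] Dn1[OF y, of fr2] by simp_all
  have B: "B 1 1 = (\<i> * NM fr1 y) \<bullet> P y + (\<i> * NP fr1 y) \<bullet> M y" "B 1 2 = (\<i> * NM fr2 y) \<bullet> P y + (\<i> * NP fr2 y) \<bullet> M y"
    "B 2 1 = - NM fr1 y \<bullet> P y + NP fr1 y \<bullet> M y" "B 2 2 = - NM fr2 y \<bullet> P y + NP fr2 y \<bullet> M y"
    unfolding B_def Re_hermitian cl_axis vector_2 N12 P_def M_def by (rule refl)+
  have T2: "tensor_norm2 S (T_tensor S \<psi>) ?x = ((B 1 1 + B 1 1) / (2 * \<rho> y))\<^sup>2 + ((B 1 2 + B 2 1) / (2 * \<rho> y))\<^sup>2
      + (((B 2 1 + B 1 2) / (2 * \<rho> y))\<^sup>2 + ((B 2 2 + B 2 2) / (2 * \<rho> y))\<^sup>2)"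
    unfolding tensor_norm2_def Let_def frame[symmetric] TT sum_2 ..
  have Q2: "tensor_norm2 S (Q_tensor S \<psi>) ?x = ((B 1 1 - B 1 1) / (2 * \<rho> y))\<^sup>2 + ((B 1 2 - B 2 1) / (2 * \<rho> y))\<^sup>2
      + (((B 2 1 - B 1 2) / (2 * \<rho> y))\<^sup>2 + ((B 2 2 - B 2 2) / (2 * \<rho> y))\<^sup>2)"
    unfolding tensor_norm2_def Let_def frame[symmetric] QQ sum_2 ..
  define Y1 Y2 where "Y1 = (\<i> * NM fr1 y - NM fr2 y) \<bullet> (\<i> * M y) + (\<i> * NP fr1 y + NP fr2 y) \<bullet> (\<i> * P y)"
    and "Y2 = (\<i> * NM fr1 y - NM fr2 y) \<bullet> (- M y) + (\<i> * NP fr1 y + NP fr2 y) \<bullet> P y"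
  have Yi: "gm y (Y ?x c) (theta_frame S (sec y) i c) = 1 / \<rho> y * Re (hermitian (\<eta> y) (cl (axis i 1) *v \<phi> y))" for i
    using Y[OF t, of i] metric_coordinates[OF c chart_W(1)[OF y] Yt t, of i]
    unfolding nrm unfolding rep\<eta>[OF y] rep[OF y] cl sp_herm_class gm_def by simp
  have Y12: "gm y (Y ?x c) ?e1 = Y1 / \<rho> y" "gm y (Y ?x c) ?e2 = Y2 / \<rho> y"
    unfolding Yi Re_hermitian cl_axis \<eta>_def vector_2 Y1_def Y2_def P_def M_def by simp_all
  have Yc: "Y ?x c = (Y1 / \<rho> y) *\<^sub>R ?e1 + (Y2 / \<rho> y) *\<^sub>R ?e2"
    unfolding Y12[symmetric] by (rule frame_expand[OF y])
  have YY: "metric S ?x (Y ?x) (Y ?x) = (Y1 / \<rho> y)\<^sup>2 + (Y2 / \<rho> y)\<^sup>2"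
    unfolding metric_coordinates[OF c chart_W(1)[OF y] Yt Yt] gm_def[symmetric]
    unfolding Yc gm_add gm_on[OF y] by (simp add: power2_eq_square)
  have Yf: "tdiff AM f ?x (Y ?x) = Y1 / \<rho> y * (g fr1 y / \<rho> y) + Y2 / \<rho> y * (g fr2 y / \<rho> y)"
  proof -
    note df = differentiableI[OF Df[OF V(2)]]
    note l = linear_frechet_derivative[OF df]
    show ?thesis unfolding tdiff_chart[OF y Yt df] Yc linear_add[OF l] linear_scale[OF l] Dfe[OF V(2), of fr1] Dfe[OF V(2), of fr2] by simp
  qed
  \<comment> \<open>The product \<open>e\<^sub>1 \<cdot> e\<^sub>2\<close> acts by the diagonal
    matrix with entries \<open>\<i>\<close> and \<open>- \<i>\<close>. With the factor
    \<open>\<i> / 2\<close> this is a real matrix, so the complex number in the claim is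
    real.\<close>
  have last: "sp_herm (sp_scale (\<i> / 2) (cliff_form2 S \<Omega> ?x (\<psi> ?x))) (sp_div_norm2 (\<psi> ?x)) =
      of_real (- dc / 2 * (P y \<bullet> P y - M y \<bullet> M y) / \<rho> y)"
    unfolding cliff_form2_def Let_def frame[symmetric] dn unfolding rep[OF y] cl sp_scale_class sp_herm_class dc_def[symmetric] hermitian_linear
    unfolding hermitian_sum cl_axis vector_2 P_def M_def
    using \<rho>y by (simp add: inner_complex_def complex_eq_iff field_simps)
  have "L * \<rho> y = - (G11 + G22) + (NP fr1 y \<bullet> NP fr1 y + NM fr1 y \<bullet> NM fr1 y + NP fr2 y \<bullet> NP fr2 y + NM fr2 y \<bullet> NM fr2 y)
      + om y ?e1 * g fr2 y - om y ?e2 * g fr1 y - (dc + do') / 2 * (P y \<bullet> P y) + (dc - do') / 2 * (M y \<bullet> M y)"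
    using main unfolding G11_def G22_def \<rho>_def g_def .
  from energy_momentum_identity[OF \<rho>_def[of y] \<rho>y g_def[of fr1 y] g_def[of fr2 y] B Y1_def Y2_def this]
  show ?thesis
    unfolding scal T2 Q2 lap YY Yf last of_real_add[symmetric] of_real_eq_iff by simp
qed

end

theorem theorem3p1:
  fixes S :: "('m::{t2_space, second_countable_topology}, 'p::{t2_space, second_countable_topology},
               'q::{t2_space, second_countable_topology}) spinc_data"
    and \<Omega> :: "('m, 2) bilin"
    and \<psi> :: "'m \<Rightarrow> 'p spinor"
    and lam :: real
    and f :: "'m \<Rightarrow> real"
    and Y :: "'m \<Rightarrow> ('m, 2) tvec"
  assumes "spinc_surface S"
    and "curvature_form S \<Omega>"
    and "eigenspinor_dirac_sq S \<psi> (lam\<^sup>2)"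
    and "\<And>x. sp_norm2 (\<psi> x) \<noteq> 0 \<Longrightarrow> f x = 1 / 2 * ln (sp_norm2 (\<psi> x))"
    and "\<And>x. sp_norm2 (\<psi> x) \<noteq> 0 \<Longrightarrow> Y x \<in> tangent_space (M_atlas S) x"
    and "\<And>x Z. sp_norm2 (\<psi> x) \<noteq> 0 \<Longrightarrow> Z \<in> tangent_space (M_atlas S) x \<Longrightarrow>
           metric S x (Y x) Z = 1 / sp_norm2 (\<psi> x) * Re (sp_herm (dirac S \<psi> x) (cliff S Z (\<psi> x)))"
  shows "\<forall>x. sp_norm2 (\<psi> x) \<noteq> 0 \<longrightarrow>
    complex_of_real (lam\<^sup>2) =
      of_real (scalar_curvature (M_atlas S) (metric S) x / 4
        + tensor_norm2 S (T_tensor S \<psi>) x + tensor_norm2 S (Q_tensor S \<psi>) x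
        + laplacian (M_atlas S) (metric S) f x
        + metric S x (Y x) (Y x) - 2 * tdiff (M_atlas S) f x (Y x))
      + sp_herm (sp_scale (\<i> / 2) (cliff_form2 S \<Omega> x (\<psi> x))) (sp_div_norm2 (\<psi> x))"
proof (intro allI impI)
  fix x assume nz: "sp_norm2 (\<psi> x) \<noteq> 0"
  interpret spinc S by (rule spinc.intro[OF assms(1)])
  \<comment> \<open>A point over the frame that is selected at \<open>x\<close>. The section through
    it satisfies the hypothesis \<open>frame\<close> of \<open>bochner_at\<close> by
    construction.\<close>
  obtain p0 where p0: "P_proj S p0 = x" "theta_frame S p0 = on_frame S x" by (rule on_frame_lift)
  define c where "c = chart_at (M_atlas S) x"
  have cM: "c \<in> M_atlas S" "x \<in> fst c" using chart_at_in[OF atlases(1), of x] by (simp_all add: c_def charts_at_def)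
  obtain W Psi where loc: "spinc_local S c W Psi" "snd c x \<in> W" "Psi (snd c x, 0, 0) = p0"
    using local_parametrization[OF cM(1), of p0, unfolded p0(1), OF cM(2)] by blast
  interpret spinc_local S c W Psi by (rule loc(1))
  have x: "chart_inv c (snd c x) = x" by (rule chart_inv_snd[OF atlases(1) cM])
  note bochner = bochner_at[where \<psi> = \<psi> and f = f and Y = Y and \<Omega> = \<Omega>, OF loc(2), unfolded x]
  show "complex_of_real (lam\<^sup>2) =
      of_real (scalar_curvature (M_atlas S) (metric S) x / 4
        + tensor_norm2 S (T_tensor S \<psi>) x + tensor_norm2 S (Q_tensor S \<psi>) x
        + laplacian (M_atlas S) (metric S) f x
        + metric S x (Y x) (Y x) - 2 * tdiff (M_atlas S) f x (Y x))
      + sp_herm (sp_scale (\<i> / 2) (cliff_form2 S \<Omega> x (\<psi> x))) (sp_div_norm2 (\<psi> x))"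
    by (rule bochner[OF c_def _ assms(2,3,4) assms(5)[OF nz] assms(6)[OF nz] nz])
      (use p0(2) loc(3) in \<open>simp_all add: sec_def\<close>)
qed

end
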